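(* Let $n\geq 8$ and let $G$ be a graph attaining the maximum spectral radius among all connected nonregular graphs on $n$ vertices with maximum degree $3$. Then $G$ has degree sequence $(3,\ldots,3,\delta)$ (i.e. all vertices but one have degree $3$ and the remaining vertex has degree $\delta$), where $\delta=2$ if $n$ is odd and $\delta=1$ if $n$ is even.
   Context: All graphs are finite, simple and undirected. The spectral radius of a graph is the largest eigenvalue of its adjacency matrix. A graph is nonregular if not all its vertices have the same degree. *)

theory Defs
  imports
    "Jordan_Normal_Form.Spectral_Radius"
    "Graph_Theory.Digraph_Component"
begin

text \<open>
  A finite simple undirected graph is a \<^locale>\<open>pair_graph\<close>: a finite loop-free digraph without
  parallel arcs whose arc set is symmetric, so that every undirected edge is represented by the two
  opposite arcs. In such a graph \<^const>\<open>out_degree\<close> counts the neighbours of a vertex, i.e. it is the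
  degree.
\<close>

definition maximum_degree :: "'a pair_pre_digraph \<Rightarrow> nat" where
  "maximum_degree G = Max (out_degree (with_proj G) ` pverts G)"

definition nonregular :: "'a pair_pre_digraph \<Rightarrow> bool" where
  "nonregular G \<longleftrightarrow>
     (\<exists>u\<in>pverts G. \<exists>v\<in>pverts G. out_degree (with_proj G) u \<noteq> out_degree (with_proj G) v)"

text \<open>The adjacency matrix with respect to the ordering \<open>vs\<close> of the vertices.\<close>

definition adjacency_matrix :: "'a pair_pre_digraph \<Rightarrow> 'a list \<Rightarrow> real mat" where
  "adjacency_matrix G vs =
     mat (length vs) (length vs) (\<lambda>(i, j). if (vs ! i, vs ! j) \<in> parcs G then 1 else 0)"

text \<open>
  The largest eigenvalue of the adjacency matrix. Since that matrix is real symmetric, all its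
  complex eigenvalues are real, so it suffices to consider its spectrum over the reals. The chosen
  vertex ordering is immaterial, see \<open>graph_spectral_radius_eq\<close> below.
\<close>

definition graph_spectral_radius :: "'a pair_pre_digraph \<Rightarrow> real" where
  "graph_spectral_radius G =
     Max (spectrum (adjacency_matrix G (SOME vs. distinct vs \<and> set vs = pverts G)))"

lemma adjacency_matrix_mult_vec:
  assumes "distinct vs" "i < length vs"
  shows "(adjacency_matrix G vs *\<^sub>v vec (length vs) (\<lambda>i. f (vs ! i))) $ i
    = (\<Sum>w | w \<in> set vs \<and> (vs ! i, w) \<in> parcs G. f w)"
proof -
  have "(adjacency_matrix G vs *\<^sub>v vec (length vs) (\<lambda>i. f (vs ! i))) $ i
      = (\<Sum>j<length vs. if (vs ! i, vs ! j) \<in> parcs G then f (vs ! j) else 0)"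
    using assms(2) by (auto simp: adjacency_matrix_def scalar_prod_def lessThan_atLeast0 intro!: sum.cong)
  also have "\<dots> = (\<Sum>w\<in>set vs. if (vs ! i, w) \<in> parcs G then f w else 0)"
    using assms(1) by (intro sum.reindex_bij_betw bij_betw_nth) auto
  also have "\<dots> = (\<Sum>w | w \<in> set vs \<and> (vs ! i, w) \<in> parcs G. f w)"
    by (simp add: sum.If_cases Int_def)
  finally show ?thesis .
qed

lemma spectrum_adjacency_matrix:
  assumes "distinct vs"
  shows "spectrum (adjacency_matrix G vs) = {k. \<exists>f. (\<exists>u\<in>set vs. f u \<noteq> 0) \<and>
    (\<forall>u\<in>set vs. (\<Sum>w | w \<in> set vs \<and> (u, w) \<in> parcs G. f w) = k * f u)}" (is "_ = {k. ?P k}")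
proof (intro Set.set_eqI iffI)
  let ?A = "adjacency_matrix G vs" and ?n = "length vs"
  have dim: "dim_row ?A = ?n" by (simp add: adjacency_matrix_def)
  have bij: "bij_betw ((!) vs) {..<?n} (set vs)"
    using assms by (intro bij_betw_nth) auto
  {
    fix k assume "k \<in> spectrum ?A"
    then obtain x where x: "x \<in> carrier_vec ?n" "x \<noteq> 0\<^sub>v ?n" "?A *\<^sub>v x = k \<cdot>\<^sub>v x"
      by (auto simp: spectrum_def eigenvalue_def eigenvector_def dim)
    define f where "f = (\<lambda>u. x $ (the_inv_into {..<?n} ((!) vs) u))"
    have f: "f (vs ! i) = x $ i" if "i < ?n" for i
      using that bij unfolding f_def by (subst the_inv_into_f_f) (auto simp: bij_betw_def)
    have xf: "x = vec ?n (\<lambda>i. f (vs ! i))"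
      using x(1) f by (intro eq_vecI) auto
    obtain i where "i < ?n" "x $ i \<noteq> 0"
      using x(1,2) by (metis carrier_vecD eq_vecI index_zero_vec(1,2))
    then have "\<exists>u\<in>set vs. f u \<noteq> 0"
      using f by (metis nth_mem)
    moreover have "(\<Sum>w | w \<in> set vs \<and> (u, w) \<in> parcs G. f w) = k * f u" if "u \<in> set vs" for u
    proof -
      from that obtain i where i: "i < ?n" "u = vs ! i" by (auto simp: in_set_conv_nth)
      show ?thesis
        using adjacency_matrix_mult_vec[OF assms i(1), of G f] x(1,3) i f by (simp flip: xf)
    qed
    ultimately show "k \<in> {k. ?P k}" by blast
  next
    fix k assume "k \<in> {k. ?P k}"
    then obtain f u where f: "u \<in> set vs" "f u \<noteq> 0"
      "\<And>u. u \<in> set vs \<Longrightarrow> (\<Sum>w | w \<in> set vs \<and> (u, w) \<in> parcs G. f w) = k * f u" by blast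
    let ?x = "vec ?n (\<lambda>i. f (vs ! i))"
    have "?x \<noteq> 0\<^sub>v ?n"
      using f(1,2) by (metis in_set_conv_nth index_vec index_zero_vec(1))
    moreover have "?A *\<^sub>v ?x = k \<cdot>\<^sub>v ?x"
      using adjacency_matrix_mult_vec[OF assms, of _ G f] f(3) by (intro eq_vecI) (auto simp: dim)
    ultimately show "k \<in> spectrum ?A"
      by (auto simp: spectrum_def eigenvalue_def eigenvector_def dim intro!: exI[of _ ?x])
  }
qed

lemma graph_spectral_radius_eq:
  assumes "distinct vs" "set vs = pverts G"
  shows "graph_spectral_radius G = Max (spectrum (adjacency_matrix G vs))"
proof -
  let ?ws = "SOME vs. distinct vs \<and> set vs = pverts G"
  have "distinct ?ws \<and> set ?ws = pverts G"
    by (rule someI[where x = vs]) (use assms in simp)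
  then show ?thesis
    using assms unfolding graph_spectral_radius_def by (simp add: spectrum_adjacency_matrix)
qed

definition connected_nonregular_graph :: "nat \<Rightarrow> nat \<Rightarrow> 'a pair_pre_digraph \<Rightarrow> bool" where
  "connected_nonregular_graph n \<Delta> G \<longleftrightarrow>
     pair_graph G \<and> card (pverts G) = n \<and> Digraph_Component.connected (with_proj G) \<and>
     nonregular G \<and> maximum_degree G = \<Delta>"

text \<open>
  Competitors range over graphs with vertices in the same type as those of \<open>G\<close>. As the vertex set of
  \<open>G\<close> itself has \<open>n\<close> elements in that type, every graph on \<open>n\<close> vertices has an isomorphic copy there.
\<close>

definition attains_max_spectral_radius :: "nat \<Rightarrow> nat \<Rightarrow> 'a pair_pre_digraph \<Rightarrow> bool" where
  "attains_max_spectral_radius n \<Delta> G \<longleftrightarrow>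
     connected_nonregular_graph n \<Delta> G \<and>
     (\<forall>H :: 'a pair_pre_digraph. connected_nonregular_graph n \<Delta> H \<longrightarrow>
        graph_spectral_radius H \<le> graph_spectral_radius G)"

end

theory Submission
  imports Defs "HOL-Analysis.Function_Topology"
begin

text \<open>
  Let \<open>x\<close> be the Perron vector of an extremal graph and \<open>\<epsilon> = 3 - \<mu>\<close>, where \<open>\<mu>\<close> is the spectral radius.
  Since \<open>\<mu>\<close> is the maximum of the Rayleigh quotient, no competitor may have a test vector with a larger
  quotient. Adding edges shows that, unless a single vertex has degree less than 3, exactly two vertices
  do, either both of degree 2 or adjacent of degrees 2 and 1. The first case is refuted by local
  modifications of the graph.

  The second case needs a global comparison. Read \<open>x\<close> as a potential: the flow through the cut between
  the \<open>k\<close> vertices of smallest value and the rest is \<open>\<epsilon>\<close> times the sum of the remaining values. By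
  parity and simplicity, cuts after an odd number of vertices have at least two edges, and no two
  consecutive cuts after an even number of vertices are bridges. Hence the ratio of potential to flow
  grows at most as fast as along a chain of diamonds (\<open>K\<^sub>4\<close> minus an edge) joined by bridges, where it is
  governed by a linear map \<open>T\<close> of determinant 1. A chain of diamonds that starts with one vertex
  of degree 2 and has the same number of vertices is governed by the same \<open>T\<close>, and continuing its potential
  by a constant once the flow is small yields a test vector with Rayleigh quotient larger than \<open>\<mu>\<close>.
\<close>

section \<open>Graphs and quadratic forms\<close>

text \<open>Why an orbit in the plane suffices: the flow through a cut equals \<epsilon> times the
  sum of the values behind it, so a pair (potential, flow) bounds how far the next step can raise
  the potential. Pairs are ordered by the sign of a 2x2 determinant. Maps of determinant 1 preserve
  this order, so one-step estimates can be iterated without solving the recursion. Neither are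
  closed forms needed for the two chains of diamonds: three vectors of the plane are dependent, and
  the dependency between the two start vectors and the image of one of them is carried along by
  \<open>T\<close>.

  The obstacle is that the comparison orbit may run out of flow while vertices are left over. The
  test vector therefore follows the orbit only as long as its flow is positive and is constant
  afterwards, at the value that the next exact step would give. This gains as soon as the remaining
  vertices would take more than the flow that is left. The polynomial inequalities behind this hold
  only for small \<epsilon>; the smallness comes from a cruder test vector, 1 everywhere except for
  2/3 at the root.\<close>

locale simple_graph =
  fixes V :: "'a set" and E :: "'a rel"
  assumes finite_V: "finite V" and E_subset: "E \<subseteq> V \<times> V" and sym_E: "sym E" and irrefl_E: "irrefl E"

definition vdegree :: "'a rel \<Rightarrow> 'a \<Rightarrow> nat" where
  "vdegree E v = card (E `` {v})"

text \<open>Connectivity as the absence of proper closed vertex sets, which for symmetric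
  \<open>E\<close> is the usual notion. A contradiction then needs only a small closed set.\<close>

definition connected_graph :: "'a set \<Rightarrow> 'a rel \<Rightarrow> bool" where
  "connected_graph V E \<longleftrightarrow> V \<noteq> {} \<and> (\<forall>S\<subseteq>V. S \<noteq> {} \<and> E `` S \<subseteq> S \<longrightarrow> S = V)"

text \<open>The quadratic form of the adjacency matrix. The sum runs over arcs, so an undirected
  edge contributes \<open>2 * f a * f b\<close>.\<close>

definition adj_form :: "'a rel \<Rightarrow> ('a \<Rightarrow> real) \<Rightarrow> real" where
  "adj_form E f = (\<Sum>(a, b)\<in>E. f a * f b)"

definition edge :: "'a \<Rightarrow> 'a \<Rightarrow> 'a rel" where
  "edge a b = {(a, b), (b, a)}"

definition competitor :: "'a set \<Rightarrow> 'a rel \<Rightarrow> bool" where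
  "competitor V E \<longleftrightarrow> simple_graph V E \<and> connected_graph V E \<and> (\<forall>v\<in>V. vdegree E v \<le> 3)
     \<and> (\<exists>v\<in>V. vdegree E v = 3) \<and> (\<exists>v\<in>V. vdegree E v < 3)"

lemma connected_graphD:
  assumes "connected_graph V E" "S \<subseteq> V" "S \<noteq> {}" "\<And>a b. (a, b) \<in> E \<Longrightarrow> a \<in> S \<Longrightarrow> b \<in> S"
  shows "S = V"
  using assms unfolding connected_graph_def by blast

lemma connected_graph_mono:
  assumes "connected_graph V E" and "\<And>a b. (a, b) \<in> E \<Longrightarrow> (a, b) \<in> E'\<^sup>*"
  shows "connected_graph V E'"
  unfolding connected_graph_def
proof (intro conjI allI impI)
  show "V \<noteq> {}" using assms by (simp add: connected_graph_def)
  fix S assume S: "S \<subseteq> V" "S \<noteq> {} \<and> E' `` S \<subseteq> S"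
  have closed: "b \<in> S" if "(a, b) \<in> E'\<^sup>*" "a \<in> S" for a b
    using that(1)
  proof induction
    case (step b c)
    then show ?case using S by blast
  qed (rule that(2))
  show "S = V"
    using S by (intro connected_graphD[OF assms(1)]) (auto intro: closed[OF assms(2)])
qed

text \<open>Arcs inside \<open>S\<close> come in opposite pairs. For the whole vertex set this is
  the handshake lemma; for initial segments of the sorted vertices it gives the parity of
  cuts.\<close>

lemma even_card_sym:
  assumes "finite S" "sym E" "irrefl E"
  shows "even (card (E \<inter> S \<times> S))"
  using assms(1)
proof induction
  case empty
  then show ?case by simp
next
  case (insert s S)
  let ?N = "{t\<in>S. (s, t) \<in> E}"
  have "E \<inter> insert s S \<times> insert s S = E \<inter> S \<times> S \<union> (Pair s ` ?N \<union> (\<lambda>t. (t, s)) ` ?N)"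
    using assms by (auto simp: irrefl_def intro: symD[OF assms(2)])
  moreover have "card (E \<inter> S \<times> S \<union> (Pair s ` ?N \<union> (\<lambda>t. (t, s)) ` ?N))
    = card (E \<inter> S \<times> S) + card (Pair s ` ?N \<union> (\<lambda>t. (t, s)) ` ?N)"
    using insert by (intro card_Un_disjoint) auto
  moreover have "card (Pair s ` ?N \<union> (\<lambda>t. (t, s)) ` ?N) = card (Pair s ` ?N) + card ((\<lambda>t. (t, s)) ` ?N)"
    using insert by (intro card_Un_disjoint) auto
  moreover have "card (Pair s ` ?N) = card ?N" "card ((\<lambda>t. (t, s)) ` ?N) = card ?N"
    by (auto intro!: card_image inj_onI)
  ultimately show ?case using insert by simp
qed

lemma edge_simps [simp]:
  "(x, y) \<in> edge a b \<longleftrightarrow> x = a \<and> y = b \<or> x = b \<and> y = a"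
  by (auto simp: edge_def)

lemma edge_Image:
  "(E \<union> edge a b) `` {v} = E `` {v} \<union> (if v = a then {b} else {}) \<union> (if v = b then {a} else {})"
  "(E - edge a b) `` {v} = E `` {v} - (if v = a then {b} else {}) - (if v = b then {a} else {})"
  by (auto simp: edge_def)

context simple_graph
begin

lemma sym_iff: "(a, b) \<in> E \<longleftrightarrow> (b, a) \<in> E"
  using symD[OF sym_E] by blast

lemma no_loop [simp]: "(a, a) \<notin> E"
  using irrefl_E by (auto simp: irrefl_def)

lemma edge_in_V: "(a, b) \<in> E \<Longrightarrow> a \<in> V" "(a, b) \<in> E \<Longrightarrow> b \<in> V"
  using E_subset by auto

lemma finite_E: "finite E"
  using finite_subset[OF E_subset] finite_V by auto

lemma finite_nbrs: "finite (E `` {v})"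
  using finite_E by (rule finite_Image)

lemma nbrs_subset: "E `` {v} \<subseteq> V"
  using E_subset by auto

lemma E_Sigma: "E = (SIGMA v:V. E `` {v})"
  using E_subset by auto

lemma sum_E: "(\<Sum>(a, b)\<in>E. g a b) = (\<Sum>v\<in>V. \<Sum>w\<in>E `` {v}. g v w)" for g :: "'a \<Rightarrow> 'a \<Rightarrow> 'b :: comm_monoid_add"
  by (subst E_Sigma) (simp add: sum.Sigma finite_V finite_nbrs)

lemma sum_E_swap: "(\<Sum>(a, b)\<in>E. g b a) = (\<Sum>(a, b)\<in>E. g a b)" for g :: "'a \<Rightarrow> 'a \<Rightarrow> 'b :: comm_monoid_add"
  by (rule sum.reindex_bij_witness[of _ prod.swap prod.swap]) (auto intro: symD[OF sym_E])

lemma adj_form_nbrs: "adj_form E f = (\<Sum>v\<in>V. f v * (\<Sum>w\<in>E `` {v}. f w))"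
  unfolding adj_form_def sum_E by (simp add: sum_distrib_left)

lemma sum_vdegree: "(\<Sum>v\<in>V. vdegree E v) = card E"
  using sum_E[of "\<lambda>_ _. 1::nat"] by (simp add: vdegree_def)

lemma even_card_E: "even (card E)"
  using even_card_sym[OF finite_V sym_E irrefl_E] E_subset by (simp add: Int_absorb2)

lemma sum_nbr_sums: "(\<Sum>v\<in>V. \<Sum>w\<in>E `` {v}. f w) = (\<Sum>v\<in>V. real (vdegree E v) * f v)"
proof -
  have "(\<Sum>v\<in>V. \<Sum>w\<in>E `` {v}. f w) = (\<Sum>(a, b)\<in>E. f b)" by (simp add: sum_E)
  also have "\<dots> = (\<Sum>(a, b)\<in>E. f a)" by (rule sum_E_swap)
  finally show ?thesis by (simp add: sum_E vdegree_def)
qed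

lemma add_edge:
  assumes "a \<in> V" "b \<in> V" "a \<noteq> b"
  shows "simple_graph V (E \<union> edge a b)"
  using assms finite_V E_subset sym_E irrefl_E
  by unfold_locales (auto simp: edge_def sym_def irrefl_def)

lemma remove_edge: "simple_graph V (E - edge a b)"
  using finite_V E_subset sym_E irrefl_E
  by unfold_locales (auto simp: edge_def sym_def irrefl_def)

lemma adj_form_add_edge:
  assumes "a \<noteq> b" "(a, b) \<notin> E"
  shows "adj_form (E \<union> edge a b) f = adj_form E f + 2 * f a * f b"
  using assms finite_E sym_iff[of a b] unfolding adj_form_def edge_def
  by (subst sum.union_disjoint) auto

lemma adj_form_remove_edge:
  assumes "(a, b) \<in> E"
  shows "adj_form (E - edge a b) f = adj_form E f - 2 * f a * f b"
proof -
  have "a \<noteq> b" "edge a b \<subseteq> E" using assms sym_iff[of a b] by (auto simp: edge_def)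
  then show ?thesis
    using finite_E unfolding adj_form_def edge_def by (subst sum_diff) auto
qed

lemma sum_sq_pos:
  assumes "v \<in> V" "y v \<noteq> 0"
  shows "0 < (\<Sum>v\<in>V. (y v)^2 :: real)"
  using assms finite_V by (intro sum_pos2[of V v]) auto

lemma adj_form_bump:
  assumes "v \<in> V"
  shows "adj_form E (x(v := x v + t)) = adj_form E x + 2 * t * (\<Sum>w\<in>E `` {v}. x w)"
proof -
  let ?e = "\<lambda>w. if w = v then t else 0"
  have eq: "x(v := x v + t) = (\<lambda>w. x w + ?e w)" by auto
  have "adj_form E (x(v := x v + t)) = adj_form E x + (\<Sum>(a, b)\<in>E. x a * ?e b)
      + (\<Sum>(a, b)\<in>E. ?e a * x b) + (\<Sum>(a, b)\<in>E. ?e a * ?e b)"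
    unfolding adj_form_def eq sum.distrib[symmetric] by (intro sum.cong) (auto simp: algebra_simps)
  moreover have "(\<Sum>(a, b)\<in>E. ?e a * ?e b) = 0" by (intro sum.neutral) auto
  moreover have "(\<Sum>(a, b)\<in>E. x a * ?e b) = (\<Sum>(a, b)\<in>E. ?e a * x b)"
    using sum_E_swap[of "\<lambda>a b. ?e a * x b"] by (simp add: mult.commute)
  moreover have "(\<Sum>(a, b)\<in>E. ?e a * x b) = (\<Sum>u\<in>V. if u = v then t * (\<Sum>w\<in>E `` {v}. x w) else 0)"
    unfolding sum_E by (intro sum.cong) (auto simp: sum_distrib_left)
  ultimately show ?thesis using assms finite_V by (simp add: sum.delta)
qed

text \<open>The change involves only the neighbours of \<open>v\<close>, so a test vector that
  differs from \<open>x\<close> in a few vertices can be evaluated one vertex at a time.\<close>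

lemma adj_form_update:
  assumes "v \<in> V"
  shows "adj_form E (y(v := c)) - \<mu> * (\<Sum>w\<in>V. ((y(v := c)) w)^2)
    = adj_form E y - \<mu> * (\<Sum>w\<in>V. (y w)^2) + 2 * (c - y v) * (\<Sum>w\<in>E `` {v}. y w) - \<mu> * (c^2 - (y v)^2)"
proof -
  have "(\<Sum>w\<in>V. ((y(v := c)) w)^2) = (\<Sum>w\<in>V. (y w)^2) + (c^2 - (y v)^2)"
    using assms finite_V by (simp add: sum.remove[of V v])
  moreover have "adj_form E (y(v := c)) = adj_form E y + 2 * (c - y v) * (\<Sum>w\<in>E `` {v}. y w)"
    using adj_form_bump[OF assms, of y "c - y v"] by simp
  ultimately show ?thesis by (simp only:) (simp add: algebra_simps)
qed

lemma adj_form_cong: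
  assumes "\<And>v. v \<in> V \<Longrightarrow> f v = g v"
  shows "adj_form E f = adj_form E g"
  unfolding adj_form_def
proof (rule sum.cong[OF refl])
  fix e assume e: "e \<in> E"
  then have "fst e \<in> V" "snd e \<in> V" using edge_in_V[of "fst e" "snd e"] by simp_all
  then show "(case e of (a, b) \<Rightarrow> f a * f b) = (case e of (a, b) \<Rightarrow> g a * g b)"
    by (simp add: assms split_beta)
qed

text \<open>First-order condition, one coordinate at a time: moving the value at \<open>v\<close> by
  \<open>t\<close> changes the gap by \<open>2 * t * d - \<mu> * t^2\<close>, where \<open>d\<close>
  is the defect of the eigenvalue equation. This stays nonpositive for all \<open>t\<close> only if
  \<open>d = 0\<close>.\<close>

lemma maximizer_eigenvector:
  assumes bound: "\<And>y. adj_form E y \<le> \<mu> * (\<Sum>v\<in>V. (y v)^2)"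
    and attained: "\<mu> * (\<Sum>v\<in>V. (x v)^2) \<le> adj_form E x" and v: "v \<in> V"
  shows "(\<Sum>w\<in>E `` {v}. x w) = \<mu> * x v"
proof -
  define d where "d = (\<Sum>w\<in>E `` {v}. x w) - \<mu> * x v"
  have key: "2 * t * d \<le> \<mu> * t^2" for t
  proof -
    have sq: "(\<Sum>u\<in>V. ((x(v := x v + t)) u)^2) = (\<Sum>u\<in>V. (x u)^2) + 2 * t * x v + t^2"
    proof -
      have "(\<Sum>u\<in>V. ((x(v := x v + t)) u)^2) = (\<Sum>u\<in>V. (x u)^2 + (if u = v then 2 * t * x v + t^2 else 0))"
        by (intro sum.cong) (auto simp: power2_eq_square algebra_simps)
      then show ?thesis using v finite_V by (simp add: sum.distrib sum.delta)
    qed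
    have "adj_form E (x(v := x v + t)) \<le> \<mu> * (\<Sum>u\<in>V. ((x(v := x v + t)) u)^2)" by (rule bound)
    then show ?thesis
      unfolding sq adj_form_bump[OF v] d_def using attained by (simp add: algebra_simps)
  qed
  have "d = 0"
  proof (rule ccontr)
    assume "d \<noteq> 0"
    then have d2: "0 < d^2" by simp
    \<comment> \<open>A positive number above \<mu>, so that the linear term wins at
      \<open>t = d / c\<close>.\<close>
    define c where "c = \<bar>\<mu>\<bar> + 1"
    have c: "0 < c" "\<mu> < c" by (auto simp: c_def)
    have "2 * (d / c) * d \<le> \<mu> * (d / c)^2" by (rule key)
    then have "2 * d^2 * c \<le> \<mu> * d^2" using c by (simp add: field_simps power2_eq_square)
    also have "\<dots> < c * d^2" using c d2 by (intro mult_strict_right_mono)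
    finally show False using c d2 by (simp add: mult.commute)
  qed
  then show ?thesis by (simp add: d_def)
qed

end

section \<open>Extremal graphs and their Perron vectors\<close>

locale extremal_cubic = simple_graph V E for V :: "'a set" and E +
  fixes x :: "'a \<Rightarrow> real" and \<mu> :: real
  assumes comp: "competitor V E"
    and x_pos: "\<And>v. v \<in> V \<Longrightarrow> 0 < x v"
    and eigen: "\<And>v. v \<in> V \<Longrightarrow> (\<Sum>w\<in>E `` {v}. x w) = \<mu> * x v"
    and opt: "\<And>E' y. competitor V E' \<Longrightarrow> adj_form E' y \<le> \<mu> * (\<Sum>v\<in>V. (y v)^2)"
begin

lemma conn: "connected_graph V E" and deg_le: "v \<in> V \<Longrightarrow> vdegree E v \<le> 3"
  using comp by (auto simp: competitor_def)

lemma form_x: "adj_form E x = \<mu> * (\<Sum>v\<in>V. (x v)^2)"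
  unfolding adj_form_nbrs by (simp add: eigen sum_distrib_left power2_eq_square ac_simps)

text \<open>A competitor whose form at \<open>x\<close> is not smaller also has \<open>x\<close> as
  a maximizer of its Rayleigh quotient. Hence \<open>x\<close> satisfies the eigenvalue equations of
  both graphs, which fails at a vertex whose neighbour sum has changed.\<close>

lemma improve:
  assumes "competitor V E'" "adj_form E x \<le> adj_form E' x" "v \<in> V"
  shows "(\<Sum>w\<in>E' `` {v}. x w) = \<mu> * x v"
proof -
  interpret E': simple_graph V E' using assms by (simp add: competitor_def)
  show ?thesis
    by (rule E'.maximizer_eigenvector) (use assms opt form_x in auto)
qed

lemma sum_x_pos: "0 < (\<Sum>v\<in>V. x v)"
  using conn finite_V x_pos by (intro sum_pos) (auto simp: connected_graph_def)

lemma mu_less_3: "\<mu> < 3"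
proof -
  obtain v where v: "v \<in> V" "vdegree E v < 3" using comp by (auto simp: competitor_def)
  have "\<mu> * (\<Sum>v\<in>V. x v) = (\<Sum>v\<in>V. real (vdegree E v) * x v)"
    using sum_nbr_sums[of x] by (simp add: eigen sum_distrib_left)
  also have "\<dots> < (\<Sum>v\<in>V. 3 * x v)"
    using v x_pos deg_le finite_V by (intro sum_strict_mono_ex1 bexI[of _ v]) auto
  finally have "\<mu> * (\<Sum>v\<in>V. x v) < 3 * (\<Sum>v\<in>V. x v)" by (simp add: sum_distrib_left)
  then show ?thesis using sum_x_pos by simp
qed

text \<open>The constant test vector; this is the source of the bounds
  \<open>2 < \<mu>\<close>.\<close>

lemma average_degree: "real (card E) \<le> \<mu> * real (card V)"
proof -
  have "adj_form E (\<lambda>_. 1) \<le> \<mu> * (\<Sum>v\<in>V. 1^2)" by (rule opt[OF comp])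
  then show ?thesis by (simp add: adj_form_def case_prod_unfold)
qed

text \<open>The edge \<open>uv\<close> would add \<open>2 * x u * x v > 0\<close> to the form, so
  the enlarged graph is no competitor. As it is connected with maximum degree 3, it can only fail by
  being 3-regular.\<close>

lemma nonadjacent_deficient:
  assumes uv: "u \<in> V" "v \<in> V" "u \<noteq> v" "(u, v) \<notin> E" "vdegree E u < 3" "vdegree E v < 3"
  shows "vdegree E u = 2" "vdegree E v = 2" "\<And>w. w \<in> V \<Longrightarrow> w \<noteq> u \<Longrightarrow> w \<noteq> v \<Longrightarrow> vdegree E w = 3"
proof -
  let ?E = "E \<union> edge u v"
  interpret E': simple_graph V ?E using uv by (intro add_edge) auto
  have deg: "vdegree ?E u = vdegree E u + 1" "vdegree ?E v = vdegree E v + 1"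
    "w \<noteq> u \<Longrightarrow> w \<noteq> v \<Longrightarrow> vdegree ?E w = vdegree E w" for w
    using uv sym_iff[of u v] finite_nbrs by (auto simp: vdegree_def edge_Image)
  have le: "vdegree ?E w \<le> 3" if "w \<in> V" for w
    using deg_le[OF that] uv deg by (cases "w = u"; cases "w = v") auto
  have "\<not> competitor V ?E"
  proof
    assume c: "competitor V ?E"
    have f: "adj_form ?E x = adj_form E x + 2 * x u * x v"
      using uv by (intro adj_form_add_edge) auto
    moreover have "adj_form ?E x \<le> \<mu> * (\<Sum>v\<in>V. (x v)^2)" by (rule opt[OF c])
    moreover have "0 < x u * x v" using uv x_pos by simp
    ultimately show False using form_x by simp
  qed
  moreover have "connected_graph V ?E" by (rule connected_graph_mono[OF conn]) auto
  moreover obtain w where "w \<in> V" "vdegree E w = 3" using comp by (auto simp: competitor_def)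
  moreover have "vdegree ?E w = 3" if "vdegree E w = 3" for w using that deg(3)[of w] uv by (cases "w = u \<or> w = v") auto
  ultimately have all: "w \<in> V \<Longrightarrow> vdegree ?E w = 3" for w
    using le E'.simple_graph_axioms unfolding competitor_def by (metis le_neq_implies_less)
  show "vdegree E u = 2" "vdegree E v = 2" using all[of u] all[of v] deg uv by auto
  show "\<And>w. w \<in> V \<Longrightarrow> w \<noteq> u \<Longrightarrow> w \<noteq> v \<Longrightarrow> vdegree E w = 3" using all deg by metis
qed

end

section \<open>Perron vectors\<close>

context simple_graph
begin

lemma adj_form_abs: "adj_form E f \<le> adj_form E (\<lambda>v. \<bar>f v\<bar>)"
  unfolding adj_form_def by (intro sum_mono) (auto simp flip: abs_mult)

lemma adj_form_scale: "adj_form E (\<lambda>v. c * f v) = c^2 * adj_form E f"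
  unfolding adj_form_def sum_distrib_left by (intro sum.cong) (auto simp: power2_eq_square)

text \<open>Functions live on the whole type, so they are pinned to 0 outside \<open>V\<close>. This
  makes the sphere a closed subset of a product of compact sets, to which Tychonoff's theorem
  applies.\<close>

lemma compact_unit_functions:
  "compact {f :: 'a \<Rightarrow> real. (\<forall>v. v \<notin> V \<longrightarrow> f v = 0) \<and> (\<Sum>v\<in>V. (f v)^2) = 1}" (is "compact ?S")
proof -
  let ?B = "\<lambda>v. if v \<in> V then {-1..1::real} else {0}"
  have "compactin (product_topology (\<lambda>_. euclidean) UNIV) (PiE UNIV ?B)"
    by (subst compactin_PiE) auto
  then have c: "compact (PiE UNIV ?B)"
    by (simp add: euclidean_product_topology)
  have "closed {f :: 'a \<Rightarrow> real. (\<Sum>v\<in>V. (f v)^2) = 1}"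
    by (intro closed_Collect_eq continuous_intros continuous_on_product_coordinates)
  then have "compact (PiE UNIV ?B \<inter> {f. (\<Sum>v\<in>V. (f v)^2) = 1})"
    by (rule compact_Int_closed[OF c])
  moreover have "?S = PiE UNIV ?B \<inter> {f. (\<Sum>v\<in>V. (f v)^2) = 1}"
  proof (intro equalityI subsetI)
    fix f assume f: "f \<in> ?S"
    have "\<bar>f v\<bar> \<le> 1" if "v \<in> V" for v
    proof -
      have "(f v)^2 \<le> (\<Sum>v\<in>V. (f v)^2)" using that finite_V by (intro member_le_sum) auto
      then show ?thesis using f by (simp add: abs_square_le_1)
    qed
    then show "f \<in> PiE UNIV ?B \<inter> {f. (\<Sum>v\<in>V. (f v)^2) = 1}"
      using f by (auto simp: PiE_def Pi_def abs_le_iff minus_le_iff)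
  qed (auto simp: PiE_def Pi_def split: if_splits)
  ultimately show ?thesis by simp
qed

text \<open>A maximizer of the form on the unit sphere may be replaced by its absolute value, which
  does not lower the form. The zero set of the result is closed under neighbours, because a
  vanishing sum of nonnegative values has only zero terms; by connectivity it would be everything,
  against norm 1.\<close>

lemma perron:
  assumes conn: "connected_graph V E"
  obtains x :: "'a \<Rightarrow> real" and \<mu> where "\<And>v. v \<in> V \<Longrightarrow> 0 < x v"
    "\<And>v. v \<in> V \<Longrightarrow> (\<Sum>w\<in>E `` {v}. x w) = \<mu> * x v"
    "\<And>y. adj_form E y \<le> \<mu> * (\<Sum>v\<in>V. (y v)^2)"
proof -
  let ?S = "{f :: 'a \<Rightarrow> real. (\<forall>v. v \<notin> V \<longrightarrow> f v = 0) \<and> (\<Sum>v\<in>V. (f v)^2) = 1}"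
  obtain u where u: "u \<in> V" using conn by (auto simp: connected_graph_def)
  have "(\<lambda>v. if v = u then 1 else 0) \<in> ?S"
  proof -
    have "(\<Sum>v\<in>V. (if v = u then 1 else 0 :: real)^2) = (\<Sum>v\<in>V. if v = u then 1 else 0)"
      by (intro sum.cong) auto
    also have "\<dots> = 1" using u finite_V by (simp add: sum.delta)
    finally show ?thesis using u by (intro CollectI conjI) auto
  qed
  then have ne: "?S \<noteq> {}" by (rule ex_in_conv[THEN iffD1, OF exI])
  have cont: "continuous_on ?S (adj_form E)"
    unfolding adj_form_def case_prod_unfold
    by (intro continuous_intros continuous_on_subset[OF continuous_on_product_coordinates]) auto
  obtain f where f: "f \<in> ?S" and max': "\<forall>g\<in>?S. adj_form E g \<le> adj_form E f"
    using continuous_attains_sup[OF compact_unit_functions ne cont] by (elim bexE)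
  have max: "adj_form E g \<le> adj_form E f" if "g \<in> ?S" for g
    by (rule bspec[OF max' that])
  define \<mu> where "\<mu> = adj_form E f"
  define x where "x = (\<lambda>v. \<bar>f v\<bar>)"
  have bound: "adj_form E y \<le> \<mu> * (\<Sum>v\<in>V. (y v)^2)" for y
  proof (cases "\<forall>v\<in>V. y v = 0")
    case True
    then have "adj_form E y = 0" by (auto simp: adj_form_def dest: edge_in_V intro!: sum.neutral)
    then show ?thesis using True by simp
  next
    case False
    then obtain v where v: "v \<in> V" "y v \<noteq> 0" by blast
    define N where "N = (\<Sum>v\<in>V. (y v)^2)"
    have N: "0 < N" unfolding N_def using v by (rule sum_sq_pos)
    define g where "g = (\<lambda>v. if v \<in> V then (1 / sqrt N) * y v else 0)"
    have "(\<Sum>v\<in>V. (g v)^2) = (\<Sum>v\<in>V. (y v)^2 / N)"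
      using N by (intro sum.cong) (auto simp: g_def power_mult_distrib power_divide)
    also have "\<dots> = 1" using N by (simp add: sum_divide_distrib[symmetric] N_def)
    finally have "g \<in> ?S" by (auto simp: g_def)
    then have "adj_form E g \<le> \<mu>" using max by (simp add: \<mu>_def)
    moreover have "adj_form E g = adj_form E (\<lambda>v. (1 / sqrt N) * y v)"
      by (rule adj_form_cong) (simp add: g_def)
    moreover have "\<dots> = adj_form E y / N" using N by (simp only: adj_form_scale) (simp add: power_divide)
    ultimately have "adj_form E y / N \<le> \<mu>" by simp
    then show ?thesis using N by (simp add: pos_divide_le_eq N_def[symmetric])
  qed
  have att: "\<mu> * (\<Sum>v\<in>V. (x v)^2) \<le> adj_form E x"
    using adj_form_abs[of f] f by (simp add: x_def \<mu>_def)
  have eig: "(\<Sum>w\<in>E `` {v}. x w) = \<mu> * x v" if "v \<in> V" for v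
    using maximizer_eigenvector[OF bound att that] .
  have pos: "0 < x v" if "v \<in> V" for v
  proof (rule ccontr)
    assume "\<not> 0 < x v"
    then have "x v = 0" by (simp add: x_def)
    define Z where "Z = {v\<in>V. x v = 0}"
    have "Z = V"
    proof (rule connected_graphD[OF conn])
      fix a b assume ab: "(a, b) \<in> E" "a \<in> Z"
      then have "(\<Sum>w\<in>E `` {a}. x w) = 0" using eig[of a] by (simp add: Z_def)
      then have "\<forall>w\<in>E `` {a}. x w = 0"
        using finite_nbrs by (subst (asm) sum_nonneg_eq_0_iff) (auto simp: x_def)
      then show "b \<in> Z" using ab by (auto simp: Z_def dest: edge_in_V)
    qed (use \<open>x v = 0\<close> that in \<open>auto simp: Z_def\<close>)
    then have "(\<Sum>v\<in>V. (f v)^2) = 0" by (intro sum.neutral) (auto simp: Z_def x_def)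
    then show False using f by simp
  qed
  show thesis by (rule that[OF pos eig bound])
qed

end

section \<open>Translation from digraphs and adjacency matrices\<close>

lemma pair_graph_iff: "pair_graph G \<longleftrightarrow> simple_graph (pverts G) (parcs G)"
proof
  assume "pair_graph G"
  then interpret pair_graph G .
  show "simple_graph (pverts G) (parcs G)"
  proof
    show "finite (pverts G)" by (rule pair_finite_verts)
    show "parcs G \<subseteq> pverts G \<times> pverts G" using in_arcsD1 in_arcsD2 by auto
    show "sym (parcs G)" using arcs_symmetric by (intro symI)
    show "irrefl (parcs G)" using pair_no_loops[of "(a, a)" for a] by (auto simp: irrefl_def)
  qed
next
  assume "simple_graph (pverts G) (parcs G)"
  then interpret simple_graph "pverts G" "parcs G" .
  show "pair_graph G"
    using finite_V finite_E sym_E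
    by unfold_locales (auto simp: symmetric_def dest: edge_in_V)
qed

lemma out_degree_with_proj: "out_degree (with_proj G) v = vdegree (parcs G) v"
proof -
  have "out_arcs (with_proj G) v = Pair v ` (parcs G `` {v})" by (auto simp: out_arcs_def)
  then show ?thesis by (simp add: out_degree_def vdegree_def card_image inj_on_def)
qed

lemma connected_with_proj:
  assumes "simple_graph (pverts G) (parcs G)"
  shows "Digraph_Component.connected (with_proj G) \<longleftrightarrow> connected_graph (pverts G) (parcs G)"
proof -
  interpret simple_graph "pverts G" "parcs G" by fact
  interpret G: pair_graph G using assms by (simp add: pair_graph_iff)
  let ?V = "pverts G" and ?E = "parcs G"
  have symcl: "?E\<^sup>s = ?E" by (auto simp: symcl_def intro: symD[OF sym_E])
  have conv: "Digraph_Component.connected (with_proj G) \<longleftrightarrow>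
    ?V \<noteq> {} \<and> (\<forall>u\<in>?V. \<forall>v\<in>?V. (u, v) \<in> rtrancl_on ?V ?E)"
    using connected_conv[of "with_proj G"] by (simp add: symcl)
  show ?thesis unfolding conv connected_graph_def
  proof (intro conj_cong refl iffI allI impI)
    fix S assume all: "\<forall>u\<in>?V. \<forall>v\<in>?V. (u, v) \<in> rtrancl_on ?V ?E"
      and S: "S \<subseteq> ?V" "S \<noteq> {} \<and> ?E `` S \<subseteq> S"
    then obtain s where s: "s \<in> S" by auto
    have "v \<in> S" if "(s, v) \<in> rtrancl_on ?V ?E" for v
      using that
    proof (induction rule: rtrancl_on_induct)
      case (step y z)
      then show ?case using S by blast
    qed (rule s)
    then show "S = ?V" using all s S by blast
  next
    assume cl: "\<forall>S\<subseteq>?V. S \<noteq> {} \<and> ?E `` S \<subseteq> S \<longrightarrow> S = ?V"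
    show "\<forall>u\<in>?V. \<forall>v\<in>?V. (u, v) \<in> rtrancl_on ?V ?E"
    proof (intro ballI)
      fix u v assume uv: "u \<in> ?V" "v \<in> ?V"
      let ?S = "{w\<in>?V. (u, w) \<in> rtrancl_on ?V ?E}"
      have u: "u \<in> ?S" using uv by (auto intro: rtrancl_on_refl)
      have cS: "?E `` ?S \<subseteq> ?S"
        by (auto dest: edge_in_V intro: rtrancl_on_into_rtrancl_on)
      have "?S = ?V"
      proof (rule cl[rule_format])
        show "?S \<noteq> {} \<and> ?E `` ?S \<subseteq> ?S" using u cS by (intro conjI) (rule ex_in_conv[THEN iffD1, OF exI])
      qed auto
      then show "(u, v) \<in> rtrancl_on ?V ?E" using uv by auto
    qed
  qed
qed

lemma connected_nonregular_competitor:
  "connected_nonregular_graph n 3 G \<longleftrightarrow> card (pverts G) = n \<and> competitor (pverts G) (parcs G)"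
proof (cases "simple_graph (pverts G) (parcs G) \<and> connected_graph (pverts G) (parcs G)")
  case True
  then interpret simple_graph "pverts G" "parcs G" by simp
  let ?d = "vdegree (parcs G)"
  have ne: "pverts G \<noteq> {}" "finite (?d ` pverts G)" using True finite_V by (auto simp: connected_graph_def)
  have "nonregular G \<and> maximum_degree G = 3 \<longleftrightarrow> (\<forall>v\<in>pverts G. ?d v \<le> 3)
     \<and> (\<exists>v\<in>pverts G. ?d v = 3) \<and> (\<exists>v\<in>pverts G. ?d v < 3)" (is "?L \<longleftrightarrow> ?R")
  proof
    assume L: ?L
    then have m: "Max (?d ` pverts G) = 3" by (simp add: maximum_degree_def out_degree_with_proj)
    have le: "\<forall>v\<in>pverts G. ?d v \<le> 3" using ne m by (metis Max_ge imageI)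
    moreover have "\<exists>v\<in>pverts G. ?d v = 3" using Max_in[OF ne(2)] ne m by auto
    moreover have "\<exists>v\<in>pverts G. ?d v < 3"
    proof -
      obtain u v where "u \<in> pverts G" "v \<in> pverts G" "?d u \<noteq> ?d v"
        using L unfolding nonregular_def out_degree_with_proj by blast
      then have "?d u < 3 \<or> ?d v < 3" using le by (metis le_neq_implies_less)
      then show ?thesis using \<open>u \<in> pverts G\<close> \<open>v \<in> pverts G\<close> by blast
    qed
    ultimately show ?R by blast
  next
    assume R: ?R
    then have "Max (?d ` pverts G) = 3" using ne by (intro Max_eqI) (auto simp: image_iff)
    moreover obtain u v where "u \<in> pverts G" "v \<in> pverts G" "?d u = 3" "?d v < 3" using R by blast
    then have "nonregular G" unfolding nonregular_def out_degree_with_proj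
      by (intro bexI[of _ u] bexI[of _ v]) auto
    ultimately show ?L by (simp add: maximum_degree_def out_degree_with_proj)
  qed
  then show ?thesis
    using True by (auto simp: connected_nonregular_graph_def competitor_def pair_graph_iff connected_with_proj)
next
  case False
  then show ?thesis
    by (auto simp: connected_nonregular_graph_def competitor_def pair_graph_iff connected_with_proj)
qed

text \<open>The Rayleigh quotient of an eigenvector is its eigenvalue, so the bound on the form
  bounds the whole spectrum.\<close>

lemma graph_spectral_radius_perron:
  assumes G: "simple_graph (pverts G) (parcs G)"
    and x: "v \<in> pverts G" "x v \<noteq> 0" "\<And>v. v \<in> pverts G \<Longrightarrow> (\<Sum>w\<in>parcs G `` {v}. x w) = \<mu> * x v"
    and bound: "\<And>y. adj_form (parcs G) y \<le> \<mu> * (\<Sum>v\<in>pverts G. (y v)^2)"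
  shows "graph_spectral_radius G = \<mu>"
proof -
  interpret simple_graph "pverts G" "parcs G" by fact
  obtain vs where vs: "set vs = pverts G" "distinct vs" using finite_distinct_list[OF finite_V] by auto
  let ?A = "adjacency_matrix G vs"
  have nb: "{w. w \<in> set vs \<and> (u, w) \<in> parcs G} = parcs G `` {u}" for u
    using vs by (auto dest: edge_in_V)
  note spec = spectrum_adjacency_matrix[OF vs(2), of G, unfolded nb, unfolded vs(1)]
  have "?A \<in> carrier_mat (length vs) (length vs)" by (simp add: adjacency_matrix_def)
  then have fin: "finite (spectrum ?A)" by (rule card_finite_spectrum)
  have "Max (spectrum ?A) = \<mu>"
  proof (rule Max_eqI[OF fin])
    show "\<mu> \<in> spectrum ?A" unfolding spec using x by blast
    fix k assume "k \<in> spectrum ?A"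
    then obtain f u where f: "u \<in> pverts G" "f u \<noteq> 0"
      "\<And>u. u \<in> pverts G \<Longrightarrow> (\<Sum>w\<in>parcs G `` {u}. f w) = k * f u" unfolding spec by blast
    have "adj_form (parcs G) f = k * (\<Sum>v\<in>pverts G. (f v)^2)"
      unfolding adj_form_nbrs by (simp add: f(3) sum_distrib_left power2_eq_square ac_simps)
    then have "k * (\<Sum>v\<in>pverts G. (f v)^2) \<le> \<mu> * (\<Sum>v\<in>pverts G. (f v)^2)" using bound by metis
    then show "k \<le> \<mu>" using sum_sq_pos[of u f] f(1,2) by simp
  qed
  then show ?thesis using graph_spectral_radius_eq[OF vs(2,1)] by simp
qed

lemma attains_max_extremal_cubic:
  fixes G :: "'a pair_pre_digraph"
  assumes "attains_max_spectral_radius n 3 G"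
  obtains x \<mu> where "extremal_cubic (pverts G) (parcs G) x \<mu>" "card (pverts G) = n"
proof -
  have G: "card (pverts G) = n" "competitor (pverts G) (parcs G)"
    and opt: "\<And>H :: 'a pair_pre_digraph. connected_nonregular_graph n 3 H \<Longrightarrow> graph_spectral_radius H \<le> graph_spectral_radius G"
    using assms unfolding attains_max_spectral_radius_def by (auto simp: connected_nonregular_competitor[of n])
  interpret simple_graph "pverts G" "parcs G" using G by (simp add: competitor_def)
  have conn: "connected_graph (pverts G) (parcs G)" using G by (simp add: competitor_def)
  obtain v where v: "v \<in> pverts G" using conn by (auto simp: connected_graph_def)
  obtain x \<mu> where x: "\<And>v. v \<in> pverts G \<Longrightarrow> 0 < x v"
    "\<And>v. v \<in> pverts G \<Longrightarrow> (\<Sum>w\<in>parcs G `` {v}. x w) = \<mu> * x v"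
    "\<And>y. adj_form (parcs G) y \<le> \<mu> * (\<Sum>v\<in>pverts G. (y v)^2)"
    using perron[OF conn] by metis
  have rho: "graph_spectral_radius G = \<mu>"
    using graph_spectral_radius_perron[of G v x \<mu>, OF simple_graph_axioms v _ x(2,3)] x(1)[OF v] by simp
  \<comment> \<open>The competitor's own Perron vector turns the bound on its spectral radius into a
    bound on its form for every test vector.\<close>
  have "adj_form E' y \<le> \<mu> * (\<Sum>v\<in>pverts G. (y v)^2)" if E': "competitor (pverts G) E'" for E' y
  proof -
    let ?H = "\<lparr>pverts = pverts G, parcs = E'\<rparr>"
    interpret H: simple_graph "pverts G" E' using E' by (simp add: competitor_def)
    have connH: "connected_graph (pverts G) E'" using E' by (simp add: competitor_def)
    obtain z \<nu> where z: "\<And>v. v \<in> pverts G \<Longrightarrow> 0 < z v"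
      "\<And>v. v \<in> pverts G \<Longrightarrow> (\<Sum>w\<in>E' `` {v}. z w) = \<nu> * z v"
      "\<And>y. adj_form E' y \<le> \<nu> * (\<Sum>v\<in>pverts G. (y v)^2)"
      using H.perron[OF connH] by metis
    have "graph_spectral_radius ?H = \<nu>"
      using graph_spectral_radius_perron[of ?H v z \<nu>] H.simple_graph_axioms v z(2,3) z(1)[OF v] by simp
    moreover have "connected_nonregular_graph n 3 ?H"
      unfolding connected_nonregular_competitor using E' G by simp
    ultimately have "\<nu> \<le> \<mu>" using opt rho by metis
    then have "\<nu> * (\<Sum>v\<in>pverts G. (y v)^2) \<le> \<mu> * (\<Sum>v\<in>pverts G. (y v)^2)"
      by (intro mult_right_mono sum_nonneg) auto
    then show ?thesis using z(3)[of y] by linarith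
  qed
  then have "extremal_cubic (pverts G) (parcs G) x \<mu>"
    using G x by unfold_locales auto
  then show thesis using G that by blast
qed

section \<open>Two vertices of degree 2\<close>

context simple_graph
begin

lemma rtrancl_symmetric: "(a, b) \<in> E\<^sup>* \<Longrightarrow> (b, a) \<in> E\<^sup>*"
  using sym_rtrancl[OF sym_E] by (rule symD)

lemma nbrs_2:
  assumes "vdegree E v = 2" "(v, a) \<in> E"
  obtains b where "E `` {v} = {a, b}" "a \<noteq> b"
proof -
  have "card (E `` {v} - {a}) = 1" using assms finite_nbrs by (simp add: vdegree_def)
  then obtain b where "E `` {v} - {a} = {b}" by (auto simp: card_1_singleton_iff)
  then show thesis using assms that[of b] by blast
qed

lemma nbrs_3:
  assumes "vdegree E v = 3" "(v, a) \<in> E"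
  obtains b c where "E `` {v} = {a, b, c}" "a \<noteq> b" "a \<noteq> c" "b \<noteq> c"
proof -
  have "card (E `` {v} - {a}) = 2" using assms finite_nbrs by (simp add: vdegree_def)
  then obtain b c where "E `` {v} - {a} = {b, c}" "b \<noteq> c" by (auto simp: card_2_iff)
  then show thesis using assms that[of b c] by blast
qed

end

context extremal_cubic
begin

text \<open>Replacing the edge \<open>vw\<close> by \<open>uw\<close> adds
  \<open>2 * (x u - x v) * x w\<close>, which is nonnegative, to the form. If \<open>w\<close>
  stayed reachable from \<open>v\<close>, the result would be a competitor, so \<open>x\<close>
  would satisfy its eigenvalue equation at \<open>u\<close>; but there the neighbour sum has grown
  by \<open>x w\<close>.\<close>

lemma rotate_disconnects:
  assumes uv: "u \<in> V" "v \<in> V" "u \<noteq> v" "vdegree E u = 2" "vdegree E v = 2"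
    and other: "\<And>z. z \<in> V \<Longrightarrow> z \<noteq> u \<Longrightarrow> z \<noteq> v \<Longrightarrow> vdegree E z = 3"
    and le: "x v \<le> x u"
    and w: "(v, w) \<in> E" "w \<noteq> u" "(u, w) \<notin> E"
  shows "(v, w) \<notin> (E - edge v w \<union> edge u w)\<^sup>*"
proof
  let ?E = "E - edge v w \<union> edge u w"
  assume r: "(v, w) \<in> ?E\<^sup>*"
  have wV: "w \<in> V" "w \<noteq> v" using w(1) by (auto dest: edge_in_V)
  interpret F: simple_graph V "E - edge v w" by (rule remove_edge)
  interpret E': simple_graph V ?E using uv w wV by (intro F.add_edge) auto
  have wu: "(w, u) \<notin> E" "(w, v) \<in> E" using w sym_iff by blast+
  have "connected_graph V ?E"
  proof (rule connected_graph_mono[OF conn])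
    fix a b assume "(a, b) \<in> E"
    then consider "a = v" "b = w" | "a = w" "b = v" | "(a, b) \<in> ?E" by auto
    then show "(a, b) \<in> ?E\<^sup>*" by cases (use r E'.rtrancl_symmetric[OF r] in auto)
  qed
  moreover have Iu: "?E `` {u} = insert w (E `` {u})" and Iv: "?E `` {v} = E `` {v} - {w}"
    and Iw: "?E `` {w} = insert u (E `` {w} - {v})"
    using uv w wV unfolding edge_Image by auto
  moreover have Iz: "z \<noteq> u \<Longrightarrow> z \<noteq> v \<Longrightarrow> z \<noteq> w \<Longrightarrow> ?E `` {z} = E `` {z}" for z
    unfolding edge_Image by auto
  have du: "vdegree ?E u = 3" using uv w finite_nbrs by (simp add: vdegree_def Iu)
  have dv: "vdegree ?E v = 1" using uv w finite_nbrs by (simp add: vdegree_def Iv)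
  have dw: "vdegree ?E w = 3" using other[OF wV(1) w(2) wV(2)] wu finite_nbrs by (simp add: vdegree_def Iw)
  have dz: "vdegree ?E z = 3" if "z \<in> V" "z \<noteq> u" "z \<noteq> v" "z \<noteq> w" for z
    using other[OF that(1,2,3)] Iz[OF that(2,3,4)] by (simp add: vdegree_def)
  have "vdegree ?E z \<le> 3" if "z \<in> V" for z
    using du dv dw dz[OF that] by (cases "z = u \<or> z = v \<or> z = w") auto
  ultimately have c: "competitor V ?E"
    unfolding competitor_def using E'.simple_graph_axioms du dv uv by force
  have "adj_form ?E x = adj_form (E - edge v w) x + 2 * x u * x w"
    using w by (intro F.adj_form_add_edge) auto
  also have "adj_form (E - edge v w) x = adj_form E x - 2 * x v * x w" by (rule adj_form_remove_edge[OF w(1)])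
  finally have "adj_form ?E x = adj_form E x + 2 * ((x u - x v) * x w)" by (simp add: algebra_simps)
  moreover have "0 \<le> (x u - x v) * x w" using le x_pos[OF wV(1)] by simp
  ultimately have "(\<Sum>z\<in>?E `` {u}. x z) = \<mu> * x u"
    by (intro improve[OF c _ uv(1)]) linarith
  moreover have "(\<Sum>z\<in>?E `` {u}. x z) = x w + \<mu> * x u"
    unfolding Iu using w finite_nbrs eigen[OF uv(1)] by simp
  ultimately show False using x_pos[OF wV(1)] by simp
qed

text \<open>Otherwise both edges at \<open>v\<close> could be rotated to \<open>u\<close>, and each
  rotation must disconnect the graph. The first one shows that \<open>u\<close> is joined to
  \<open>w\<close> without the edges at \<open>v\<close>; then the second rotated graph contains a
  walk from \<open>v\<close> over \<open>w\<close> and \<open>u\<close> to \<open>w'\<close>, a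
  contradiction.\<close>

lemma deficient_nbrs_subset:
  assumes uv: "u \<in> V" "v \<in> V" "u \<noteq> v" "vdegree E u = 2" "vdegree E v = 2"
    and other: "\<And>z. z \<in> V \<Longrightarrow> z \<noteq> u \<Longrightarrow> z \<noteq> v \<Longrightarrow> vdegree E z = 3"
    and le: "x v \<le> x u"
    and w: "(v, w) \<in> E" "w \<noteq> u"
  shows "(u, w) \<in> E"
proof (rule ccontr)
  assume nuw: "(u, w) \<notin> E"
  let ?E = "E - edge v w \<union> edge u w"
  have nr: "(v, w) \<notin> ?E\<^sup>*" by (rule rotate_disconnects[OF uv other le w nuw])
  have wV: "w \<in> V" "w \<noteq> v" using w(1) by (auto dest: edge_in_V)
  obtain w' where w': "E `` {v} = {w, w'}" "w \<noteq> w'" using nbrs_2[OF uv(5) w(1)] by blast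
  have vw': "(v, w') \<in> E" using w' by blast
  then have w'V: "w' \<in> V" "w' \<noteq> v" by (auto dest: edge_in_V)
  have uw: "(u, w) \<in> ?E" by simp
  have vw'E: "(v, w') \<in> ?E" using vw' w' wV by auto
  have w'u: "w' \<noteq> u"
  proof
    assume "w' = u"
    then have "(v, w) \<in> ?E\<^sup>*" using vw'E uw by (meson r_into_rtrancl rtrancl.rtrancl_into_rtrancl)
    then show False using nr by simp
  qed
  have vu: "(v, u) \<notin> ?E\<^sup>*" using nr uw by (meson rtrancl.rtrancl_into_rtrancl)
  have uw': "(u, w') \<notin> E"
  proof
    assume "(u, w') \<in> E"
    then have "(w', u) \<in> E" by (rule symD[OF sym_E])
    then have "(w', u) \<in> ?E" using w'V w' by auto
    then show False using vu vw'E by (meson r_into_rtrancl rtrancl.rtrancl_into_rtrancl)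
  qed
  let ?E' = "E - edge v w' \<union> edge u w'"
  have nr': "(v, w') \<notin> ?E'\<^sup>*" by (rule rotate_disconnects[OF uv other le vw' w'u uw'])
  define F where "F = E - edge v w - edge v w'"
  \<comment> \<open>Every vertex is reachable from \<open>v\<close> in the first rotated graph or
    from \<open>w\<close> without the edges at \<open>v\<close>; the vertex \<open>u\<close> is not
    of the first kind.\<close>
  define T where "T = {z\<in>V. (v, z) \<in> ?E\<^sup>* \<or> (w, z) \<in> F\<^sup>*}"
  have "T = V"
  proof (rule connected_graphD[OF conn])
    fix a b assume ab: "(a, b) \<in> E" "a \<in> T"
    have bV: "b \<in> V" using ab by (auto dest: edge_in_V)
    show "b \<in> T"
    proof (cases "b = v \<or> b = w \<or> b = w'")
      case True
      then show ?thesis using bV vw'E by (auto simp: T_def)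
    next
      case False
      then have "(a, b) \<in> ?E" "(a, b) \<in> F" using ab by (auto simp: F_def)
      then show ?thesis using ab bV unfolding T_def by (auto intro: rtrancl.rtrancl_into_rtrancl)
    qed
  qed (use wV in \<open>auto simp: T_def\<close>)
  then have "(w, u) \<in> F\<^sup>*" using uv vu by (auto simp: T_def)
  moreover have "F\<^sup>* \<subseteq> ?E'\<^sup>*" by (intro rtrancl_mono) (auto simp: F_def)
  ultimately have "(w, u) \<in> ?E'\<^sup>*" by blast
  moreover have "(v, w) \<in> ?E'" using w w' wV by auto
  moreover have "(u, w') \<in> ?E'" by simp
  ultimately have "(v, w') \<in> ?E'\<^sup>*"
    by (meson converse_rtrancl_into_rtrancl rtrancl.rtrancl_into_rtrancl)
  then show False using nr' by simp
qed

text \<open>By \<open>deficient_nbrs_subset\<close>, \<open>u\<close> and \<open>v\<close> are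
  adjacent with a common neighbour or have the same two neighbours. In both cases an exchange of
  edges makes \<open>v\<close> pendant at \<open>u\<close>, and \<open>x\<close>, corrected to
  satisfy the new eigenvalue equations at \<open>u\<close> and \<open>v\<close>, gets a positive
  Rayleigh gap.\<close>

lemma no_deficient_pair_2_2:
  assumes uv: "u \<in> V" "v \<in> V" "u \<noteq> v" "vdegree E u = 2" "vdegree E v = 2"
    and other: "\<And>z. z \<in> V \<Longrightarrow> z \<noteq> u \<Longrightarrow> z \<noteq> v \<Longrightarrow> vdegree E z = 3"
    and le: "x v \<le> x u" and n: "6 \<le> card V"
  shows False
proof -
  have sub: "(u, w) \<in> E" if "(v, w) \<in> E" "w \<noteq> u" for w
    by (rule deficient_nbrs_subset[OF uv other le that])
  have mu2: "2 < \<mu>"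
  proof -
    have "(\<Sum>z\<in>V. vdegree E z) = (\<Sum>z\<in>V - {u, v}. vdegree E z) + 4"
      using uv finite_V by (simp add: sum.remove[of V u] sum.remove[of "V - {u}" v] Diff_insert2[symmetric])
    also have "(\<Sum>z\<in>V - {u, v}. vdegree E z) = 3 * (card V - 2)"
      using uv finite_V by (simp add: other card_Diff_subset)
    finally have "real (card E) = 3 * real (card V) - 2" using sum_vdegree n by simp
    then have "3 * real (card V) - 2 \<le> \<mu> * real (card V)" using average_degree by simp
    moreover have "\<mu> * real (card V) \<le> 2 * real (card V)" if "\<mu> \<le> 2" using that by (intro mult_right_mono) auto
    moreover have "6 \<le> real (card V)" using n by simp
    ultimately show ?thesis by linarith
  qed
  define s where "s = x u"
  have s: "0 < s" using x_pos uv by (simp add: s_def)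
  have closed: False if "S \<subseteq> V" "S \<noteq> {}" "card S < 6" "\<And>a b. (a, b) \<in> E \<Longrightarrow> a \<in> S \<Longrightarrow> b \<in> S" for S
    using connected_graphD[OF conn that(1,2,4)] that(3) n by simp
  have ex: "\<exists>w. (v, w) \<in> E \<and> w \<noteq> u"
  proof (rule ccontr)
    assume "\<not> ?thesis"
    then have "E `` {v} \<subseteq> {u}" by blast
    then have "card (E `` {v}) \<le> 1" using card_mono[of "{u}" "E `` {v}"] by simp
    then show False using uv by (simp add: vdegree_def)
  qed
  show False
  proof (cases "(u, v) \<in> E")
    case True
    then have vu: "(v, u) \<in> E" by (rule symD[OF sym_E])
    obtain a where Nv: "E `` {v} = {u, a}" "u \<noteq> a" using nbrs_2[OF uv(5) vu] by blast
    have ua: "(u, a) \<in> E" using sub[of a] Nv by blast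
    have av: "a \<noteq> v" "a \<in> V" using Nv by (auto dest: edge_in_V)
    obtain b where "E `` {u} = {v, b}" using nbrs_2[OF uv(4) True] by blast
    then have Nu: "E `` {u} = {v, a}" using ua av by auto
    have au: "(a, u) \<in> E" "(a, v) \<in> E" using ua Nv by (auto intro: symD[OF sym_E])
    obtain p where Na: "E `` {a} = {u, v, p}" "p \<noteq> u" "p \<noteq> v"
    proof -
      obtain b c where bc: "E `` {a} = {u, b, c}" "u \<noteq> b" "u \<noteq> c" "b \<noteq> c"
        using nbrs_3[OF other[OF av(2)] au(1)] Nv av by blast
      have "v \<in> E `` {a}" using au by blast
      then have "v = b \<or> v = c" using bc(1) uv(3) by auto
      then show thesis using bc that[of b] that[of c] by auto
    qed
    have ap: "(a, p) \<in> E" "(p, a) \<in> E" "p \<noteq> a" "p \<in> V"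
      using Na by (auto intro: symD[OF sym_E] dest: edge_in_V)
    obtain q r where Np: "E `` {p} = {a, q, r}" "a \<noteq> q" "a \<noteq> r" "q \<noteq> r"
      using nbrs_3[OF other[OF ap(4) Na(2,3)] ap(2)] by blast
    have pq: "(p, q) \<in> E" "(q, p) \<in> E" "(p, r) \<in> E" "(r, p) \<in> E" using Np by (auto intro: symD[OF sym_E])
    have qr: "q \<noteq> u" "q \<noteq> v" "r \<noteq> u" "r \<noteq> v" "q \<noteq> p" "r \<noteq> p" "q \<in> V" "r \<in> V"
      using pq Nu Nv Na ap by (auto dest: edge_in_V)
    have naq: "(a, q) \<notin> E" "(u, p) \<notin> E" "(q, a) \<notin> E" "(p, u) \<notin> E"
      using Na Nu Np qr ap by (auto dest: symD[OF sym_E])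
    \<comment> \<open>The triangle \<open>u\<close>, \<open>v\<close>, \<open>a\<close> is turned
      into the triangle \<open>u\<close>, \<open>a\<close>, \<open>p\<close> with the pendant edge
      \<open>uv\<close>.\<close>
    let ?E1 = "E - edge v a" and ?E2 = "E - edge v a - edge p q"
    let ?E3 = "?E2 \<union> edge u p"
    let ?H = "?E3 \<union> edge a q"
    interpret E1: simple_graph V ?E1 by (rule remove_edge)
    interpret E2: simple_graph V ?E2 by (rule E1.remove_edge)
    interpret E3: simple_graph V ?E3 using uv ap Na by (intro E2.add_edge) auto
    interpret H: simple_graph V ?H using av qr Np by (intro E3.add_edge) auto
    note dist = uv(3) Nv(2) av(1) Na(2,3) ap(3) Np(2-4) qr(1-6)
    have Hu: "?H `` {u} = {v, a, p}" and Hv: "?H `` {v} = {u}" and Ha: "?H `` {a} = {u, p, q}"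
      and Hp: "?H `` {p} = {u, a, r}" and Hq: "?H `` {q} = insert a (E `` {q} - {p})"
      unfolding edge_Image using Nu Nv Na Np dist dist[symmetric] by auto
    have Hz: "z \<notin> {u, v, a, p, q} \<Longrightarrow> ?H `` {z} = E `` {z}" for z
      unfolding edge_Image by auto
    have dH: "vdegree ?H u = 3" "vdegree ?H v = 1" "vdegree ?H a = 3" "vdegree ?H p = 3"
      using dist dist[symmetric] by (simp_all add: vdegree_def Hu Hv Ha Hp)
    have dq: "vdegree ?H q = 3"
      using other[OF qr(7,1,2)] naq pq finite_nbrs[of q] by (simp add: vdegree_def Hq)
    have le3: "vdegree ?H z \<le> 3" if "z \<in> V" for z
      using deg_le[OF that] Hz[of z] dH dq by (cases "z \<in> {u, v, a, p, q}") (auto simp: vdegree_def)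
    have "connected_graph V ?H"
    proof (rule connected_graph_mono[OF conn])
      have st: "(v, u) \<in> ?H" "(u, a) \<in> ?H" "(p, a) \<in> ?H" "(a, q) \<in> ?H"
        unfolding Image_singleton_iff[symmetric] Hu Hv Ha Hp by simp_all
      have t: "(v, a) \<in> ?H\<^sup>*" "(p, q) \<in> ?H\<^sup>*"
        by (rule rtrancl_trans[OF r_into_rtrancl r_into_rtrancl], rule st, rule st)+
      fix c d assume "(c, d) \<in> E"
      then consider "c = v" "d = a" | "c = a" "d = v" | "c = p" "d = q" | "c = q" "d = p" | "(c, d) \<in> ?H" by auto
      then show "(c, d) \<in> ?H\<^sup>*" by cases (use t H.rtrancl_symmetric in auto)
    qed
    then have c: "competitor V ?H"
      unfolding competitor_def using H.simple_graph_axioms le3 dH uv by force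
    have xv: "x v = s"
    proof -
      have "x v + x a = \<mu> * x u" "x u + x a = \<mu> * x v"
        using eigen[OF uv(1)] eigen[OF uv(2)] Nu Nv av by auto
      then have "(\<mu> + 1) * (x u - x v) = 0" by (simp add: algebra_simps)
      then show ?thesis using mu2 by (simp add: s_def)
    qed
    have xa: "x a = (\<mu> - 1) * s"
      using eigen[OF uv(1)] Nu av xv by (simp add: s_def algebra_simps)
    have xp: "x p = (\<mu> * (\<mu> - 1) - 2) * s"
      using eigen[OF av(2)] Na dist xv xa by (simp add: s_def algebra_simps)
    have xr: "x r = \<mu> * x p - x a - x q"
      using eigen[OF ap(4)] Np by simp
    have S: "0 < (\<mu>^3 - \<mu>^2 - 3 * \<mu> + 1) * s"
    proof -
      have "0 < x q + x r" using x_pos[OF qr(7)] x_pos[OF qr(8)] by simp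
      then show ?thesis unfolding xr xp xa by (simp add: algebra_simps power2_eq_square power3_eq_cube)
    qed
    \<comment> \<open>These values solve the new eigenvalue equations at \<open>v\<close> and
      \<open>u\<close>. The equation at \<open>u\<close> leaves \<open>(\<mu>^2 - 1) * s\<close> for
      \<open>a\<close> and \<open>p\<close> together, which is split evenly.\<close>
    define y1 where "y1 = x(v := s)"
    define y2 where "y2 = y1(u := \<mu> * s)"
    define y3 where "y3 = y2(a := (\<mu>^2 - 1) / 2 * s)"
    define y where "y = y3(p := (\<mu>^2 - 1) / 2 * s)"
    let ?Q = "\<lambda>y. adj_form ?H y - \<mu> * (\<Sum>w\<in>V. (y w)^2)"
    have form: "adj_form ?H x = adj_form E x - 2 * x v * x a - 2 * x p * x q + 2 * x u * x p + 2 * x a * x q"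
    proof -
      have "adj_form ?H x = adj_form ?E3 x + 2 * x a * x q"
        using naq dist by (intro E3.adj_form_add_edge) auto
      moreover have "adj_form ?E3 x = adj_form ?E2 x + 2 * x u * x p"
        using naq dist by (intro E2.adj_form_add_edge) auto
      moreover have "adj_form ?E2 x = adj_form ?E1 x - 2 * x p * x q"
        using pq dist by (intro E1.adj_form_remove_edge) auto
      moreover have "adj_form ?E1 x = adj_form E x - 2 * x v * x a"
        using Nv by (intro adj_form_remove_edge) auto
      ultimately show ?thesis by simp
    qed
    have "?Q y1 = ?Q x"
      unfolding y1_def H.adj_form_update[OF uv(2)] using xv by simp
    moreover have "?Q y2 = ?Q y1 + 2 * (\<mu> * s - s) * (s + x a + x p) - \<mu> * ((\<mu> * s)^2 - s^2)"
      unfolding y2_def H.adj_form_update[OF uv(1)] Hu using dist dist[symmetric] xv by (simp add: y1_def s_def)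
    moreover have "?Q y3 = ?Q y2 + 2 * ((\<mu>^2 - 1) / 2 * s - x a) * (\<mu> * s + x p + x q) - \<mu> * (((\<mu>^2 - 1) / 2 * s)^2 - (x a)^2)"
      unfolding y3_def H.adj_form_update[OF av(2)] Ha using dist dist[symmetric] xv by (simp add: y2_def y1_def s_def)
    moreover have "?Q y = ?Q y3 + 2 * ((\<mu>^2 - 1) / 2 * s - x p) * (\<mu> * s + (\<mu>^2 - 1) / 2 * s + x r) - \<mu> * (((\<mu>^2 - 1) / 2 * s)^2 - (x p)^2)"
      unfolding y_def H.adj_form_update[OF ap(4)] Hp using dist dist[symmetric] xv by (simp add: y3_def y2_def y1_def s_def)
    moreover have "?Q x = - 2 * s * x a - 2 * x p * x q + 2 * s * x p + 2 * x a * x q"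
      using form form_x xv by (simp add: s_def)
    \<comment> \<open>The last factor is \<open>x q + x r\<close>, hence positive.\<close>
    ultimately have "?Q y = (\<mu> + 1) * (3 - \<mu>) / 2 * s * ((\<mu>^3 - \<mu>^2 - 3 * \<mu> + 1) * s)"
      unfolding xr xp xa by (simp add: field_simps power2_eq_square power3_eq_cube)
    also have "\<dots> > 0" using s mu2 mu_less_3 by (intro mult_pos_pos[OF _ S]) auto
    finally show False using opt[OF c, of y] by simp
  next
    case False
    then have nvu: "(v, u) \<notin> E" by (auto intro: symD[OF sym_E])
    obtain w1 where w1: "(v, w1) \<in> E" using ex by blast
    obtain w2 where Nv: "E `` {v} = {w1, w2}" "w1 \<noteq> w2" using nbrs_2[OF uv(5) w1] by blast
    have w2: "(v, w2) \<in> E" using Nv by blast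
    have ne: "w1 \<noteq> u" "w2 \<noteq> u" using w1 w2 nvu by auto
    have uw: "(u, w1) \<in> E" "(u, w2) \<in> E" using sub w1 w2 ne by auto
    obtain b where "E `` {u} = {w1, b}" using nbrs_2[OF uv(4) uw(1)] by blast
    then have Nu: "E `` {u} = {w1, w2}" using uw Nv(2) by auto
    have wV: "w1 \<in> V" "w2 \<in> V" "w1 \<noteq> v" "w2 \<noteq> v" using w1 w2 by (auto dest: edge_in_V)
    have wu: "(w1, u) \<in> E" "(w2, u) \<in> E" "(w1, v) \<in> E" "(w2, v) \<in> E"
      using uw w1 w2 by (auto intro: symD[OF sym_E])
    have third: "\<exists>p. E `` {w} = {u, v, p} \<and> p \<noteq> u \<and> p \<noteq> v" if "w \<in> {w1, w2}" for w
    proof -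
      have w: "(w, u) \<in> E" "(w, v) \<in> E" "vdegree E w = 3" using that wu other wV ne by auto
      obtain b c where bc: "E `` {w} = {u, b, c}" "u \<noteq> b" "u \<noteq> c" "b \<noteq> c" using nbrs_3[OF w(3,1)] by blast
      have "v \<in> E `` {w}" using w by blast
      then have "v = b \<or> v = c" using bc(1) uv(3) by auto
      then show ?thesis using bc by auto
    qed
    obtain p where N1: "E `` {w1} = {u, v, p}" "p \<noteq> u" "p \<noteq> v" using third by blast
    obtain q where N2: "E `` {w2} = {u, v, q}" "q \<noteq> u" "q \<noteq> v" using third by blast
    have n12: "(w1, w2) \<notin> E"
    proof
      assume a: "(w1, w2) \<in> E"
      then have "(w2, w1) \<in> E" by (rule symD[OF sym_E])
      then have pq: "p = w2" "q = w1" using a N1 N2 ne wV by auto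
      show False
      proof (rule closed[of "{u, v, w1, w2}"])
        show "card {u, v, w1, w2} < 6" by (simp add: card_insert_if)
        fix a b assume "(a, b) \<in> E" "a \<in> {u, v, w1, w2}"
        then have "b \<in> E `` {u} \<union> E `` {v} \<union> E `` {w1} \<union> E `` {w2}" by blast
        then show "b \<in> {u, v, w1, w2}" unfolding Nu Nv N1 N2 pq by blast
      qed (use uv wV in auto)
    qed
    have n21: "(w2, w1) \<notin> E" using n12 by (auto intro: symD[OF sym_E])
    have pw: "p \<noteq> w2" "q \<noteq> w1" "p \<in> V" "q \<in> V" "p \<noteq> w1" "q \<noteq> w2"
    proof -
      have "(w1, p) \<in> E" "(w2, q) \<in> E" using N1 N2 by auto
      then show "p \<noteq> w2" "q \<noteq> w1" "p \<in> V" "q \<in> V" "p \<noteq> w1" "q \<noteq> w2"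
        using n12 n21 by (auto dest: edge_in_V)
    qed
    \<comment> \<open>The vertex \<open>v\<close> leaves the 4-cycle \<open>u\<close>,
      \<open>w1\<close>, \<open>v\<close>, \<open>w2\<close> and becomes pendant at
      \<open>u\<close>; joining \<open>w1\<close> and \<open>w2\<close> restores their
      degrees.\<close>
    let ?E1 = "E - edge v w1" and ?E2 = "E - edge v w1 - edge v w2"
    let ?E3 = "?E2 \<union> edge u v"
    let ?H = "?E3 \<union> edge w1 w2"
    interpret E1: simple_graph V ?E1 by (rule remove_edge)
    interpret E2: simple_graph V ?E2 by (rule E1.remove_edge)
    interpret E3: simple_graph V ?E3 using uv by (intro E2.add_edge) auto
    interpret H: simple_graph V ?H using wV Nv by (intro E3.add_edge) auto
    note dist = uv(3) Nv(2) ne wV(3,4) N1(2,3) N2(2,3) pw(1,2,5,6)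
    have Hu: "?H `` {u} = {v, w1, w2}" and Hv: "?H `` {v} = {u}" and H1: "?H `` {w1} = {u, w2, p}"
      and H2: "?H `` {w2} = {u, w1, q}"
      unfolding edge_Image using Nu Nv N1 N2 dist dist[symmetric] by auto
    have Hz: "z \<notin> {u, v, w1, w2} \<Longrightarrow> ?H `` {z} = E `` {z}" for z
      unfolding edge_Image by auto
    have dH: "vdegree ?H u = 3" "vdegree ?H v = 1" "vdegree ?H w1 = 3" "vdegree ?H w2 = 3"
      using dist dist[symmetric] by (simp_all add: vdegree_def Hu Hv H1 H2)
    have le3: "vdegree ?H z \<le> 3" if "z \<in> V" for z
      using deg_le[OF that] Hz[of z] dH by (cases "z \<in> {u, v, w1, w2}") (auto simp: vdegree_def)
    have "connected_graph V ?H"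
    proof (rule connected_graph_mono[OF conn])
      have st: "(v, u) \<in> ?H" "(u, w1) \<in> ?H" "(u, w2) \<in> ?H"
        unfolding Image_singleton_iff[symmetric] Hu Hv by simp_all
      have t: "(v, w1) \<in> ?H\<^sup>*" "(v, w2) \<in> ?H\<^sup>*"
        by (rule rtrancl_trans[OF r_into_rtrancl r_into_rtrancl], rule st, rule st)+
      fix c d assume "(c, d) \<in> E"
      then consider "c = v" "d = w1" | "c = w1" "d = v" | "c = v" "d = w2" | "c = w2" "d = v" | "(c, d) \<in> ?H" by auto
      then show "(c, d) \<in> ?H\<^sup>*" by cases (use t H.rtrancl_symmetric in auto)
    qed
    then have c: "competitor V ?H"
      unfolding competitor_def using H.simple_graph_axioms le3 dH uv by force
    define a b where "a = x w1" and "b = x w2"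
    have L: "a + b = \<mu> * s" "x v = s"
    proof -
      have "a + b = \<mu> * x u" "a + b = \<mu> * x v"
        using eigen[OF uv(1)] eigen[OF uv(2)] Nu Nv by (auto simp: a_def b_def)
      then show "a + b = \<mu> * s" "x v = s" using mu2 by (auto simp: s_def)
    qed
    have ab: "2 * s \<le> \<mu> * a" "2 * s \<le> \<mu> * b"
      using eigen[OF wV(1)] eigen[OF wV(2)] N1 N2 dist L x_pos[OF pw(3)] x_pos[OF pw(4)]
      by (auto simp: a_def b_def s_def)
    \<comment> \<open>Both factors below are nonnegative because of the third neighbours of
      \<open>w1\<close> and \<open>w2\<close>. As \<open>a + b\<close> is known, this bounds
      \<open>a * b\<close> from below.\<close>
    have prod: "2 * (\<mu>^2 - 2) * s^2 \<le> \<mu>^2 * (a * b)"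
    proof -
      have "0 \<le> (\<mu> * a - 2 * s) * (\<mu> * b - 2 * s)" using ab by simp
      also have "\<dots> = \<mu>^2 * (a * b) - 2 * s * \<mu> * (a + b) + 4 * s^2" by (simp add: algebra_simps power2_eq_square)
      finally show ?thesis unfolding L by (simp add: algebra_simps power2_eq_square)
    qed
    define d where "d = \<mu>^2 - 1"
    have mu4: "4 < \<mu>^2" using mu2 power_strict_mono[of 2 \<mu> 2] by simp
    have d: "0 < d" using mu4 by (simp add: d_def)
    \<comment> \<open>The solution of the new eigenvalue equations at \<open>v\<close> and
      \<open>u\<close> when \<open>w1\<close> and \<open>w2\<close> keep their values.\<close>
    define y1 where "y1 = x(v := \<mu> * s / d)"
    define y where "y = y1(u := \<mu>^2 * s / d)"
    let ?Q = "\<lambda>y. adj_form ?H y - \<mu> * (\<Sum>w\<in>V. (y w)^2)"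
    have form: "adj_form ?H x = adj_form E x - 2 * x v * x w1 - 2 * x v * x w2 + 2 * x u * x v + 2 * x w1 * x w2"
    proof -
      have "adj_form ?H x = adj_form ?E3 x + 2 * x w1 * x w2"
        using n12 dist by (intro E3.adj_form_add_edge) auto
      moreover have "adj_form ?E3 x = adj_form ?E2 x + 2 * x u * x v"
        using False dist by (intro E2.adj_form_add_edge) auto
      moreover have "adj_form ?E2 x = adj_form ?E1 x - 2 * x v * x w2"
        using w2 dist by (intro E1.adj_form_remove_edge) auto
      moreover have "adj_form ?E1 x = adj_form E x - 2 * x v * x w1"
        using w1 by (intro adj_form_remove_edge) auto
      ultimately show ?thesis by simp
    qed
    have "?Q y1 = ?Q x + 2 * (\<mu> * s / d - s) * s - \<mu> * ((\<mu> * s / d)^2 - s^2)"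
      unfolding y1_def H.adj_form_update[OF uv(2)] Hv using L by (simp add: s_def)
    moreover have "?Q y = ?Q y1 + 2 * (\<mu>^2 * s / d - s) * (\<mu> * s / d + (a + b)) - \<mu> * ((\<mu>^2 * s / d)^2 - s^2)"
      unfolding y_def H.adj_form_update[OF uv(1)] Hu using dist dist[symmetric] by (simp add: y1_def s_def a_def b_def)
    moreover have "?Q x = - 2 * s * (a + b) + 2 * s^2 + 2 * a * b"
    proof -
      have "?Q x = - 2 * s * a - 2 * s * b + 2 * s * s + 2 * a * b"
        using form form_x L(2) by (simp add: s_def a_def b_def)
      then show ?thesis by (simp add: algebra_simps power2_eq_square)
    qed
    ultimately have Qy: "?Q y = 2 * (a * b) - s^2 * (\<mu> * (\<mu>^2 - 2) / d)"
    proof -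
      assume 1: "?Q y1 = ?Q x + 2 * (\<mu> * s / d - s) * s - \<mu> * ((\<mu> * s / d)^2 - s^2)"
        and 2: "?Q y = ?Q y1 + 2 * (\<mu>^2 * s / d - s) * (\<mu> * s / d + (a + b)) - \<mu> * ((\<mu>^2 * s / d)^2 - s^2)"
        and 3: "?Q x = - 2 * s * (a + b) + 2 * s^2 + 2 * a * b"
      have m: "\<mu>^2 = d + 1" by (simp add: d_def)
      have "?Q y = 2 * (a * b) + s^2 * (- 2 * \<mu> + 2 + 2 * (\<mu> / d - 1) - \<mu> * (\<mu>^2 / d^2 - 1)
          + 2 * (\<mu>^2 / d - 1) * (\<mu> / d + \<mu>) - \<mu> * ((\<mu>^2 / d)^2 - 1))"
        unfolding 2 1 3 L by (simp add: algebra_simps power2_eq_square)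
      also have "(- 2 * \<mu> + 2 + 2 * (\<mu> / d - 1) - \<mu> * (\<mu>^2 / d^2 - 1)
          + 2 * (\<mu>^2 / d - 1) * (\<mu> / d + \<mu>) - \<mu> * ((\<mu>^2 / d)^2 - 1)) = - (\<mu> * (\<mu>^2 - 2) / d)"
        unfolding m using d by (simp add: field_simps power2_eq_square)
      finally show ?thesis by simp
    qed
    have "\<mu>^3 < 4 * d"
    proof -
      have "\<mu> * \<mu>^2 \<le> 3 * \<mu>^2" using mu_less_3 by (intro mult_right_mono) auto
      moreover have "\<mu>^3 = \<mu> * \<mu>^2" by (simp add: power2_eq_square power3_eq_cube)
      ultimately show ?thesis using mu4 by (simp add: d_def)
    qed
    then have "(\<mu>^2 - 2) * s^2 * \<mu>^3 < (\<mu>^2 - 2) * s^2 * (4 * d)" using mu4 s by (intro mult_strict_left_mono) auto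
    also have "\<dots> \<le> 2 * d * (\<mu>^2 * (a * b))" using mult_left_mono[OF prod, of "2 * d"] d by (simp add: algebra_simps)
    finally have "\<mu>^2 * (s^2 * (\<mu> * (\<mu>^2 - 2))) < \<mu>^2 * (2 * (a * b) * d)"
      by (simp add: algebra_simps power2_eq_square power3_eq_cube)
    then have "s^2 * (\<mu> * (\<mu>^2 - 2)) < 2 * (a * b) * d" using mu2 by simp
    then have "s^2 * (\<mu> * (\<mu>^2 - 2) / d) < 2 * (a * b)" using d by (simp add: field_simps)
    then have "0 < ?Q y" unfolding Qy by simp
    then show False using opt[OF c, of y] by simp
  qed
qed

end

section \<open>Transfer maps\<close>

text \<open>A state \<open>(a, F)\<close> consists of the potential of the last vertices passed and the flow through the cut
  behind them. Two edges lead on, so the next potential is \<open>a + F/2\<close>. In \<open>step_pair\<close> two vertices share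
  it; in \<open>step_bridge\<close> one vertex has it, and a single edge carrying all the flow leads to a second one.\<close>

fun step_pair :: "real \<Rightarrow> real \<times> real \<Rightarrow> real \<times> real" where
  "step_pair \<epsilon> (a, F) = (a + F/2, F - 2 * \<epsilon> * (a + F/2))"

fun step_bridge :: "real \<Rightarrow> real \<times> real \<Rightarrow> real \<times> real" where
  "step_bridge \<epsilon> (a, F) =
     ((1 - \<epsilon>) * (a + F/2) + F, F - \<epsilon> * (a + F/2) - \<epsilon> * ((1 - \<epsilon>) * (a + F/2) + F))"

definition step_diamond :: "real \<Rightarrow> real \<times> real \<Rightarrow> real \<times> real" where
  "step_diamond \<epsilon> s = step_bridge \<epsilon> (step_pair \<epsilon> s)"

text \<open>The sign of a determinant. For positive potentials it says that \<open>t\<close> has at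
  most as much flow per potential as \<open>s\<close>. Cross-multiplication keeps it meaningful when
  the flow of \<open>t\<close> is not positive, and invariant under maps of determinant 1.\<close>

definition below :: "real \<times> real \<Rightarrow> real \<times> real \<Rightarrow> bool" where
  "below s t \<longleftrightarrow> fst s * snd t \<le> snd s * fst t"

lemma below_trans:
  assumes "below s t" "below t u" "0 \<le> fst s" "0 < fst t" "0 \<le> fst u"
  shows "below s u"
proof -
  have "fst t * (fst s * snd u) = fst s * (fst t * snd u)" by simp
  also have "\<dots> \<le> fst s * (snd t * fst u)"
    using assms(2,3) by (intro mult_left_mono) (auto simp: below_def)
  also have "\<dots> = fst u * (fst s * snd t)" by simp
  also have "\<dots> \<le> fst u * (snd s * fst t)"
    using assms(1,5) by (intro mult_left_mono) (auto simp: below_def)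
  finally have "fst t * (fst s * snd u) \<le> fst t * (snd s * fst u)" by (simp add: algebra_simps)
  then show ?thesis using assms(4) by (simp add: below_def)
qed

lemma step_pair_det:
  "fst (step_pair \<epsilon> s) * snd (step_pair \<epsilon> t) - snd (step_pair \<epsilon> s) * fst (step_pair \<epsilon> t)
     = fst s * snd t - snd s * fst t"
  by (cases s; cases t) (simp add: field_simps)

lemma step_bridge_det:
  "fst (step_bridge \<epsilon> s) * snd (step_bridge \<epsilon> t) - snd (step_bridge \<epsilon> s) * fst (step_bridge \<epsilon> t)
     = fst s * snd t - snd s * fst t"
  by (cases s; cases t) (simp add: field_simps)

lemma below_step_pair [simp]: "below (step_pair \<epsilon> s) (step_pair \<epsilon> t) \<longleftrightarrow> below s t"
  using step_pair_det[of \<epsilon> s t] by (auto simp: below_def)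

lemma below_step_bridge [simp]: "below (step_bridge \<epsilon> s) (step_bridge \<epsilon> t) \<longleftrightarrow> below s t"
  using step_bridge_det[of \<epsilon> s t] by (auto simp: below_def)

text \<open>What the extremal graph satisfies in place of the exact step: the flow balance is an
  equation, the potential is only bounded from above.\<close>

definition pair_move :: "real \<Rightarrow> real \<times> real \<Rightarrow> real \<times> real \<Rightarrow> bool" where
  "pair_move \<epsilon> s t \<longleftrightarrow> fst t \<le> fst s + snd s / 2 \<and> snd t = snd s - 2 * \<epsilon> * fst t"

text \<open>The value \<open>x\<close> of the first of the two vertices is not part of a state,
  hence the quantifier. The second value exceeds it by at most the flow over the bridge.\<close>

definition bridge_move :: "real \<Rightarrow> real \<times> real \<Rightarrow> real \<times> real \<Rightarrow> bool" where
  "bridge_move \<epsilon> s t \<longleftrightarrow> (\<exists>x>0. x \<le> fst s + snd s / 2 \<and> fst t \<le> x + (snd s - \<epsilon> * x)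
     \<and> snd t = snd s - \<epsilon> * x - \<epsilon> * fst t)"

text \<open>A larger new potential also takes more from the flow, so the largest admissible one is
  extremal.\<close>

lemma pair_move_below:
  assumes "pair_move \<epsilon> s t" "0 < snd s"
  shows "below t (step_pair \<epsilon> s)"
proof (cases s; cases t)
  fix l \<Phi> l' \<Phi>' assume st: "s = (l, \<Phi>)" "t = (l', \<Phi>')"
  have "l' \<le> l + \<Phi>/2" "\<Phi>' = \<Phi> - 2 * \<epsilon> * l'" "0 < \<Phi>" using assms st by (auto simp: pair_move_def)
  then have "l' * \<Phi> \<le> (l + \<Phi>/2) * \<Phi>" by (intro mult_right_mono) auto
  then show ?thesis using st \<open>\<Phi>' = _\<close> by (simp add: below_def algebra_simps)
qed

lemma step_bridge_fst_pos:
  assumes "0 < fst s" "0 < snd s" "\<epsilon> < 1"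
  shows "0 < fst (step_bridge \<epsilon> s)"
  using assms by (cases s) (auto intro!: add_pos_pos mult_pos_pos)

text \<open>A bridge lowers the ratio of flow to potential at least as much as a pair. At the
  largest admissible potential the two differ by the square \<open>d * d\<close>.\<close>

lemma pair_move_below_bridge:
  assumes m: "pair_move \<epsilon> s t" and pos: "0 < fst s" "0 < snd s" "0 < fst t" "0 < \<epsilon>" "\<epsilon> < 1"
  shows "below t (step_bridge \<epsilon> s)"
proof (cases s; cases t)
  fix l \<Phi> l' \<Phi>' assume st: "s = (l, \<Phi>)" "t = (l', \<Phi>')"
  define x where "x = l + \<Phi>/2"
  define d where "d = \<Phi> - \<epsilon> * x"
  have h: "l' \<le> x" "\<Phi>' = \<Phi> - 2 * \<epsilon> * l'" "0 < \<Phi>" "0 < l'"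
    using assms st by (auto simp: pair_move_def x_def)
  have y: "fst (step_bridge \<epsilon> s) = x + d" "snd (step_bridge \<epsilon> s) = d - \<epsilon> * (x + d)"
    by (auto simp: st x_def d_def field_simps)
  have ypos: "0 < x + d" using step_bridge_fst_pos[OF pos(1,2,5)] y by simp
  have "l' * (\<Phi> + \<epsilon> * d) \<le> \<Phi> * (x + d)"
  proof (cases "0 \<le> \<Phi> + \<epsilon> * d")
    case True
    then have "l' * (\<Phi> + \<epsilon> * d) \<le> x * (\<Phi> + \<epsilon> * d)" using h by (intro mult_right_mono)
    moreover have "\<Phi> * (x + d) - x * (\<Phi> + \<epsilon> * d) = d * d" by (simp add: d_def algebra_simps)
    ultimately show ?thesis using zero_le_square[of d] by linarith
  next
    case False
    then have "l' * (\<Phi> + \<epsilon> * d) \<le> 0" using h by (simp add: mult_le_0_iff)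
    also have "0 \<le> \<Phi> * (x + d)" using h ypos by simp
    finally show ?thesis .
  qed
  then have "l' * (d - \<epsilon> * (x + d)) \<le> (\<Phi> - 2 * \<epsilon> * l') * (x + d)"
    by (simp add: d_def algebra_simps)
  then show ?thesis unfolding below_def y using h by (simp add: st)
qed

text \<open>Raising the first value from \<open>z\<close> to the largest admissible \<open>x\<close>
  moves the determinant by \<open>\<Phi> * (x - z)\<close> in the right direction. If
  \<open>x\<close> would already exhaust the flow, the signs decide.\<close>

lemma bridge_move_below:
  assumes m: "bridge_move \<epsilon> s t" and pos: "0 < fst s" "0 < snd s" "0 < fst t" "0 < snd t" "0 < \<epsilon>" "\<epsilon> < 1"
  shows "below t (step_bridge \<epsilon> s)"
proof (cases s; cases t)
  fix l \<Phi> l' \<Phi>' assume st: "s = (l, \<Phi>)" "t = (l', \<Phi>')"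
  define x where "x = l + \<Phi>/2"
  define y where "y = (1 - \<epsilon>) * x + \<Phi>"
  obtain z where h: "0 < z" "z \<le> x" "l' \<le> (1 - \<epsilon>) * z + \<Phi>" "\<Phi>' = \<Phi> - \<epsilon> * z - \<epsilon> * l'" "0 < \<Phi>" "0 < l'" "0 < \<Phi>'"
    using assms st by (auto simp: bridge_move_def x_def algebra_simps)
  have b: "fst (step_bridge \<epsilon> s) = y" "snd (step_bridge \<epsilon> s) = \<Phi> - \<epsilon> * x - \<epsilon> * y"
    by (auto simp: st x_def y_def algebra_simps)
  have ypos: "0 < y" using step_bridge_fst_pos[OF pos(1,2,6)] b by simp
  have flow: "0 < \<Phi> - \<epsilon> * z" using h \<open>0 < \<epsilon>\<close> mult_pos_pos[of \<epsilon> l'] by linarith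
  have "l' * (\<Phi> - \<epsilon> * x) \<le> (\<Phi> - \<epsilon> * z) * y"
  proof (cases "0 \<le> \<Phi> - \<epsilon> * x")
    case True
    then have "l' * (\<Phi> - \<epsilon> * x) \<le> ((1 - \<epsilon>) * z + \<Phi>) * (\<Phi> - \<epsilon> * x)" using h by (intro mult_right_mono)
    moreover have "(\<Phi> - \<epsilon> * z) * y - ((1 - \<epsilon>) * z + \<Phi>) * (\<Phi> - \<epsilon> * x) = \<Phi> * (x - z)"
      by (simp add: y_def algebra_simps)
    moreover have "0 \<le> \<Phi> * (x - z)" using h by simp
    ultimately show ?thesis by linarith
  next
    case False
    then have "l' * (\<Phi> - \<epsilon> * x) \<le> 0" using h by (simp add: mult_le_0_iff)
    also have "0 \<le> (\<Phi> - \<epsilon> * z) * y" using flow ypos by simp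
    finally show ?thesis .
  qed
  then have "l' * (\<Phi> - \<epsilon> * x - \<epsilon> * y) \<le> (\<Phi> - \<epsilon> * z - \<epsilon> * l') * y" by (simp add: algebra_simps)
  then show ?thesis unfolding below_def b using h by (simp add: st)
qed

lemma step_pair_fst_pos: "0 < fst s \<Longrightarrow> 0 < snd s \<Longrightarrow> 0 < fst (step_pair \<epsilon> s)"
  by (cases s) auto

lemma step_diamond_fst_pos:
  assumes "0 < fst s" "0 < snd s" "0 < \<epsilon>" "\<epsilon> < 1/10"
  shows "0 < fst (step_diamond \<epsilon> s)"
proof -
  obtain l \<Phi> where s: "s = (l, \<Phi>)" by (cases s)
  have "fst (step_diamond \<epsilon> s) = (1 - 4*\<epsilon> + \<epsilon>^2) * l + (2 - 5/2*\<epsilon> + \<epsilon>^2/2) * \<Phi>"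
    by (simp add: s step_diamond_def field_simps power2_eq_square)
  also have "\<dots> > 0"
    using assms zero_le_power2[of \<epsilon>] unfolding s fst_conv snd_conv
    by (intro add_pos_pos[OF mult_pos_pos mult_pos_pos]) linarith+
  finally show ?thesis .
qed

text \<open>Resistance placed early, where the flow is larger, lowers the flow-to-potential ratio more.\<close>

lemma pair_bridge_exchange:
  assumes pos: "0 < fst s" "0 < snd s" "0 < \<epsilon>" "\<epsilon> < 1/10"
    and fl: "0 < snd (step_pair \<epsilon> (step_bridge \<epsilon> s))"
  shows "below (step_bridge \<epsilon> (step_pair \<epsilon> s)) (step_pair \<epsilon> (step_bridge \<epsilon> s))"
proof (cases s)
  case (Pair l \<Phi>)
  have p: "0 < l" "0 < \<Phi>" using pos Pair by auto
  have e2: "\<epsilon>^2 \<le> \<epsilon>/10" using pos by (simp add: power2_eq_square)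
  have e3: "0 \<le> \<epsilon>^3" "0 \<le> \<epsilon>^4" "0 \<le> \<epsilon>^5" "\<epsilon>^4 \<le> \<epsilon>^3" "\<epsilon>^5 \<le> \<epsilon>^4" "\<epsilon>^3 \<le> \<epsilon>^2"
    using pos by (auto intro!: power_decreasing)
  have a: "0 < 1 - \<epsilon>" using pos by simp
  define x where "x = l + \<Phi>/2"
  define y where "y = (1 - \<epsilon>) * x + \<Phi>"
  define G where "G = \<Phi> - \<epsilon> * x - \<epsilon> * y"
  have G: "0 < G - 2 * \<epsilon> * (y + G/2)"
    using fl by (simp add: Pair x_def y_def G_def)
  have x: "l < x" using p by (simp add: x_def)
  have Gp: "0 < G"
  proof -
    have "0 < y" unfolding y_def using a p x by (intro add_pos_pos mult_pos_pos) auto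
    then have "0 < 2 * \<epsilon> * y" using pos by simp
    moreover have "0 < (1 - \<epsilon>) * G" using G \<open>0 < 2 * \<epsilon> * y\<close> by (simp add: algebra_simps)
    ultimately show ?thesis using a by (simp add: zero_less_mult_iff)
  qed
  have yx: "x \<le> y"
  proof -
    have "0 < \<epsilon> * y" using pos a p x unfolding y_def by (intro mult_pos_pos add_pos_pos) auto
    then show ?thesis using Gp by (simp add: y_def G_def algebra_simps)
  qed
  \<comment> \<open>The two steps pass four vertices, each taking at least
    \<open>\<epsilon> * l\<close> from the flow, and some flow is left. This is what absorbs the
    only positive term, the one with \<open>l^2\<close>.\<close>
  have \<Phi>l: "4 * \<epsilon> * l \<le> \<Phi>"
  proof -
    have "\<epsilon> * l \<le> \<epsilon> * x" "\<epsilon> * x \<le> \<epsilon> * y" "0 \<le> \<epsilon> * G" using x yx pos Gp by auto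
    moreover have "2 * (\<epsilon> * y) + \<epsilon> * G < G" using G by (simp add: algebra_simps)
    moreover have "G = \<Phi> - \<epsilon> * x - \<epsilon> * y" by (simp add: G_def)
    ultimately show ?thesis by linarith
  qed
  have "fst (step_bridge \<epsilon> (step_pair \<epsilon> s)) * snd (step_pair \<epsilon> (step_bridge \<epsilon> s))
      - snd (step_bridge \<epsilon> (step_pair \<epsilon> s)) * fst (step_pair \<epsilon> (step_bridge \<epsilon> s))
    = (8*\<epsilon>^2 - 12*\<epsilon>^3 + 9/2*\<epsilon>^4 - \<epsilon>^5/2) * l^2
      - (4*\<epsilon> - 21*\<epsilon>^2 + 18*\<epsilon>^3 - 21/4*\<epsilon>^4 + \<epsilon>^5/2) * (l * \<Phi>)
      - (5*\<epsilon> - 41/4*\<epsilon>^2 + 25/4*\<epsilon>^3 - 3/2*\<epsilon>^4 + \<epsilon>^5/8) * \<Phi>^2"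
    by (simp add: Pair field_simps power2_eq_square power3_eq_cube eval_nat_numeral)
  also have "\<dots> \<le> 8*\<epsilon>^2 * l^2 - (4*\<epsilon> - 21*\<epsilon>^2) * (l * \<Phi>) - (5*\<epsilon> - 41/4*\<epsilon>^2) * \<Phi>^2"
  proof -
    have "(8*\<epsilon>^2 - 12*\<epsilon>^3 + 9/2*\<epsilon>^4 - \<epsilon>^5/2) * l^2 \<le> 8*\<epsilon>^2 * l^2"
      using e3 by (intro mult_right_mono) (linarith, simp)
    moreover have "(4*\<epsilon> - 21*\<epsilon>^2) * (l * \<Phi>) \<le> (4*\<epsilon> - 21*\<epsilon>^2 + 18*\<epsilon>^3 - 21/4*\<epsilon>^4 + \<epsilon>^5/2) * (l * \<Phi>)"
      using e3 p by (intro mult_right_mono) (linarith, simp)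
    moreover have "(5*\<epsilon> - 41/4*\<epsilon>^2) * \<Phi>^2 \<le> (5*\<epsilon> - 41/4*\<epsilon>^2 + 25/4*\<epsilon>^3 - 3/2*\<epsilon>^4 + \<epsilon>^5/8) * \<Phi>^2"
      using e3 by (intro mult_right_mono) (linarith, simp)
    ultimately show ?thesis by linarith
  qed
  also have "\<dots> \<le> 0"
  proof -
    have "8*\<epsilon>^2 * l^2 = 2 * (\<epsilon> * l) * (4 * \<epsilon> * l)" by (simp add: power2_eq_square)
    also have "\<dots> \<le> 2 * (\<epsilon> * l) * \<Phi>" using \<Phi>l pos p by (intro mult_left_mono) auto
    finally have 1: "8*\<epsilon>^2 * l^2 \<le> 2 * \<epsilon> * (l * \<Phi>)" by simp
    have "11 * \<epsilon>^2 * (l * \<Phi>) = 11/4 * (\<epsilon> * \<Phi>) * (4 * \<epsilon> * l)" by (simp add: power2_eq_square)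
    also have "\<dots> \<le> 11/4 * (\<epsilon> * \<Phi>) * \<Phi>" using \<Phi>l pos p by (intro mult_left_mono) auto
    finally have 2: "11 * \<epsilon>^2 * (l * \<Phi>) \<le> 11/4 * (\<epsilon> * \<Phi>^2)" by (simp add: power2_eq_square)
    have 3: "\<epsilon>^2 * \<Phi>^2 \<le> \<epsilon>/10 * \<Phi>^2" using e2 by (intro mult_right_mono) auto
    have 4: "\<epsilon>^2 * (l * \<Phi>) \<le> \<epsilon>/10 * (l * \<Phi>)" using p e2 by (intro mult_right_mono) auto
    have 5: "0 \<le> \<epsilon> * (l * \<Phi>)" "0 \<le> \<epsilon> * \<Phi>^2" using p pos by auto
    have "8*\<epsilon>^2 * l^2 - (4*\<epsilon> - 21*\<epsilon>^2) * (l * \<Phi>) - (5*\<epsilon> - 41/4*\<epsilon>^2) * \<Phi>^2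
      = 8*\<epsilon>^2 * l^2 - 4 * (\<epsilon> * (l * \<Phi>)) + 10 * (\<epsilon>^2 * (l * \<Phi>)) + 11*\<epsilon>^2 * (l * \<Phi>)
        - 5 * (\<epsilon> * \<Phi>^2) + 41/4 * (\<epsilon>^2 * \<Phi>^2)" by (simp add: algebra_simps)
    then show ?thesis using 1 2 3 4 5 by linarith
  qed
  finally show ?thesis by (simp add: below_def)
qed

section \<open>Comparison with alternating pairs and bridges\<close>

fun comparison_chain :: "real \<Rightarrow> real \<times> real \<Rightarrow> nat \<Rightarrow> real \<times> real" where
  "comparison_chain \<epsilon> p 0 = p"
| "comparison_chain \<epsilon> p (Suc i) =
     (if even i then step_pair \<epsilon> else step_bridge \<epsilon>) (comparison_chain \<epsilon> p i)"

text \<open>Where the comparison chain has a bridge, it dominates either kind of move. Where it has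
  a pair and the graph has a bridge, the graph's preceding move is a pair while the comparison
  chain's is a bridge; these two steps are compared at once by
  \<open>pair_bridge_exchange\<close>.\<close>

lemma chain_below_comparison:
  fixes s :: "nat \<Rightarrow> real \<times> real"
  assumes eps: "0 < \<epsilon>" "\<epsilon> < 1/10"
    and pos: "\<And>i. i \<le> M \<Longrightarrow> 0 < fst (s i) \<and> 0 < snd (s i)"
    and move: "\<And>i. i < M \<Longrightarrow> if br i then bridge_move \<epsilon> (s i) (s (Suc i)) else pair_move \<epsilon> (s i) (s (Suc i))"
    and br: "\<not> br 0" "\<And>i. Suc i < M \<Longrightarrow> br i \<Longrightarrow> \<not> br (Suc i)"
    and alt: "\<And>i. i \<le> I \<Longrightarrow> 0 < fst (comparison_chain \<epsilon> (s 0) i)"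
    and "i \<le> I" "i \<le> M"
  shows "below (s i) (comparison_chain \<epsilon> (s 0) i)"
  using assms(8,9)
proof (induction i rule: less_induct)
  case (less i)
  let ?c = "comparison_chain \<epsilon> (s 0)"
  let ?N = "step_pair \<epsilon>" and ?B = "step_bridge \<epsilon>"
  have e1: "\<epsilon> < 1" using eps by simp
  show ?case
  proof (cases i)
    case 0
    then show ?thesis by (simp add: below_def mult.commute)
  next
    case (Suc k)
    have k: "k < M" "k \<le> I" using Suc less.prems by auto
    have IH: "below (s k) (?c k)" using less.IH[of k] k Suc by auto
    have ps: "0 < fst (s k)" "0 < snd (s k)" "0 < fst (s i)" "0 < snd (s i)"
      using pos[of k] pos[of i] k less.prems by auto
    have ca: "0 < fst (?c i)" using alt less.prems by auto
    have fB: "0 < fst (?B (s k))" using step_bridge_fst_pos[OF ps(1,2) e1] .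
    show ?thesis
    proof (cases "even k")
      case ev: True
      show ?thesis
      proof (cases "br k")
        case False
        then have "pair_move \<epsilon> (s k) (s i)" using move[OF k(1)] Suc by simp
        then have "below (s i) (?N (s k))" using pair_move_below ps by blast
        moreover have "below (?N (s k)) (?c i)" using IH Suc ev by simp
        ultimately show ?thesis
          using below_trans[of "s i" "?N (s k)"] ps ca step_pair_fst_pos[OF ps(1,2)] by simp
      next
        case True
        then obtain j where j: "k = Suc j" using br(1) by (cases k) auto
        then have nb: "\<not> br j" using br(2)[of j] True k by auto
        have js: "0 < fst (s j)" "0 < snd (s j)" using pos[of j] k j by auto
        have m1: "pair_move \<epsilon> (s j) (s k)" using move[of j] nb j k by simp
        have m2: "bridge_move \<epsilon> (s k) (s i)" using move[OF k(1)] True Suc by simp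
        have IHj: "below (s j) (?c j)" using less.IH[of j] j Suc less.prems by auto
        have c: "?c i = ?N (?B (?c j))" using Suc j ev by simp
        \<comment> \<open>The exchange needs positive flow after both steps. If the comparison chain
          has none left, the claim holds by signs alone.\<close>
        show ?thesis
        proof (cases "0 < snd (?c i)")
          case False
          then have "fst (s i) * snd (?c i) \<le> 0" using ps by (simp add: mult_le_0_iff)
          also have "0 \<le> snd (s i) * fst (?c i)" using ps ca by simp
          finally show ?thesis by (simp add: below_def)
        next
          case True
          have NB: "below (?N (?B (s j))) (?c i)" using IHj c by simp
          have fNB: "0 < fst (?N (?B (s j)))"
          proof -
            obtain l \<Phi> where lp: "s j = (l, \<Phi>)" by (cases "s j")
            have "fst (?N (?B (s j))) = (1 - 2*\<epsilon> + \<epsilon>^2/2) * l + (2 - 3/2*\<epsilon> + \<epsilon>^2/4) * \<Phi>"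
              by (simp add: lp field_simps power2_eq_square)
            also have "\<dots> > 0"
              using js eps zero_le_power2[of \<epsilon>] unfolding lp fst_conv snd_conv
              by (intro add_pos_pos[OF mult_pos_pos mult_pos_pos]) linarith+
            finally show ?thesis .
          qed
          have "0 < fst (?N (?B (s j))) * snd (?c i)" using fNB True by simp
          also have "\<dots> \<le> snd (?N (?B (s j))) * fst (?c i)" using NB by (simp add: below_def)
          finally have "0 < snd (?N (?B (s j)))" using ca by (simp add: zero_less_mult_iff)
          then have BN: "below (?B (?N (s j))) (?N (?B (s j)))"
            using pair_bridge_exchange js eps by blast
          have fBN: "0 < fst (?B (?N (s j)))"
            using step_diamond_fst_pos js eps by (simp add: step_diamond_def)
          have "below (s i) (?B (s k))" using bridge_move_below[OF m2] ps eps e1 by auto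
          moreover have "below (?B (s k)) (?B (?N (s j)))" using pair_move_below m1 js by simp
          ultimately have "below (s i) (?B (?N (s j)))"
            using below_trans[of "s i" "?B (s k)"] ps fBN fB by simp
          then have "below (s i) (?N (?B (s j)))"
            using below_trans[OF _ BN] ps fBN fNB by simp
          then show ?thesis using below_trans[OF _ NB] ps ca fNB by simp
        qed
      qed
    next
      case od: False
      have "below (s i) (?B (s k))"
      proof (cases "br k")
        case True
        then show ?thesis using bridge_move_below move[OF k(1)] ps eps e1 Suc by auto
      next
        case False
        then show ?thesis using pair_move_below_bridge move[OF k(1)] ps eps e1 Suc by auto
      qed
      moreover have "below (?B (s k)) (?c i)" using IH Suc od by simp
      ultimately show ?thesis using below_trans[of "s i" "?B (s k)"] ps ca fB by simp
    qed
  qed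
qed


text \<open>The state behind the third vertex in the second case: if the pendant vertex has value 1,
  the eigenvalue equations give \<open>3 - \<epsilon>\<close> and
  \<open>(3 - \<epsilon>)^2 - 1\<close> to the next two.\<close>

definition chain_start :: "real \<Rightarrow> real \<times> real" where
  "chain_start \<epsilon> = ((3 - \<epsilon>)^2 - 1, (1 - \<epsilon>) * ((3 - \<epsilon>)^2 - 1) - (3 - \<epsilon>))"

text \<open>Let \<open>p\<close> be \<open>chain_start \<epsilon>\<close>, let \<open>q = (1, 1 - \<epsilon>)\<close> be the start of the chain with a root of degree 2,
  and let \<open>T\<close> be the linear map \<open>step_diamond \<epsilon>\<close>. Then \<open>W q = U p - (3 - \<epsilon>) T p\<close> with \<open>W = - det (p, T p)\<close> and
  \<open>U = - det (q, T p)\<close>, which are \<open>lead_weight\<close> and \<open>start_weight\<close>. This relation is preserved by \<open>T\<close>, so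
  the second chain can be read off the first.\<close>

definition lead_weight :: "real \<Rightarrow> real" where
  "lead_weight \<epsilon> = 50 - 133/2*\<epsilon> + 63/2*\<epsilon>^2 - 13/2*\<epsilon>^3 + \<epsilon>^4/2"

definition start_weight :: "real \<Rightarrow> real" where
  "start_weight \<epsilon> = 13 - 59/2*\<epsilon> + 41/2*\<epsilon>^2 - 11/2*\<epsilon>^3 + \<epsilon>^4/2"

lemma step_diamond_eq:
  "fst (step_diamond \<epsilon> (a, F)) = (1 - 4*\<epsilon> + \<epsilon>^2) * a + (2 - 5/2*\<epsilon> + \<epsilon>^2/2) * F"
  "snd (step_diamond \<epsilon> (a, F)) = (- 4*\<epsilon> + 5*\<epsilon>^2 - \<epsilon>^3) * a + (1 - 4*\<epsilon> + 3*\<epsilon>^2 - \<epsilon>^3/2) * F"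
  by (simp_all add: step_diamond_def field_simps power2_eq_square power3_eq_cube)

lemma diamond_chain_combination:
  fixes \<epsilon> :: real
  defines "P \<equiv> \<lambda>j. (step_diamond \<epsilon> ^^ j) (chain_start \<epsilon>)"
    and "Q \<equiv> \<lambda>j. (step_diamond \<epsilon> ^^ j) (1, 1 - \<epsilon>)"
  shows "lead_weight \<epsilon> * fst (Q j) = start_weight \<epsilon> * fst (P j) - (3 - \<epsilon>) * fst (P (Suc j))
       \<and> lead_weight \<epsilon> * snd (Q j) = start_weight \<epsilon> * snd (P j) - (3 - \<epsilon>) * snd (P (Suc j))"
proof (induction j)
  case 0
  \<comment> \<open>Cramer's rule for \<open>q\<close> in terms of \<open>p\<close> and
    \<open>T p\<close>; the coefficient \<open>3 - \<epsilon>\<close> is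
    \<open>det (p, q)\<close>.\<close>
  show ?case
    by (simp add: P_def Q_def step_diamond_eq chain_start_def lead_weight_def start_weight_def
        field_simps power2_eq_square power3_eq_cube eval_nat_numeral)
next
  case (Suc j)
  obtain a F where p: "P j = (a, F)" by (cases "P j")
  obtain a' F' where p': "P (Suc j) = (a', F')" by (cases "P (Suc j)")
  obtain b G where q: "Q j = (b, G)" by (cases "Q j")
  have P2: "P (Suc (Suc j)) = step_diamond \<epsilon> (a', F')" using p' by (simp add: P_def)
  have P1: "step_diamond \<epsilon> (a, F) = (a', F')" using p p' by (simp add: P_def)
  have Q1: "Q (Suc j) = step_diamond \<epsilon> (b, G)" using q by (simp add: Q_def)
  have IH: "lead_weight \<epsilon> * b = start_weight \<epsilon> * a - (3 - \<epsilon>) * a'"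
    "lead_weight \<epsilon> * G = start_weight \<epsilon> * F - (3 - \<epsilon>) * F'"
    using Suc p p' q by auto
  have lin: "w * (c * b + d * G) = u * (c * a + d * F) - v * (c * a' + d * F')"
    if "w * b = u * a - v * a'" "w * G = u * F - v * F'" for w u v c d :: real
    using arg_cong[OF that(1), of "(*) c"] arg_cong[OF that(2), of "(*) d"] by (simp add: algebra_simps)
  have "a' = fst (step_diamond \<epsilon> (a, F))" "F' = snd (step_diamond \<epsilon> (a, F))" using P1 by auto
  then show ?case
    unfolding Q1 P2 unfolding p' step_diamond_eq fst_conv snd_conv
    using lin[OF IH] by (simp only: step_diamond_eq)
qed

section \<open>Ending a chain on a plateau\<close>

lemma diamond_death:
  assumes "0 < fst s" "0 < snd s" "0 < \<epsilon>" "\<epsilon> < 1/10" "snd (step_diamond \<epsilon> s) \<le> 0"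
  shows "snd s \<le> 4 * \<epsilon> * (fst s + snd s)"
proof -
  obtain a F where s: "s = (a, F)" by (cases s)
  have "0 \<le> \<epsilon>^2" "\<epsilon>^3 \<le> \<epsilon>^2" using assms power_decreasing[of 2 3 \<epsilon>] by auto
  then have e2: "0 \<le> 5*\<epsilon>^2 - \<epsilon>^3" "0 \<le> 3*\<epsilon>^2 - \<epsilon>^3/2" by linarith+
  \<comment> \<open>To first order in \<epsilon> a diamond takes
    \<open>4 * \<epsilon> * (a + F)\<close> from the flow, and the terms of higher order are
    nonnegative.\<close>
  have "snd (step_diamond \<epsilon> s) = F - 4*\<epsilon>*(a + F) + (5*\<epsilon>^2 - \<epsilon>^3) * a + (3*\<epsilon>^2 - \<epsilon>^3/2) * F"
    by (simp add: s step_diamond_eq algebra_simps)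
  moreover have "0 \<le> (5*\<epsilon>^2 - \<epsilon>^3) * a" "0 \<le> (3*\<epsilon>^2 - \<epsilon>^3/2) * F"
    using e2 assms s by simp_all
  ultimately show ?thesis using assms(5) s by auto
qed

text \<open>The expression is the gap in \<open>rooted_plateau\<close> for
  \<open>m = a + F/2\<close>, the value reached when the flow splits over two edges. It factors as
  \<open>m * (r * \<epsilon> * m - F)\<close>: there is a gain when \<open>r\<close> vertices on the
  plateau would take more than the flow \<open>F\<close>.\<close>

lemma plateau_gain:
  fixes \<epsilon> r a F :: real
  assumes "0 < a + F/2" "0 < 2 * r * \<epsilon> * a - (2 - r * \<epsilon>) * F"
  shows "0 < r * \<epsilon> * (a + F/2)^2 - F^2/2 - a * F"
proof -
  have "r * \<epsilon> * (a + F/2)^2 - F^2/2 - a * F = (a + F/2) * ((2 * r * \<epsilon> * a - (2 - r * \<epsilon>) * F) / 2)"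
    by (simp add: field_simps power2_eq_square)
  moreover have "0 < (a + F/2) * ((2 * r * \<epsilon> * a - (2 - r * \<epsilon>) * F) / 2)" using assms by simp
  ultimately show ?thesis by linarith
qed

text \<open>The alternatives are the ways to stop: after all diamonds with 4 or 6 vertices left
  besides the last root, or earlier because the flow runs out. Each bounds the flow of
  \<open>P\<close> by a small multiple of \<epsilon> times its potential, and
  \<open>diamond_chain_combination\<close> turns the claim about \<open>Q\<close> into a linear
  inequality in these two quantities.\<close>

lemma chain_end_positive:
  fixes \<epsilon> r :: real and j :: nat
  defines "P \<equiv> (step_diamond \<epsilon> ^^ j) (chain_start \<epsilon>)" and "Q \<equiv> (step_diamond \<epsilon> ^^ j) (1, 1 - \<epsilon>)"
  assumes eps: "0 < \<epsilon>" "\<epsilon> < 1/10" and pos: "0 < fst P" "0 < snd P"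
    and cs: "r = 4 \<and> snd P * (1 - \<epsilon>/2) \<le> 2 * \<epsilon> * fst P \<or>
       r = 6 \<and> \<epsilon> \<le> 3/47 \<and> snd P * (1 - \<epsilon>/2) \<le> 2 * \<epsilon> * (2 - \<epsilon>/2) * (fst P + snd P / 2) \<or>
       8 \<le> r \<and> \<epsilon> \<le> 2/25 \<and> snd P \<le> 4 * \<epsilon> * (fst P + snd P)"
  shows "0 < r * \<epsilon> * (fst Q + snd Q/2)^2 - (snd Q)^2/2 - fst Q * snd Q"
proof -
  obtain A \<Phi> where P: "P = (A, \<Phi>)" by (cases P)
  obtain a f where Q: "Q = (a, f)" by (cases Q)
  define W where "W = lead_weight \<epsilon>"
  have pw: "0 \<le> \<epsilon>^2" "0 \<le> \<epsilon>^3" "0 \<le> \<epsilon>^4" "\<epsilon>^3 \<le> \<epsilon>^2" "\<epsilon>^4 \<le> \<epsilon>^3" "\<epsilon>^2 \<le> \<epsilon>/10"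
    using eps power_decreasing[of 2 3 \<epsilon>] power_decreasing[of 3 4 \<epsilon>] by (auto simp: power2_eq_square[of \<epsilon>])
  have W: "0 < W" using eps pw unfolding W_def lead_weight_def by linarith
  have T: "(step_diamond \<epsilon> ^^ Suc j) (chain_start \<epsilon>) = step_diamond \<epsilon> (A, \<Phi>)" using P by (simp add: P_def)
  note comb = diamond_chain_combination[of \<epsilon> j, folded P_def Q_def, unfolded T, unfolded P Q step_diamond_eq fst_conv snd_conv, folded W_def]
  have Wa: "W * a = (10 - 33/2*\<epsilon> + 27/2*\<epsilon>^2 - 9/2*\<epsilon>^3 + \<epsilon>^4/2) * A + (- 6 + 19/2*\<epsilon> - 4*\<epsilon>^2 + \<epsilon>^3/2) * \<Phi>"
    and Wf: "W * f = (12*\<epsilon> - 19*\<epsilon>^2 + 8*\<epsilon>^3 - \<epsilon>^4) * A + (10 - 33/2*\<epsilon> + 15/2*\<epsilon>^2 - \<epsilon>^3) * \<Phi>"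
    using comb by (simp_all add: start_weight_def field_simps power2_eq_square power3_eq_cube eval_nat_numeral)
  have AP: "0 < A" "0 < \<Phi>" using pos P by auto
  have eA: "0 < \<epsilon> * A" using AP eps by simp
  have Wh: "W * (a + f/2) = (10 - 21/2*\<epsilon> + 4*\<epsilon>^2 - \<epsilon>^3/2) * A - (1 - 5/4*\<epsilon> + \<epsilon>^2/4) * \<Phi>"
  proof -
    have "W * (a + f/2) = W * a + (W * f) / 2" by (simp add: algebra_simps)
    then show ?thesis unfolding Wa Wf by (simp add: field_simps)
  qed
  have half: "0 < a + f/2" if "\<Phi> \<le> A"
  proof -
    have "(1 - 5/4*\<epsilon> + \<epsilon>^2/4) * \<Phi> \<le> 1 * \<Phi>" using pw eps AP by (intro mult_right_mono) linarith+
    moreover have "8 * A \<le> (10 - 21/2*\<epsilon> + 4*\<epsilon>^2 - \<epsilon>^3/2) * A" using pw eps AP by (intro mult_right_mono) linarith+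
    ultimately have "0 < W * (a + f/2)" unfolding Wh using that AP by linarith
    then show ?thesis using W by (simp add: zero_less_mult_iff)
  qed
  have WL: "W * (2 * r * \<epsilon> * a - (2 - r * \<epsilon>) * f) = 2 * r * \<epsilon> * (W * a) - (2 - r * \<epsilon>) * (W * f)" for r
    by (simp add: algebra_simps)
  \<comment> \<open>The hypothesis on \<open>c * \<Phi>\<close> eliminates \<open>\<Phi>\<close>
    from \<open>c * X\<close>, so that each case reduces to the inequality
    \<open>k * v < c * u\<close> between polynomials in \<epsilon>.\<close>
  have fin: "0 < X" if "0 < c" "c * \<Phi> \<le> k * (\<epsilon> * A)" "X = u * (\<epsilon> * A) - v * \<Phi>" "0 < v" "k * v < c * u" for X c k u v :: real
  proof -
    have "c * X = c * u * (\<epsilon> * A) - v * (c * \<Phi>)" unfolding that(3) by (simp add: algebra_simps)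
    moreover have "v * (c * \<Phi>) \<le> v * (k * (\<epsilon> * A))" using that by (intro mult_left_mono) auto
    moreover have "k * v * (\<epsilon> * A) < c * u * (\<epsilon> * A)" using that eA by (intro mult_strict_right_mono) auto
    ultimately have "0 < c * X" by (simp add: algebra_simps)
    then show ?thesis using that(1) by (simp add: zero_less_mult_iff)
  qed
  have "0 < a + f/2 \<and> 0 < 2 * r * \<epsilon> * a - (2 - r * \<epsilon>) * f"
    using cs
  proof (elim disjE conjE)
    assume r: "r = 4" and c: "snd P * (1 - \<epsilon>/2) \<le> 2 * \<epsilon> * fst P"
    have c: "(1 - \<epsilon>/2) * \<Phi> \<le> 2 * (\<epsilon> * A)" using c P by (simp add: mult.commute)
    have "19/20 * \<Phi> \<le> (1 - \<epsilon>/2) * \<Phi>" using eps AP by (intro mult_right_mono) auto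
    moreover have "2 * (\<epsilon> * A) \<le> 1/5 * A" using eps AP by simp
    ultimately have "\<Phi> \<le> A" using c AP by linarith
    moreover have "0 < W * (2 * r * \<epsilon> * a - (2 - r * \<epsilon>) * f)"
    proof (rule fin[OF _ c])
      show "W * (2 * r * \<epsilon> * a - (2 - r * \<epsilon>) * f)
        = (56 - 46*\<epsilon> + 16*\<epsilon>^2 - 2*\<epsilon>^3) * (\<epsilon> * A) - (20 - 25*\<epsilon> + 5*\<epsilon>^2) * \<Phi>"
        unfolding WL Wa Wf r by (simp add: field_simps power2_eq_square power3_eq_cube eval_nat_numeral)
      have "(1 - \<epsilon>/2) * 50 \<le> (1 - \<epsilon>/2) * (56 - 46*\<epsilon> + 16*\<epsilon>^2 - 2*\<epsilon>^3)"
        using eps pw by (intro mult_left_mono) linarith+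
      moreover have "2 * (20 - 25*\<epsilon> + 5*\<epsilon>^2) < (1 - \<epsilon>/2) * 50"
      proof -
        have "10 * \<epsilon>^2 \<le> \<epsilon>" using pw by linarith
        then show ?thesis using eps by (simp add: algebra_simps)
      qed
      ultimately show "2 * (20 - 25*\<epsilon> + 5*\<epsilon>^2) < (1 - \<epsilon>/2) * (56 - 46*\<epsilon> + 16*\<epsilon>^2 - 2*\<epsilon>^3)"
        by (rule order.strict_trans2[rotated])
    qed (use eps pw in linarith)+
    ultimately show ?thesis using half W by (simp add: zero_less_mult_iff)
  next
    assume r: "r = 6" and e: "\<epsilon> \<le> 3/47" and c: "snd P * (1 - \<epsilon>/2) \<le> 2 * \<epsilon> * (2 - \<epsilon>/2) * (fst P + snd P / 2)"
    have "\<Phi> * (1 - \<epsilon>/2) \<le> 2 * \<epsilon> * (2 - \<epsilon>/2) * (A + \<Phi>/2)" using c P by simp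
    also have "\<dots> \<le> 2 * \<epsilon> * 2 * (A + \<Phi>/2)" using eps AP by (intro mult_right_mono mult_left_mono) auto
    finally have c: "(1 - 5/2*\<epsilon>) * \<Phi> \<le> 4 * (\<epsilon> * A)" by (simp add: algebra_simps)
    have "3/4 * \<Phi> \<le> (1 - 5/2*\<epsilon>) * \<Phi>" using eps AP by (intro mult_right_mono) auto
    moreover have "4 * (\<epsilon> * A) \<le> 2/5 * A" using eps AP by simp
    ultimately have "\<Phi> \<le> A" using c AP by linarith
    moreover have "0 < W * (2 * r * \<epsilon> * a - (2 - r * \<epsilon>) * f)"
    proof (rule fin[OF _ c])
      show "W * (2 * r * \<epsilon> * a - (2 - r * \<epsilon>) * f)
        = (96 - 88*\<epsilon> + 32*\<epsilon>^2 - 4*\<epsilon>^3) * (\<epsilon> * A) - (20 - 21*\<epsilon> + \<epsilon>^3) * \<Phi>"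
        unfolding WL Wa Wf r by (simp add: field_simps power2_eq_square power3_eq_cube eval_nat_numeral)
      have "(1 - 5/2*\<epsilon>) * (96 - 88*\<epsilon>) \<le> (1 - 5/2*\<epsilon>) * (96 - 88*\<epsilon> + 32*\<epsilon>^2 - 4*\<epsilon>^3)"
        using eps pw by (intro mult_left_mono) linarith+
      moreover have "(1 - 5/2*\<epsilon>) * (96 - 88*\<epsilon>) = 96 - 328*\<epsilon> + 220*\<epsilon>^2"
        by (simp add: algebra_simps power2_eq_square)
      moreover have "4 * (20 - 21*\<epsilon> + \<epsilon>^3) < 96 - 328*\<epsilon> + 220*\<epsilon>^2"
        unfolding right_diff_distrib distrib_left using eps pw e by linarith
      ultimately show "4 * (20 - 21*\<epsilon> + \<epsilon>^3) < (1 - 5/2*\<epsilon>) * (96 - 88*\<epsilon> + 32*\<epsilon>^2 - 4*\<epsilon>^3)"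
        by (simp only:)
    qed (use eps pw in linarith)+
    ultimately show ?thesis using half W by (simp add: zero_less_mult_iff)
  next
    assume r: "8 \<le> r" and e: "\<epsilon> \<le> 2/25" and c: "snd P \<le> 4 * \<epsilon> * (fst P + snd P)"
    have c: "(1 - 4*\<epsilon>) * \<Phi> \<le> 4 * (\<epsilon> * A)" using c P by (simp add: algebra_simps)
    have "3/5 * \<Phi> \<le> (1 - 4*\<epsilon>) * \<Phi>" using eps AP by (intro mult_right_mono) auto
    moreover have "4 * (\<epsilon> * A) \<le> 2/5 * A" using eps AP by simp
    ultimately have "\<Phi> \<le> A" using c AP by linarith
    then have h: "0 < a + f/2" by (rule half)
    \<comment> \<open>The value 8 is the worst case, since the expression grows with
      \<open>r\<close> at the rate \<open>2 * \<epsilon> * (a + f/2)\<close>.\<close>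
    have "0 < W * (2 * 8 * \<epsilon> * a - (2 - 8 * \<epsilon>) * f)"
    proof (rule fin[OF _ c])
      show "W * (2 * 8 * \<epsilon> * a - (2 - 8 * \<epsilon>) * f)
        = (136 - 130*\<epsilon> + 48*\<epsilon>^2 - 6*\<epsilon>^3) * (\<epsilon> * A) - (20 - 17*\<epsilon> - 5*\<epsilon>^2 + 2*\<epsilon>^3) * \<Phi>"
        unfolding WL Wa Wf by (simp add: field_simps power2_eq_square power3_eq_cube eval_nat_numeral)
      have "(1 - 4*\<epsilon>) * (136 - 130*\<epsilon>) \<le> (1 - 4*\<epsilon>) * (136 - 130*\<epsilon> + 48*\<epsilon>^2 - 6*\<epsilon>^3)"
        using eps pw by (intro mult_left_mono) linarith+
      moreover have "(1 - 4*\<epsilon>) * (136 - 130*\<epsilon>) = 136 - 674*\<epsilon> + 520*\<epsilon>^2"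
        by (simp add: algebra_simps power2_eq_square)
      moreover have "4 * (20 - 17*\<epsilon> - 5*\<epsilon>^2 + 2*\<epsilon>^3) < 136 - 674*\<epsilon> + 520*\<epsilon>^2"
        unfolding right_diff_distrib distrib_left using eps pw e by linarith
      ultimately show "4 * (20 - 17*\<epsilon> - 5*\<epsilon>^2 + 2*\<epsilon>^3) < (1 - 4*\<epsilon>) * (136 - 130*\<epsilon> + 48*\<epsilon>^2 - 6*\<epsilon>^3)"
        by (simp only:)
    qed (use eps pw in linarith)+
    then have "0 < 2 * 8 * \<epsilon> * a - (2 - 8 * \<epsilon>) * f" using W by (simp add: zero_less_mult_iff)
    moreover have "2 * r * \<epsilon> * a - (2 - r * \<epsilon>) * f = 2 * 8 * \<epsilon> * a - (2 - 8 * \<epsilon>) * f + 2 * (r - 8) * \<epsilon> * (a + f/2)"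
      by (simp add: algebra_simps)
    moreover have "0 \<le> 2 * (r - 8) * \<epsilon> * (a + f/2)" using r eps h by simp
    ultimately show ?thesis using h by linarith
  qed
  then show ?thesis using plateau_gain[of a f r \<epsilon>] Q by simp
qed

lemma comparison_chain_even: "comparison_chain \<epsilon> p (2 * j) = (step_diamond \<epsilon> ^^ j) p"
  by (induction j) (simp_all add: step_diamond_def)

text \<open>If the comparison chain keeps positive flow through all \<open>K\<close> diamonds, its
  end inherits the bound \<open>fin\<close> from the graph. Otherwise the plateau replaces
  everything behind the last state with positive flow; this is at least one diamond more than the
  end piece, so \<rho> is at least 8.\<close>

lemma deficient_chain_gain:
  fixes s :: "nat \<Rightarrow> real \<times> real"
  assumes eps: "0 < \<epsilon>"
    and pos: "\<And>i. i \<le> M \<Longrightarrow> 0 < fst (s i) \<and> 0 < snd (s i)"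
    and move: "\<And>i. i < M \<Longrightarrow> if br i then bridge_move \<epsilon> (s i) (s (Suc i)) else pair_move \<epsilon> (s i) (s (Suc i))"
    and br: "\<not> br 0" "\<And>i. Suc i < M \<Longrightarrow> br i \<Longrightarrow> \<not> br (Suc i)"
    and start: "s 0 = chain_start \<epsilon>"
    and fin: "snd (s M) * (1 - \<epsilon>/2) \<le> 2 * \<epsilon> * fst (s M)"
    and M: "M = 2 * K \<and> r = 4 \<and> \<epsilon> \<le> 2/25 \<or> M = Suc (2 * K) \<and> r = 6 \<and> \<epsilon> \<le> 3/47"
  shows "\<exists>J\<le>K. let (a, F) = (step_diamond \<epsilon> ^^ J) (1, 1 - \<epsilon>); \<rho> = r + 4 * real (K - J)
           in 0 < \<rho> * \<epsilon> * (a + F/2)^2 - F^2/2 - a * F"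
proof -
  have e: "\<epsilon> < 1/10" "\<epsilon> \<le> 2/25" using M by auto
  define P where "P = (\<lambda>j. (step_diamond \<epsilon> ^^ j) (chain_start \<epsilon>))"
  define alive where "alive = (\<lambda>j. 0 < fst (P j) \<and> 0 < snd (P j))"
  have goal: ?thesis if "J \<le> K" "0 < \<rho> * \<epsilon> * (fst Q + snd Q/2)^2 - (snd Q)^2/2 - fst Q * snd Q"
    "Q = (step_diamond \<epsilon> ^^ J) (1, 1 - \<epsilon>)" "\<rho> = r + 4 * real (K - J)" for J \<rho> Q
    using that by (intro exI[of _ J]) (auto simp: Let_def split: prod.splits)
  have "alive 0"
  proof -
    have "\<epsilon>^2 \<ge> 0" "\<epsilon>^3 \<le> \<epsilon>^2" using eps e power_decreasing[of 2 3 \<epsilon>] by auto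
    moreover have "snd (chain_start \<epsilon>) = 5 - 13*\<epsilon> + 7*\<epsilon>^2 - \<epsilon>^3" "fst (chain_start \<epsilon>) = 8 - 6*\<epsilon> + \<epsilon>^2"
      by (simp_all add: chain_start_def field_simps power2_eq_square power3_eq_cube)
    moreover have "P 0 = chain_start \<epsilon>" by (simp add: P_def)
    ultimately show ?thesis unfolding alive_def using e eps by (simp only:) linarith
  qed
  show ?thesis
  proof (cases "\<forall>j\<le>K. alive j")
    case True
    have fin': "r = 4 \<and> snd (P K) * (1 - \<epsilon>/2) \<le> 2 * \<epsilon> * fst (P K) \<or>
       r = 6 \<and> \<epsilon> \<le> 3/47 \<and> snd (P K) * (1 - \<epsilon>/2) \<le> 2 * \<epsilon> * (2 - \<epsilon>/2) * (fst (P K) + snd (P K) / 2)"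
    proof -
      have Pc: "P j = comparison_chain \<epsilon> (s 0) (2 * j)" for j by (simp add: P_def comparison_chain_even start)
      have Pc': "step_pair \<epsilon> (P j) = comparison_chain \<epsilon> (s 0) (Suc (2 * j))" for j by (simp add: Pc)
      have cpos: "0 < fst (comparison_chain \<epsilon> (s 0) i)" if "i \<le> Suc (2 * K)" for i
      proof (cases "even i")
        case True
        then obtain j where "i = 2 * j" by auto
        then have "alive j" "i = 2 * j" using True \<open>\<forall>j\<le>K. alive j\<close> that by auto
        then show ?thesis using Pc[of j] by (simp add: alive_def)
      next
        case False
        then obtain j where j: "i = Suc (2 * j)" by (auto elim: oddE)
        then have "alive j" using \<open>\<forall>j\<le>K. alive j\<close> that by auto
        then show ?thesis using step_pair_fst_pos unfolding j Pc'[symmetric] by (auto simp: alive_def)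
      qed
      have bel: "below (s M) (comparison_chain \<epsilon> (s 0) M)"
        by (rule chain_below_comparison[where M = M and I = "Suc (2 * K)" and br = br])
          (use eps e pos move br cpos M in auto)
      have sM: "0 < fst (s M)" "0 < snd (s M)" using pos by auto
      have cM: "0 < fst (comparison_chain \<epsilon> (s 0) M)" using cpos M by auto
      have "snd (comparison_chain \<epsilon> (s 0) M) * (1 - \<epsilon>/2) \<le> 2 * \<epsilon> * fst (comparison_chain \<epsilon> (s 0) M)"
        (is "?F * _ \<le> _ * ?a")
      proof -
        have "fst (s M) * (?F * (1 - \<epsilon>/2)) = (fst (s M) * ?F) * (1 - \<epsilon>/2)" by simp
        also have "\<dots> \<le> (snd (s M) * ?a) * (1 - \<epsilon>/2)"
          using bel e by (intro mult_right_mono) (auto simp: below_def)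
        also have "\<dots> = ?a * (snd (s M) * (1 - \<epsilon>/2))" by simp
        also have "\<dots> \<le> ?a * (2 * \<epsilon> * fst (s M))" using fin cM by (intro mult_left_mono) auto
        also have "\<dots> = fst (s M) * (2 * \<epsilon> * ?a)" by simp
        finally show ?thesis using sM by simp
      qed
      then show ?thesis using M
      proof (elim disjE)
        assume c: "snd (comparison_chain \<epsilon> (s 0) M) * (1 - \<epsilon>/2) \<le> 2 * \<epsilon> * fst (comparison_chain \<epsilon> (s 0) M)"
          and m: "M = Suc (2 * K) \<and> r = 6 \<and> \<epsilon> \<le> 3/47"
        \<comment> \<open>For odd \<open>M\<close> the comparison chain ends with a pair behind the
          last diamond. Undoing this step in the bound gives the second alternative of
          \<open>chain_end_positive\<close>.\<close>
        obtain A \<Phi> where PK: "P K = (A, \<Phi>)" by (cases "P K")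
        have "comparison_chain \<epsilon> (s 0) M = step_pair \<epsilon> (P K)" using m Pc' by simp
        then show ?thesis using c m PK by (simp add: algebra_simps)
      qed (use Pc in auto)
    qed
    show ?thesis
    proof (rule goal[of K r "(step_diamond \<epsilon> ^^ K) (1, 1 - \<epsilon>)"])
      show "0 < r * \<epsilon> * (fst ((step_diamond \<epsilon> ^^ K) (1, 1 - \<epsilon>)) + snd ((step_diamond \<epsilon> ^^ K) (1, 1 - \<epsilon>))/2)^2
        - (snd ((step_diamond \<epsilon> ^^ K) (1, 1 - \<epsilon>)))^2/2
        - fst ((step_diamond \<epsilon> ^^ K) (1, 1 - \<epsilon>)) * snd ((step_diamond \<epsilon> ^^ K) (1, 1 - \<epsilon>))"
        using chain_end_positive[OF eps e(1), of K r] True fin' unfolding alive_def P_def by blast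
    qed auto
  next
    case False
    define j where "j = (LEAST j. \<not> alive j)"
    have j: "\<not> alive j" "j \<le> K"
      using False LeastI_ex[of "\<lambda>j. \<not> alive j"] Least_le[of "\<lambda>j. \<not> alive j"]
      unfolding j_def by (auto intro: order_trans)
    then obtain J where J: "j = Suc J" using \<open>alive 0\<close> by (cases j) auto
    have aJ: "alive J" using J not_less_Least[of J "\<lambda>j. \<not> alive j"] unfolding j_def by auto
    have "P j = step_diamond \<epsilon> (P J)" using J by (simp add: P_def)
    then have "snd (step_diamond \<epsilon> (P J)) \<le> 0"
      using j step_diamond_fst_pos[of "P J" \<epsilon>] aJ eps e unfolding alive_def by auto
    then have d: "snd (P J) \<le> 4 * \<epsilon> * (fst (P J) + snd (P J))"
      using diamond_death aJ eps e unfolding alive_def by blast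
    show ?thesis
    proof (rule goal[of J "r + 4 * real (K - J)" "(step_diamond \<epsilon> ^^ J) (1, 1 - \<epsilon>)"])
      have "8 \<le> r + 4 * real (K - J)" using M J j by auto
      then show "0 < (r + 4 * real (K - J)) * \<epsilon> * (fst ((step_diamond \<epsilon> ^^ J) (1, 1 - \<epsilon>)) + snd ((step_diamond \<epsilon> ^^ J) (1, 1 - \<epsilon>))/2)^2
        - (snd ((step_diamond \<epsilon> ^^ J) (1, 1 - \<epsilon>)))^2/2
        - fst ((step_diamond \<epsilon> ^^ J) (1, 1 - \<epsilon>)) * snd ((step_diamond \<epsilon> ^^ J) (1, 1 - \<epsilon>))"
        using chain_end_positive[OF eps e(1), of J "r + 4 * real (K - J)"] aJ d e unfolding alive_def P_def by blast
    qed (use J j in auto)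
  qed
qed

section \<open>Chains of diamonds\<close>

lemma connected_graphI:
  assumes "simple_graph V E" "r \<in> V" "\<And>v. v \<in> V \<Longrightarrow> (r, v) \<in> E\<^sup>*"
  shows "connected_graph V E"
  unfolding connected_graph_def
proof (intro conjI allI impI)
  interpret simple_graph V E by fact
  show "V \<noteq> {}" using assms by auto
  fix S assume S: "S \<subseteq> V" "S \<noteq> {} \<and> E `` S \<subseteq> S"
  have closed: "b \<in> S" if "(a, b) \<in> E\<^sup>*" "a \<in> S" for a b
    using that(1)
  proof induction
    case (step b c)
    then show ?case using S by blast
  qed (rule that(2))
  obtain s where s: "s \<in> S" using S by blast
  have "(s, r) \<in> E\<^sup>*" using assms(3)[of s] s S sym_rtrancl[OF sym_E] by (auto dest: symD)
  then have "r \<in> S" using closed s by blast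
  then show "S = V" using closed assms(3) S by blast
qed

lemma connected_graph_rtrancl:
  assumes "connected_graph V E" "E \<subseteq> V \<times> V" "u \<in> V" "v \<in> V"
  shows "(u, v) \<in> E\<^sup>*"
proof -
  have "{w\<in>V. (u, w) \<in> E\<^sup>*} = V"
  proof (rule connected_graphD[OF assms(1)])
    fix a b assume "(a, b) \<in> E" "a \<in> {w\<in>V. (u, w) \<in> E\<^sup>*}"
    then show "b \<in> {w\<in>V. (u, w) \<in> E\<^sup>*}"
      using assms(2) by (auto intro: rtrancl.rtrancl_into_rtrancl)
  qed (use assms in auto)
  then show ?thesis using assms(4) by blast
qed

text \<open>The root carries the largest number, so that prepending a diamond keeps all numbers and
  makes \<open>N + 4\<close> the new root.\<close>

definition rooted :: "nat \<Rightarrow> nat rel \<Rightarrow> bool" where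
  "rooted N E \<longleftrightarrow> simple_graph {..N} E \<and> connected_graph {..N} E \<and>
     (\<forall>v<N. vdegree E v = 3) \<and> vdegree E N = 2"

definition rayleigh_gap :: "real \<Rightarrow> nat \<Rightarrow> nat rel \<Rightarrow> (nat \<Rightarrow> real) \<Rightarrow> real" where
  "rayleigh_gap \<epsilon> N E y = adj_form E y - (3 - \<epsilon>) * (\<Sum>v\<le>N. (y v)^2)"

text \<open>For a root of value \<open>a\<close> with outflow \<open>F\<close>, the eigenvalue equation asks for a further neighbour of value
  \<open>(1 - \<epsilon>) * a - F\<close>. Once the edge to it is included, the gap does not change when diamonds are prepended
  along exact states.\<close>

lemma rooted_plateau:
  assumes "rooted N E"
  shows "rayleigh_gap \<epsilon> N E ((\<lambda>_. m)(N := a)) + a * ((1 - \<epsilon>) * a - F)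
    = real N * \<epsilon> * m^2 - 2 * (m - a)^2 - a * F"
proof -
  interpret simple_graph "{..N}" E using assms by (simp add: rooted_def)
  have "card E = (\<Sum>v\<le>N. vdegree E v)" by (simp add: sum_vdegree)
  also have "{..N} = insert N {..<N}" by auto
  also have "(\<Sum>v\<in>insert N {..<N}. vdegree E v) = 3 * N + 2" using assms by (simp add: rooted_def)
  finally have f: "adj_form E (\<lambda>_. m) = (3 * real N + 2) * m^2"
    by (simp add: adj_form_def case_prod_unfold power2_eq_square)
  have nb: "(\<Sum>w\<in>E `` {N}. m) = 2 * m" using assms by (simp add: rooted_def vdegree_def)
  have sq: "(\<Sum>w\<le>N. m^2) = (real N + 1) * m^2" by simp
  have N: "N \<in> {..N}" by simp
  show ?thesis
    unfolding rayleigh_gap_def adj_form_update[OF N] f nb sq by (simp add: algebra_simps power2_eq_square)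
qed

definition prepend_diamond :: "nat \<Rightarrow> nat rel \<Rightarrow> nat rel" where
  "prepend_diamond N E = E \<union> edge (N+4) (N+1) \<union> edge (N+4) (N+2) \<union> edge (N+1) (N+2)
     \<union> edge (N+1) (N+3) \<union> edge (N+2) (N+3) \<union> edge (N+3) N"

lemma prepend_diamond:
  assumes "rooted N E"
  shows "rooted (N+4) (prepend_diamond N E)"
    and "adj_form (prepend_diamond N E) y = adj_form E y + 2 * y (N+4) * y (N+1) + 2 * y (N+4) * y (N+2)
      + 2 * y (N+1) * y (N+2) + 2 * y (N+1) * y (N+3) + 2 * y (N+2) * y (N+3) + 2 * y (N+3) * y N"
proof -
  interpret E: simple_graph "{..N}" E using assms by (simp add: rooted_def)
  interpret E0: simple_graph "{..N+4}" E
    using E.E_subset E.sym_E E.irrefl_E by unfold_locales auto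
  let ?E1 = "E \<union> edge (N+4) (N+1)"
  let ?E2 = "?E1 \<union> edge (N+4) (N+2)"
  let ?E3 = "?E2 \<union> edge (N+1) (N+2)"
  let ?E4 = "?E3 \<union> edge (N+1) (N+3)"
  let ?E5 = "?E4 \<union> edge (N+2) (N+3)"
  let ?E6 = "?E5 \<union> edge (N+3) N"
  interpret E1: simple_graph "{..N+4}" ?E1 by (rule E0.add_edge) auto
  interpret E2: simple_graph "{..N+4}" ?E2 by (rule E1.add_edge) auto
  interpret E3: simple_graph "{..N+4}" ?E3 by (rule E2.add_edge) auto
  interpret E4: simple_graph "{..N+4}" ?E4 by (rule E3.add_edge) auto
  interpret E5: simple_graph "{..N+4}" ?E5 by (rule E4.add_edge) auto
  interpret E6: simple_graph "{..N+4}" ?E6 by (rule E5.add_edge) auto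
  have notin: "(a, b) \<notin> E" if "N < a \<or> N < b" for a b
    using E.E_subset that by auto
  have P: "prepend_diamond N E = ?E6" by (simp add: prepend_diamond_def)
  have "adj_form ?E1 y = adj_form E y + 2 * y (N+4) * y (N+1)" by (rule E0.adj_form_add_edge) (auto simp: notin)
  moreover have "adj_form ?E2 y = adj_form ?E1 y + 2 * y (N+4) * y (N+2)" by (rule E1.adj_form_add_edge) (auto simp: notin)
  moreover have "adj_form ?E3 y = adj_form ?E2 y + 2 * y (N+1) * y (N+2)" by (rule E2.adj_form_add_edge) (auto simp: notin)
  moreover have "adj_form ?E4 y = adj_form ?E3 y + 2 * y (N+1) * y (N+3)" by (rule E3.adj_form_add_edge) (auto simp: notin)
  moreover have "adj_form ?E5 y = adj_form ?E4 y + 2 * y (N+2) * y (N+3)" by (rule E4.adj_form_add_edge) (auto simp: notin)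
  moreover have "adj_form ?E6 y = adj_form ?E5 y + 2 * y (N+3) * y N" by (rule E5.adj_form_add_edge) (auto simp: notin)
  ultimately show "adj_form (prepend_diamond N E) y = adj_form E y + 2 * y (N+4) * y (N+1) + 2 * y (N+4) * y (N+2)
      + 2 * y (N+1) * y (N+2) + 2 * y (N+1) * y (N+3) + 2 * y (N+2) * y (N+3) + 2 * y (N+3) * y N"
    unfolding P by simp
  have empty: "E `` {a} = {}" if "N < a" for a using notin that by auto
  have I: "?E6 `` {N+4} = {N+1, N+2}" "?E6 `` {N+3} = {N+1, N+2, N}" "?E6 `` {N+2} = {N+4, N+1, N+3}"
    "?E6 `` {N+1} = {N+4, N+2, N+3}" "?E6 `` {N} = insert (N+3) (E `` {N})"
    unfolding edge_Image by (auto simp: empty)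
  have I': "?E6 `` {v} = E `` {v}" if "v < N" for v
    unfolding edge_Image using that by auto
  have "vdegree ?E6 v = 3" if "v < N + 4" for v
  proof -
    have "v < N \<or> v = N \<or> v = N+1 \<or> v = N+2 \<or> v = N+3" using that by arith
    then consider "v < N" | "v = N" | "v = N+1" | "v = N+2" | "v = N+3" by blast
    then show ?thesis
    proof cases
      case 1
      show ?thesis unfolding vdegree_def I'[OF 1] using assms 1 by (simp add: rooted_def vdegree_def)
    next
      case 2
      have "N + 3 \<notin> E `` {N}" using notin by auto
      then show ?thesis unfolding vdegree_def 2 I
        using assms E.finite_nbrs by (simp add: rooted_def vdegree_def)
    qed (simp_all only: vdegree_def I, simp_all)
  qed
  moreover have "vdegree ?E6 (N+4) = 2" unfolding vdegree_def I by simp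
  moreover have "connected_graph {..N+4} ?E6"
  proof (rule connected_graphI[OF E6.simple_graph_axioms])
    show "N \<in> {..N+4}" by simp
    fix v assume "v \<in> {..N+4}"
    have st: "(N, N+3) \<in> ?E6" "(N+3, N+1) \<in> ?E6" "(N+3, N+2) \<in> ?E6" "(N+1, N+4) \<in> ?E6" by simp_all
    have 3: "(N, N+3) \<in> ?E6\<^sup>*" using st(1) by (rule r_into_rtrancl)
    have 1: "(N, N+1) \<in> ?E6\<^sup>*" using 3 st(2) by (rule rtrancl.rtrancl_into_rtrancl)
    have 2: "(N, N+2) \<in> ?E6\<^sup>*" using 3 st(3) by (rule rtrancl.rtrancl_into_rtrancl)
    have 4: "(N, N+4) \<in> ?E6\<^sup>*" using 1 st(4) by (rule rtrancl.rtrancl_into_rtrancl)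
    have 0: "(N, v) \<in> ?E6\<^sup>*" if "v \<le> N"
    proof -
      have "(N, v) \<in> E\<^sup>*"
        using assms that E.E_subset by (intro connected_graph_rtrancl[of "{..N}"]) (auto simp: rooted_def)
      moreover have "E\<^sup>* \<subseteq> ?E6\<^sup>*" by (intro rtrancl_mono) auto
      ultimately show ?thesis by blast
    qed
    have "v \<le> N \<or> v = N+1 \<or> v = N+2 \<or> v = N+3 \<or> v = N+4" using \<open>v \<in> _\<close> unfolding atMost_iff by arith
    then consider "v \<le> N" | "v = N+1" | "v = N+2" | "v = N+3" | "v = N+4" by blast
    then show "(N, v) \<in> ?E6\<^sup>*" using 0 1 2 3 4 by cases simp_all
  qed
  ultimately show "rooted (N+4) (prepend_diamond N E)"
    unfolding P rooted_def using E6.simple_graph_axioms by blast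
qed

text \<open>With \<open>s\<close> on the middle pair and \<open>t\<close> at the far end of the
  diamond, the exact steps are the eigenvalue equations at \<open>N+1\<close>, \<open>N+2\<close>
  and \<open>N+3\<close>. These vertices contribute nothing to the gap, and the boundary term moves
  from the old root to the new one.\<close>

lemma prepend_diamond_gap:
  assumes r: "rooted N E" and z: "z N = a" and st: "step_diamond \<epsilon> (a', F') = (a, F)"
  obtains y where "y (N+4) = a'"
    "rayleigh_gap \<epsilon> (N+4) (prepend_diamond N E) y + a' * ((1 - \<epsilon>) * a' - F')
      = rayleigh_gap \<epsilon> N E z + a * ((1 - \<epsilon>) * a - F)"
proof -
  interpret E: simple_graph "{..N}" E using r by (simp add: rooted_def)
  define s where "s = a' + F' / 2"
  define t where "t = s + (F' - 2 * \<epsilon> * s) / 2"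
  have a: "a = t + (F' - 2 * \<epsilon> * s - \<epsilon> * t)" and F: "F = F' - 2 * \<epsilon> * s - \<epsilon> * t - \<epsilon> * a"
  proof -
    have "step_diamond \<epsilon> (a', F') = step_bridge \<epsilon> (s, F' - 2 * \<epsilon> * s)"
      by (simp add: step_diamond_def s_def)
    then have 1: "a = (1 - \<epsilon>) * t + (F' - 2 * \<epsilon> * s)"
      and 2: "F = F' - 2 * \<epsilon> * s - \<epsilon> * t - \<epsilon> * ((1 - \<epsilon>) * t + (F' - 2 * \<epsilon> * s))"
      using st by (simp_all add: t_def)
    show "a = t + (F' - 2 * \<epsilon> * s - \<epsilon> * t)" unfolding 1 by (simp add: algebra_simps)
    show "F = F' - 2 * \<epsilon> * s - \<epsilon> * t - \<epsilon> * a" unfolding 2 1 by simp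
  qed
  define y where "y = z(N+4 := a', N+1 := s, N+2 := s, N+3 := t)"
  have y: "y (N+4) = a'" "y (N+1) = s" "y (N+2) = s" "y (N+3) = t" "y N = a"
    by (simp_all add: y_def z)
  have "adj_form E y = adj_form E z"
    by (rule E.adj_form_cong) (simp add: y_def)
  moreover have "(\<Sum>v\<le>N+4. (y v)^2) = (\<Sum>v\<le>N. (z v)^2) + s^2 + s^2 + t^2 + a'^2"
  proof -
    have "{..N+4} = insert (N+4) (insert (N+3) (insert (N+2) (insert (N+1) {..N})))"
      by (auto simp: le_Suc_eq numeral_eq_Suc)
    moreover have "(\<Sum>v\<le>N. (y v)^2) = (\<Sum>v\<le>N. (z v)^2)" by (intro sum.cong) (auto simp: y_def)
    ultimately show ?thesis using y by simp
  qed
  ultimately have "rayleigh_gap \<epsilon> (N+4) (prepend_diamond N E) y = rayleigh_gap \<epsilon> N E z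
      + 4 * a' * s + 2 * s^2 + 4 * s * t + 2 * t * a - (3 - \<epsilon>) * (2 * s^2 + t^2 + a'^2)"
    unfolding rayleigh_gap_def prepend_diamond(2)[OF r] y by (simp add: algebra_simps power2_eq_square)
  moreover have "4 * a' * s + 2 * s^2 + 4 * s * t + 2 * t * a - (3 - \<epsilon>) * (2 * s^2 + t^2 + a'^2)
      + a' * ((1 - \<epsilon>) * a' - F') = a * ((1 - \<epsilon>) * a - F)"
  proof -
    have F': "F' = 2 * (s - a')" by (simp add: s_def)
    have a': "a' = (3 - \<epsilon>) * s - s - t" unfolding t_def F' by (simp add: field_simps)
    have a2: "a = (3 - \<epsilon>) * t - 2 * s" unfolding a F' a' by (simp add: algebra_simps)
    have F2: "F = (1 - \<epsilon>) * a - t" unfolding F F' a' a2 by (simp add: algebra_simps)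
    show ?thesis unfolding F2 F' a2 unfolding a' by (simp add: algebra_simps power2_eq_square)
  qed
  ultimately show thesis using that[of y] y by simp
qed

text \<open>One graph serves all test vectors: \<open>j\<close> diamonds carry exact states, and
  everything behind is constant. The plateau value is a function \<open>m\<close> because it depends
  on the state \<open>(b, G)\<close> where the exact part stops.\<close>

lemma diamond_chain_graph:
  assumes "rooted N0 E0"
  shows "\<exists>E. rooted (N0 + 4 * K) E \<and> (\<forall>\<epsilon> a F m. \<forall>j\<le>K. \<exists>y. y (N0 + 4 * K) = a \<and>
    (let (b, G) = (step_diamond \<epsilon> ^^ j) (a, F)
     in rayleigh_gap \<epsilon> (N0 + 4 * K) E y + a * ((1 - \<epsilon>) * a - F)
       = (real N0 + 4 * real (K - j)) * \<epsilon> * (m b G)^2 - 2 * (m b G - b)^2 - b * G))"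
proof (induction K)
  case 0
  have "\<exists>y. y N0 = a \<and> rayleigh_gap \<epsilon> N0 E0 y + a * ((1 - \<epsilon>) * a - F)
     = real N0 * \<epsilon> * (m a F)^2 - 2 * (m a F - a)^2 - a * F" for \<epsilon> a F and m :: "real \<Rightarrow> real \<Rightarrow> real"
    using rooted_plateau[OF assms, of \<epsilon> "m a F" a F] by (intro exI[of _ "(\<lambda>_. m a F)(N0 := a)"]) simp
  then show ?case using assms by (intro exI[of _ E0]) simp
next
  case (Suc K)
  from Suc.IH obtain E where E: "rooted (N0 + 4 * K) E" and IH: "\<forall>\<epsilon> a F m. \<forall>j\<le>K. \<exists>y. y (N0 + 4 * K) = a \<and>
    (let (b, G) = (step_diamond \<epsilon> ^^ j) (a, F)
     in rayleigh_gap \<epsilon> (N0 + 4 * K) E y + a * ((1 - \<epsilon>) * a - F)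
       = (real N0 + 4 * real (K - j)) * \<epsilon> * (m b G)^2 - 2 * (m b G - b)^2 - b * G)" by (elim exE conjE)
  let ?N = "N0 + 4 * K"
  let ?E = "prepend_diamond ?N E"
  have r: "rooted (N0 + 4 * Suc K) ?E" using prepend_diamond(1)[OF E] by (simp add: algebra_simps)
  have "\<exists>y. y (N0 + 4 * Suc K) = a \<and> (let (b, G) = (step_diamond \<epsilon> ^^ j) (a, F)
     in rayleigh_gap \<epsilon> (N0 + 4 * Suc K) ?E y + a * ((1 - \<epsilon>) * a - F)
       = (real N0 + 4 * real (Suc K - j)) * \<epsilon> * (m b G)^2 - 2 * (m b G - b)^2 - b * G)"
    if "j \<le> Suc K" for \<epsilon> a F j and m :: "real \<Rightarrow> real \<Rightarrow> real"
  proof (cases j)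
    case 0
    then show ?thesis using rooted_plateau[OF r, of \<epsilon> "m a F" a F]
      by (intro exI[of _ "(\<lambda>_. m a F)(N0 + 4 * Suc K := a)"]) (simp add: algebra_simps)
  next
    case (Suc i)
    obtain a1 F1 where st: "step_diamond \<epsilon> (a, F) = (a1, F1)" by (cases "step_diamond \<epsilon> (a, F)")
    obtain b G where bG: "(step_diamond \<epsilon> ^^ i) (a1, F1) = (b, G)" by (cases "(step_diamond \<epsilon> ^^ i) (a1, F1)")
    have bG': "(step_diamond \<epsilon> ^^ j) (a, F) = (b, G)"
      unfolding Suc funpow_Suc_right using st bG by simp
    have iK: "i \<le> K" using Suc that by simp
    obtain z where z: "z ?N = a1" "rayleigh_gap \<epsilon> ?N E z + a1 * ((1 - \<epsilon>) * a1 - F1)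
       = (real N0 + 4 * real (K - i)) * \<epsilon> * (m b G)^2 - 2 * (m b G - b)^2 - b * G"
      using IH[rule_format, OF iK, of a1 \<epsilon> F1 m] unfolding bG Let_def prod.case by (elim exE conjE)
    obtain y where "y (?N + 4) = a" "rayleigh_gap \<epsilon> (?N + 4) ?E y + a * ((1 - \<epsilon>) * a - F)
      = rayleigh_gap \<epsilon> ?N E z + a1 * ((1 - \<epsilon>) * a1 - F1)"
      by (rule prepend_diamond_gap[of ?N E z a1 \<epsilon> a F F1, OF E z(1) st])
    then show ?thesis using z(2) unfolding bG' Let_def prod.case
      by (intro exI[of _ y]) (simp add: Suc ac_simps)
  qed
  then show ?case using r by blast
qed

text \<open>End pieces on 5 and 7 vertices cover both odd residues modulo 4. The test vector is
  constant on them away from the root, so only their size enters the gap.\<close>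

definition tail4 :: "nat rel" where
  "tail4 = edge 4 0 \<union> edge 4 1 \<union> edge 0 2 \<union> edge 0 3 \<union> edge 1 2 \<union> edge 1 3 \<union> edge 2 3"

definition tail6 :: "nat rel" where
  "tail6 = edge 6 0 \<union> edge 6 1 \<union> edge 0 1 \<union> edge 0 2 \<union> edge 1 3 \<union> edge 2 4 \<union> edge 2 5
     \<union> edge 3 4 \<union> edge 3 5 \<union> edge 4 5"

lemma edge_Image_single:
  "edge a b `` {v} = (if v = a then {b} else {}) \<union> (if v = b then {a} else {})"
  by (auto simp: edge_def)

lemma rooted_tail4: "rooted 4 tail4"
proof -
  have V: "{..4} = {0, 1, 2, 3, 4::nat}" by (auto simp: le_Suc_eq numeral_eq_Suc)
  have sg: "simple_graph {..4} tail4"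
    unfolding V by unfold_locales (auto simp: tail4_def edge_def sym_def irrefl_def)
  have I: "tail4 `` {4} = {0, 1}" "tail4 `` {0} = {4, 2, 3}" "tail4 `` {1} = {4, 2, 3}"
    "tail4 `` {2} = {0, 1, 3}" "tail4 `` {3} = {0, 1, 2}"
    unfolding tail4_def edge_Image edge_Image_single by auto
  have st: "(4, 0) \<in> tail4" "(4, 1) \<in> tail4" "(0, 2) \<in> tail4" "(0, 3) \<in> tail4"
    by (simp_all add: tail4_def)
  have "(4, v) \<in> tail4\<^sup>*" if "v \<in> {..4}" for v
    using that st unfolding V by (auto intro: rtrancl_trans[OF r_into_rtrancl r_into_rtrancl])
  then have "connected_graph {..4} tail4" by (intro connected_graphI[OF sg, of 4]) auto
  moreover have "vdegree tail4 v = 3" if "v < 4" for v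
  proof -
    have "v = 0 \<or> v = 1 \<or> v = 2 \<or> v = 3" using \<open>v < 4\<close> by arith
    then consider "v = 0" | "v = 1" | "v = 2" | "v = 3" by blast
    then show ?thesis by cases (simp_all only: vdegree_def I, simp_all)
  qed
  ultimately show ?thesis using sg by (simp add: rooted_def vdegree_def I)
qed

lemma rooted_tail6: "rooted 6 tail6"
proof -
  have V: "{..6} = {0, 1, 2, 3, 4, 5, 6::nat}" by (auto simp: le_Suc_eq numeral_eq_Suc)
  have sg: "simple_graph {..6} tail6"
    unfolding V by unfold_locales (auto simp: tail6_def edge_def sym_def irrefl_def)
  have I: "tail6 `` {6} = {0, 1}" "tail6 `` {0} = {6, 1, 2}" "tail6 `` {1} = {6, 0, 3}"
    "tail6 `` {2} = {0, 4, 5}" "tail6 `` {3} = {1, 4, 5}" "tail6 `` {4} = {2, 3, 5}" "tail6 `` {5} = {2, 3, 4}"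
    unfolding tail6_def edge_Image edge_Image_single by auto
  have st: "(6, 0) \<in> tail6" "(6, 1) \<in> tail6" "(0, 2) \<in> tail6" "(1, 3) \<in> tail6" "(2, 4) \<in> tail6" "(2, 5) \<in> tail6"
    by (simp_all add: tail6_def)
  have r: "(6, 0) \<in> tail6\<^sup>*" "(6, 1) \<in> tail6\<^sup>*" "(6, 2) \<in> tail6\<^sup>*" "(6, 3) \<in> tail6\<^sup>*" "(6, 4) \<in> tail6\<^sup>*" "(6, 5) \<in> tail6\<^sup>*"
  proof -
    show 0: "(6, 0) \<in> tail6\<^sup>*" and 1: "(6, 1) \<in> tail6\<^sup>*" using st by auto
    show 2: "(6, 2) \<in> tail6\<^sup>*" using 0 st(3) by (rule rtrancl.rtrancl_into_rtrancl)
    show "(6, 3) \<in> tail6\<^sup>*" using 1 st(4) by (rule rtrancl.rtrancl_into_rtrancl)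
    show "(6, 4) \<in> tail6\<^sup>*" using 2 st(5) by (rule rtrancl.rtrancl_into_rtrancl)
    show "(6, 5) \<in> tail6\<^sup>*" using 2 st(6) by (rule rtrancl.rtrancl_into_rtrancl)
  qed
  have "(6, v) \<in> tail6\<^sup>*" if "v \<in> {..6}" for v
    using that r unfolding V by auto
  then have "connected_graph {..6} tail6" by (intro connected_graphI[OF sg, of 6]) auto
  moreover have "vdegree tail6 v = 3" if "v < 6" for v
  proof -
    have "v = 0 \<or> v = 1 \<or> v = 2 \<or> v = 3 \<or> v = 4 \<or> v = 5" using \<open>v < 6\<close> by arith
    then consider "v = 0" | "v = 1" | "v = 2" | "v = 3" | "v = 4" | "v = 5" by blast
    then show ?thesis by cases (simp_all only: vdegree_def I, simp_all)
  qed
  ultimately show ?thesis using sg by (simp add: rooted_def vdegree_def I)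
qed

context extremal_cubic
begin

text \<open>Optimality refers to graphs on \<open>V\<close>; a rooted graph of the same size becomes
  a competitor after renaming its vertices along a bijection.\<close>

lemma rooted_gap_nonpos:
  assumes r: "rooted N E'" and card: "card V = N + 1" and N: "0 < N"
  shows "rayleigh_gap (3 - \<mu>) N E' y \<le> 0"
proof -
  interpret E': simple_graph "{..N}" E' using r by (simp add: rooted_def)
  obtain h where h: "bij_betw h {..N} V"
    using finite_same_card_bij[of "{..N}" V] finite_V card by auto
  then have inj: "inj_on h {..N}" and img: "h ` {..N} = V" by (auto simp: bij_betw_def)
  let ?H = "map_prod h h ` E'"
  have inj2: "inj_on (map_prod h h) E'"
  proof (rule inj_onI)
    fix e e' assume "e \<in> E'" "e' \<in> E'" and eq: "map_prod h h e = map_prod h h e'"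
    then have "fst e \<in> {..N}" "snd e \<in> {..N}" "fst e' \<in> {..N}" "snd e' \<in> {..N}"
      using E'.E_subset by auto
    moreover have "h (fst e) = h (fst e')" "h (snd e) = h (snd e')"
      using eq by (cases e; cases e'; simp)+
    ultimately show "e = e'" using inj by (simp add: inj_on_eq_iff prod_eq_iff)
  qed
  have I: "?H `` {h v} = h ` (E' `` {v})" if "v \<le> N" for v
    using inj that E'.E_subset by (fastforce simp: inj_on_def)
  have deg: "vdegree ?H (h v) = vdegree E' v" if "v \<le> N" for v
    unfolding vdegree_def I[OF that] using inj E'.nbrs_subset by (intro card_image inj_on_subset[OF inj])
  have "competitor V ?H"
    unfolding competitor_def
  proof (intro conjI)
    show "simple_graph V ?H"
    proof
      show "?H \<subseteq> V \<times> V" using E'.E_subset img by auto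
      show "sym ?H"
      proof (rule symI)
        fix a b assume "(a, b) \<in> ?H"
        then obtain c d where cd: "(c, d) \<in> E'" "a = h c" "b = h d" by auto
        have "map_prod h h (d, c) \<in> ?H" using symD[OF E'.sym_E cd(1)] by (rule imageI)
        then show "(b, a) \<in> ?H" using cd by simp
      qed
      show "irrefl ?H"
      proof (rule irreflI)
        fix a show "(a, a) \<notin> ?H"
        proof
          assume "(a, a) \<in> ?H"
          then obtain c d where cd: "(c, d) \<in> E'" "a = h c" "a = h d" by auto
          then have "c = d" using inj E'.edge_in_V[OF cd(1)] by (auto simp: inj_on_def)
          then show False using cd by simp
        qed
      qed
    qed (rule finite_V)
    then interpret H: simple_graph V ?H .
    show "connected_graph V ?H"
    proof (rule connected_graphI[OF H.simple_graph_axioms])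
      show "h N \<in> V" using img by auto
      fix v assume "v \<in> V"
      then obtain k where k: "v = h k" "k \<le> N" using img by auto
      have "(N, k) \<in> E'\<^sup>*"
        using r k E'.E_subset by (intro connected_graph_rtrancl[of "{..N}"]) (auto simp: rooted_def)
      then have "(h N, h k) \<in> ?H\<^sup>*"
      proof induction
        case (step a b)
        have "(h a, h b) \<in> ?H" using step(2) by (auto intro: rev_image_eqI)
        with step(3) show ?case by (rule rtrancl.rtrancl_into_rtrancl)
      qed simp
      then show "(h N, v) \<in> ?H\<^sup>*" using k by simp
    qed
    show "\<forall>v\<in>V. vdegree ?H v \<le> 3"
    proof
      fix v assume "v \<in> V"
      then obtain k where k: "v = h k" "k \<le> N" using img by auto
      then show "vdegree ?H v \<le> 3" using deg[of k] r by (cases "k = N") (auto simp: rooted_def)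
    qed
    show "\<exists>v\<in>V. vdegree ?H v = 3" using deg[of 0] r img N by (intro bexI[of _ "h 0"]) (auto simp: rooted_def)
    show "\<exists>v\<in>V. vdegree ?H v < 3" using deg[of N] r img by (intro bexI[of _ "h N"]) (auto simp: rooted_def)
  qed
  then have "adj_form ?H (y \<circ> the_inv_into {..N} h) \<le> \<mu> * (\<Sum>v\<in>V. ((y \<circ> the_inv_into {..N} h) v)^2)"
    by (rule opt)
  moreover have "(\<Sum>v\<in>V. ((y \<circ> the_inv_into {..N} h) v)^2) = (\<Sum>k\<le>N. (y k)^2)"
    unfolding img[symmetric] using inj by (subst sum.reindex) (auto simp: the_inv_into_f_f intro!: sum.cong)
  moreover have "adj_form ?H (y \<circ> the_inv_into {..N} h) = adj_form E' y"
  proof -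
    have "adj_form ?H (y \<circ> the_inv_into {..N} h)
      = (\<Sum>e\<in>E'. y (the_inv_into {..N} h (h (fst e))) * y (the_inv_into {..N} h (h (snd e))))"
      unfolding adj_form_def by (subst sum.reindex[OF inj2]) (auto simp: case_prod_unfold intro!: sum.cong)
    also have "\<dots> = adj_form E' y"
      unfolding adj_form_def case_prod_unfold
    proof (rule sum.cong[OF refl])
      fix e assume "e \<in> E'"
      then have "fst e \<in> {..N}" "snd e \<in> {..N}" using E'.E_subset by auto
      then show "y (the_inv_into {..N} h (h (fst e))) * y (the_inv_into {..N} h (h (snd e))) = y (fst e) * y (snd e)"
        using inj by (simp add: the_inv_into_f_f)
    qed
    finally show ?thesis .
  qed
  ultimately show ?thesis by (simp add: rayleigh_gap_def)
qed

end

section \<open>Adjacent vertices of degrees 2 and 1\<close>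

text \<open>Numbering by increasing value makes \<open>{..<k}\<close> the \<open>k\<close> vertices
  of smallest potential, so all edges of a cut carry flow in the same direction.\<close>

locale sorted_cubic = simple_graph "{..<n}" R for n :: nat and R :: "nat rel" +
  fixes X :: "nat \<Rightarrow> real" and \<epsilon> :: real
  assumes conn: "connected_graph {..<n} R"
    and n: "7 \<le> n" "odd n"
    and mono: "\<And>i j. i \<le> j \<Longrightarrow> j < n \<Longrightarrow> X i \<le> X j"
    and pos: "\<And>i. i < n \<Longrightarrow> 0 < X i"
    and eigen: "\<And>i. i < n \<Longrightarrow> (\<Sum>j\<in>R `` {i}. X j) = (3 - \<epsilon>) * X i"
    and eps: "0 < \<epsilon>"
    and R0: "R `` {0} = {1}" and R1: "R `` {1} = {0, 2}"
    and deg3: "\<And>i. 2 \<le> i \<Longrightarrow> i < n \<Longrightarrow> vdegree R i = 3"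
begin

section \<open>Flow and parity of cuts\<close>

definition level_cut :: "nat \<Rightarrow> nat rel" where
  "level_cut k = {(a, b)\<in>R. a < k \<and> k \<le> b}"

definition flow :: "nat \<Rightarrow> real" where
  "flow k = (\<Sum>(a, b)\<in>level_cut k. X b - X a)"

lemma lt_n: "(a, b) \<in> R \<Longrightarrow> a < n" "(a, b) \<in> R \<Longrightarrow> b < n"
  by (auto dest: edge_in_V)

lemma R_sym: "(a, b) \<in> R \<Longrightarrow> (b, a) \<in> R"
  by (rule symD[OF sym_E])

lemma finite_cut: "finite (level_cut k)"
  by (rule finite_subset[OF _ finite_E]) (auto simp: level_cut_def)

lemma cut_term_nonneg: "(a, b) \<in> level_cut k \<Longrightarrow> 0 \<le> X b - X a"
  using mono[of a b] lt_n[of a b] by (auto simp: level_cut_def)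

lemma level_cut_bounds:
  assumes "(a, b) \<in> level_cut k"
  shows "X a \<le> X (k - 1)" "X k \<le> X b"
proof -
  have ab: "a < k" "k \<le> b" "b < n" using assms lt_n[of a b] by (auto simp: level_cut_def)
  then show "X k \<le> X b" by (intro mono)
  have "a \<le> k - 1" "k - 1 < n" using ab by auto
  then show "X a \<le> X (k - 1)" by (rule mono)
qed

lemma flow_ge:
  assumes "S \<subseteq> level_cut k"
  shows "(\<Sum>(a, b)\<in>S. X b - X a) \<le> flow k"
  unfolding flow_def using assms finite_cut cut_term_nonneg by (intro sum_mono2) auto

text \<open>A vertex \<open>i \<ge> 2\<close> has degree 3 and eigenvalue
  \<open>3 - \<epsilon>\<close>, so it takes up the net flow \<open>\<epsilon> * X i\<close>.
  Summing over all vertices from \<open>k\<close> on, inner edges cancel by antisymmetry and the cut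
  remains.\<close>

lemma flow_eq:
  assumes k: "2 \<le> k" "k \<le> n"
  shows "flow k = \<epsilon> * (\<Sum>i\<in>{k..<n}. X i)"
proof -
  let ?U = "{k..<n}"
  have fin: "finite (R \<inter> A)" for A using finite_E by simp
  have "\<epsilon> * (\<Sum>i\<in>?U. X i) = (\<Sum>i\<in>?U. \<Sum>j\<in>R `` {i}. X i - X j)"
    unfolding sum_distrib_left
  proof (rule sum.cong[OF refl])
    fix i assume "i \<in> ?U"
    then have i: "2 \<le> i" "i < n" using k by auto
    show "\<epsilon> * X i = (\<Sum>j\<in>R `` {i}. X i - X j)"
      using eigen[OF i(2)] deg3[OF i] by (simp add: sum_subtractf vdegree_def algebra_simps)
  qed
  also have "\<dots> = (\<Sum>(i, j)\<in>(SIGMA i:?U. R `` {i}). X i - X j)"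
    using finite_nbrs by (simp add: sum.Sigma)
  also have "(SIGMA i:?U. R `` {i}) = (R \<inter> ?U \<times> ?U) \<union> (level_cut k)\<inverse>"
    using lt_n R_sym by (auto simp: level_cut_def not_le)
  also have "(\<Sum>(i, j)\<in>(R \<inter> ?U \<times> ?U) \<union> (level_cut k)\<inverse>. X i - X j)
      = (\<Sum>(i, j)\<in>R \<inter> ?U \<times> ?U. X i - X j) + (\<Sum>(i, j)\<in>(level_cut k)\<inverse>. X i - X j)"
    using fin finite_cut by (intro sum.union_disjoint) (auto simp: level_cut_def)
  also have "(\<Sum>(i, j)\<in>R \<inter> ?U \<times> ?U. X i - X j) = 0"
  proof -
    have "(\<Sum>(i, j)\<in>R \<inter> ?U \<times> ?U. X i) = (\<Sum>(i, j)\<in>R \<inter> ?U \<times> ?U. X j)"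
      by (rule sum.reindex_bij_witness[of _ prod.swap prod.swap]) (auto intro: R_sym)
    then show ?thesis by (simp add: sum_subtractf case_prod_unfold)
  qed
  also have "(\<Sum>(i, j)\<in>(level_cut k)\<inverse>. X i - X j) = flow k"
    unfolding flow_def by (rule sum.reindex_bij_witness[of _ prod.swap prod.swap]) auto
  finally show ?thesis by simp
qed

lemma flow_step:
  assumes "2 \<le> k" "k < n"
  shows "flow (Suc k) = flow k - \<epsilon> * X k"
proof -
  have "(\<Sum>i\<in>{k..<n}. X i) = X k + (\<Sum>i\<in>{Suc k..<n}. X i)"
    using assms by (simp add: sum.atLeast_Suc_lessThan)
  then show ?thesis using assms by (simp add: flow_eq algebra_simps)
qed

lemma flow_pos:
  assumes "2 \<le> k" "k < n"
  shows "0 < flow k"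
proof -
  have "0 < (\<Sum>i\<in>{k..<n}. X i)" using assms pos by (intro sum_pos) auto
  then show ?thesis using assms eps by (simp add: flow_eq)
qed

lemma cut_nonempty:
  assumes "0 < k" "k < n"
  shows "level_cut k \<noteq> {}"
proof
  assume e: "level_cut k = {}"
  have "{..<k} = {..<n}"
  proof (rule connected_graphD[OF conn])
    fix a b assume ab: "(a, b) \<in> R" "a \<in> {..<k}"
    have "(a, b) \<notin> level_cut k" using e by blast
    then show "b \<in> {..<k}" using ab by (auto simp: level_cut_def)
  qed (use assms in auto)
  then show False using assms by auto
qed

lemma card_cut_pos: "0 < k \<Longrightarrow> k < n \<Longrightarrow> 0 < card (level_cut k)"
  using cut_nonempty finite_cut by (simp add: card_gt_0_iff)

text \<open>The first \<open>k\<close> degrees sum to \<open>3 * (k - 2) + 3\<close>, and edges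
  inside the segment count twice.\<close>

lemma cut_parity:
  assumes "2 \<le> k" "k \<le> n"
  shows "even (card (level_cut k)) \<longleftrightarrow> odd k"
proof -
  have "(\<Sum>i<k. vdegree R i) = 3 * (k - 2) + 3"
  proof -
    have "{..<k} = insert 0 (insert 1 {2..<k})" using assms by auto
    then have "(\<Sum>i<k. vdegree R i) = vdegree R 0 + vdegree R 1 + (\<Sum>i\<in>{2..<k}. vdegree R i)" by simp
    also have "(\<Sum>i\<in>{2..<k}. vdegree R i) = 3 * (k - 2)" using deg3 assms by simp
    also have "vdegree R 0 + vdegree R 1 = 3" unfolding vdegree_def R0 R1 by simp
    finally show ?thesis by simp
  qed
  moreover have "(\<Sum>i<k. vdegree R i) = card (R \<inter> {..<k} \<times> {..<k}) + card (level_cut k)"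
  proof -
    have "(\<Sum>i<k. vdegree R i) = card (SIGMA i:{..<k}. R `` {i})"
      using finite_nbrs by (simp add: vdegree_def)
    also have "(SIGMA i:{..<k}. R `` {i}) = (R \<inter> {..<k} \<times> {..<k}) \<union> level_cut k"
      by (auto simp: level_cut_def)
    also have "card \<dots> = card (R \<inter> {..<k} \<times> {..<k}) + card (level_cut k)"
      using finite_E finite_cut by (intro card_Un_disjoint) (auto simp: level_cut_def)
    finally show ?thesis .
  qed
  moreover have "even (card (R \<inter> {..<k} \<times> {..<k}))"
    by (rule even_card_sym[OF _ sym_E irrefl_E]) simp
  ultimately have "even (card (level_cut k)) \<longleftrightarrow> even (3 * (k - 2) + 3)" by (metis even_add)
  then show ?thesis using assms by auto
qed

lemma cut_ge_2: "odd k \<Longrightarrow> 2 \<le> k \<Longrightarrow> k < n \<Longrightarrow> 2 \<le> card (level_cut k)"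
  using cut_parity[of k] card_cut_pos[of k] by (cases "card (level_cut k) = 1") auto

lemma cut_ge_3: "even k \<Longrightarrow> 2 \<le> k \<Longrightarrow> k < n \<Longrightarrow> card (level_cut k) \<noteq> 1 \<Longrightarrow> 3 \<le> card (level_cut k)"
  using cut_parity[of k] card_cut_pos[of k] by (cases "card (level_cut k) = 2") auto

lemma cut_2: "level_cut 2 = {(1, 2)}"
proof -
  have 0: "(0, b) \<in> R \<longleftrightarrow> b = 1" for b using R0 by blast
  have 1: "(1, b) \<in> R \<longleftrightarrow> b = 0 \<or> b = 2" for b using R1 by blast
  show ?thesis
  proof (intro equalityI subsetI)
    fix e assume "e \<in> level_cut 2"
    then obtain a b where e: "e = (a, b)" "(a, b) \<in> R" "a < 2" "2 \<le> b" by (auto simp: level_cut_def)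
    then have "a = 0 \<or> a = 1" by auto
    then show "e \<in> {(1, 2)}" using e 0 1 by auto
  qed (use 1 in \<open>auto simp: level_cut_def\<close>)
qed

text \<open>The vertices \<open>k - 1\<close> and \<open>k\<close> have six outgoing arcs. The two
  bridges account for two of them and, in a simple graph, the edge between the vertices for at most
  two more.\<close>

lemma no_adjacent_bridges:
  assumes k: "3 \<le> k" "Suc k < n" and b: "card (level_cut (k - 1)) = 1" "card (level_cut (Suc k)) = 1"
  shows False
proof -
  let ?P = "(SIGMA i:{k - 1, k}. R `` {i})"
  have "card ?P = vdegree R (k - 1) + vdegree R k" using finite_nbrs k by (simp add: vdegree_def)
  also have "\<dots> = 6" using deg3[of "k - 1"] deg3[of k] k by simp
  finally have six: "card ?P = 6" .
  have "?P \<subseteq> (level_cut (k - 1))\<inverse> \<union> level_cut (Suc k) \<union> {(k - 1, k), (k, k - 1)}"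
  proof
    fix e assume "e \<in> ?P"
    then obtain i j where e: "e = (i, j)" "i = k - 1 \<or> i = k" "(i, j) \<in> R" by auto
    then have "j \<noteq> i" by auto
    have "j < k - 1 \<or> j = k - 1 \<or> j = k \<or> Suc k \<le> j" using k by arith
    then show "e \<in> (level_cut (k - 1))\<inverse> \<union> level_cut (Suc k) \<union> {(k - 1, k), (k, k - 1)}"
      using e R_sym[OF e(3)] \<open>j \<noteq> i\<close> by (auto simp: level_cut_def)
  qed
  then have "6 \<le> card ((level_cut (k - 1))\<inverse> \<union> level_cut (Suc k) \<union> {(k - 1, k), (k, k - 1)})"
    unfolding six[symmetric] using finite_cut by (intro card_mono) auto
  also have "\<dots> \<le> card ((level_cut (k - 1))\<inverse> \<union> level_cut (Suc k)) + card {(k - 1, k), (k, k - 1)}" by (rule card_Un_le)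
  also have "card ((level_cut (k - 1))\<inverse> \<union> level_cut (Suc k)) \<le> card ((level_cut (k - 1))\<inverse>) + card (level_cut (Suc k))" by (rule card_Un_le)
  also have "card ((level_cut (k - 1))\<inverse>) = 1" using b by simp
  also have "card {(k - 1, k), (k, k - 1)} \<le> 2" by (simp add: card_insert_if)
  finally show False using b by simp
qed

text \<open>Otherwise all edges of the cut \<open>k - 1\<close> end in the vertex
  \<open>k - 1\<close> and exhaust its degree. The edges of the cut \<open>k\<close> would have to
  start there as well, so this cut would be empty.\<close>

lemma long_edge_left:
  assumes k: "3 \<le> k" "k < n" and c: "3 \<le> card (level_cut (k - 1))"
  shows "\<exists>a b. (a, b) \<in> level_cut k \<and> a < k - 1"
proof (rule ccontr)
  assume no: "\<not> ?thesis"
  have "level_cut (k - 1) \<subseteq> (\<lambda>a. (a, k - 1)) ` {a \<in> R `` {k - 1}. a < k - 1}"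
  proof
    fix e assume "e \<in> level_cut (k - 1)"
    then obtain a b where e: "e = (a, b)" "(a, b) \<in> R" "a < k - 1" "k - 1 \<le> b" by (auto simp: level_cut_def)
    have "\<not> k \<le> b"
    proof
      assume "k \<le> b"
      then have "(a, b) \<in> level_cut k" using e by (simp add: level_cut_def)
      then show False using no e(3) by blast
    qed
    then have "b = k - 1" using e by simp
    then show "e \<in> (\<lambda>a. (a, k - 1)) ` {a \<in> R `` {k - 1}. a < k - 1}" using e R_sym[OF e(2)] by auto
  qed
  then have "3 \<le> card {a \<in> R `` {k - 1}. a < k - 1}"
    using c surj_card_le[of "{a \<in> R `` {k - 1}. a < k - 1}" "level_cut (k - 1)" "\<lambda>a. (a, k - 1)"] finite_nbrs[of "k - 1"]
    by (metis (no_types, lifting) finite_subset mem_Collect_eq order_trans subsetI)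
  moreover have "card (R `` {k - 1}) = 3" using deg3[of "k - 1"] k by (simp add: vdegree_def)
  ultimately have "{a \<in> R `` {k - 1}. a < k - 1} = R `` {k - 1}"
    using finite_nbrs by (intro card_seteq) auto
  then have below: "a < k - 1" if "(k - 1, a) \<in> R" for a using that by blast
  obtain a b where ab: "(a, b) \<in> level_cut k" using cut_nonempty[of k] k by fastforce
  then have "\<not> a < k - 1" using no by blast
  then have "a = k - 1" using ab by (auto simp: level_cut_def)
  then show False using below[of b] ab by (auto simp: level_cut_def)
qed

lemma long_edge_right:
  assumes k: "2 \<le> k" "Suc k < n" and c: "3 \<le> card (level_cut (Suc k))"
  shows "\<exists>a b. (a, b) \<in> level_cut k \<and> k < b"
proof (rule ccontr)
  assume no: "\<not> ?thesis"
  have "level_cut (Suc k) \<subseteq> Pair k ` {b \<in> R `` {k}. k < b}"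
  proof
    fix e assume "e \<in> level_cut (Suc k)"
    then obtain a b where e: "e = (a, b)" "(a, b) \<in> R" "a < Suc k" "Suc k \<le> b" by (auto simp: level_cut_def)
    have "\<not> a < k"
    proof
      assume "a < k"
      then have "(a, b) \<in> level_cut k" using e by (simp add: level_cut_def)
      then show False using no e(4) by (auto simp: Suc_le_eq)
    qed
    then have "a = k" using e by simp
    then show "e \<in> Pair k ` {b \<in> R `` {k}. k < b}" using e by auto
  qed
  then have "3 \<le> card {b \<in> R `` {k}. k < b}"
    using c surj_card_le[of "{b \<in> R `` {k}. k < b}" "level_cut (Suc k)" "Pair k"] finite_nbrs[of k]
    by (metis (no_types, lifting) finite_subset mem_Collect_eq order_trans subsetI)
  moreover have "card (R `` {k}) = 3" using deg3[of k] k by (simp add: vdegree_def)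
  ultimately have "{b \<in> R `` {k}. k < b} = R `` {k}"
    using finite_nbrs by (intro card_seteq) auto
  then have above: "k < b" if "(k, b) \<in> R" for b using that by blast
  obtain a b where ab: "(a, b) \<in> level_cut k" using cut_nonempty[of k] k by fastforce
  then have "\<not> k < b" using no by blast
  then have "b = k" using ab by (auto simp: level_cut_def)
  then show False using above[of a] R_sym[of a b] ab by (auto simp: level_cut_def)
qed

text \<open>The pair of vertices \<open>k, k + 1\<close>, with \<open>k\<close> odd, is separated by the even cut \<open>k + 1\<close>. If that cut
  is a single bridge both values count; otherwise the pair acts like one vertex with the mean value.\<close>

definition upper :: "nat \<Rightarrow> real" where
  "upper k = (if card (level_cut (k - 1)) = 1 then X (k - 1) else (X (k - 2) + X (k - 1)) / 2)"

definition lower :: "nat \<Rightarrow> real" where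
  "lower k = (if card (level_cut (Suc k)) = 1 then X k else (X k + X (Suc k)) / 2)"

text \<open>Cut \<open>k\<close> has two edges, each spanning the gap from \<open>X (k - 1)\<close>
  to \<open>X k\<close>. Next to an even cut that is no bridge, some edge reaches at least one
  vertex further, which pays for the mean value in \<open>upper\<close> or \<open>lower\<close>. If
  the same edge is long on both sides, any second edge pays for the second gap.\<close>

lemma flow_ge_gap:
  assumes k: "odd k" "3 \<le> k" "Suc k < n"
  shows "2 * (lower k - upper k) \<le> flow k"
proof -
  define g where "g = X k - X (k - 1)"
  define dl where "dl = 2 * (X (k - 1) - upper k)"
  define dr where "dr = 2 * (lower k - X k)"
  have gap_le: "g \<le> X b - X a" if "(a, b) \<in> level_cut k" for a b
    using level_cut_bounds[OF that] by (simp add: g_def)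
  obtain a1 b1 where 1: "(a1, b1) \<in> level_cut k" "dl \<le> X (k - 1) - X a1"
  proof (cases "card (level_cut (k - 1)) = 1")
    case True
    obtain a b where "(a, b) \<in> level_cut k" using cut_nonempty[of k] k by fastforce
    then show thesis using True that[of a b] level_cut_bounds[of a b k] by (simp add: dl_def upper_def)
  next
    case False
    have "3 \<le> card (level_cut (k - 1))" using k False by (intro cut_ge_3) auto
    then obtain a b where ab: "(a, b) \<in> level_cut k" "a < k - 1" using long_edge_left[of k] k by auto
    have "dl = X (k - 1) - X (k - 2)" using False by (simp add: dl_def upper_def field_simps)
    moreover have "X a \<le> X (k - 2)" using ab k by (intro mono) auto
    ultimately show thesis using that[of a b] ab by simp
  qed
  obtain a2 b2 where 2: "(a2, b2) \<in> level_cut k" "dr \<le> X b2 - X k"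
  proof (cases "card (level_cut (Suc k)) = 1")
    case True
    obtain a b where "(a, b) \<in> level_cut k" using cut_nonempty[of k] k by fastforce
    then show thesis using True that[of a b] level_cut_bounds[of a b k] by (simp add: dr_def lower_def)
  next
    case False
    have "3 \<le> card (level_cut (Suc k))" using k False by (intro cut_ge_3) auto
    then obtain a b where ab: "(a, b) \<in> level_cut k" "k < b" using long_edge_right[of k] k by auto
    have "dr = X (Suc k) - X k" using False by (simp add: dr_def lower_def field_simps)
    moreover have "X (Suc k) \<le> X b" using ab lt_n[of a b] by (intro mono) (auto simp: level_cut_def)
    ultimately show thesis using that[of a b] ab by simp
  qed
  have goal: "2 * (lower k - upper k) = 2 * g + dl + dr" by (simp add: g_def dl_def dr_def)
  have le1: "X a1 \<le> X (k - 1)" and le2: "X k \<le> X b2" and le1': "X k \<le> X b1" and le2': "X a2 \<le> X (k - 1)"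
    using level_cut_bounds[OF 1(1)] level_cut_bounds[OF 2(1)] by auto
  show ?thesis
  proof (cases "(a1, b1) = (a2, b2)")
    case False
    have "(\<Sum>(a, b)\<in>{(a1, b1), (a2, b2)}. X b - X a) \<le> flow k" using 1 2 by (intro flow_ge) auto
    then have "(X b1 - X a1) + (X b2 - X a2) \<le> flow k" using False by simp
    then show ?thesis unfolding goal using 1(2) 2(2) le1' le2' by (simp add: g_def)
  next
    case True
    have "\<not> level_cut k \<subseteq> {(a1, b1)}"
    proof
      assume "level_cut k \<subseteq> {(a1, b1)}"
      then have "card (level_cut k) \<le> 1" using card_mono[of "{(a1, b1)}" "level_cut k"] by simp
      then show False using cut_ge_2[of k] k by simp
    qed
    then obtain a3 b3 where 3: "(a3, b3) \<in> level_cut k" "(a3, b3) \<noteq> (a1, b1)" by fastforce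
    have "(\<Sum>(a, b)\<in>{(a1, b1), (a3, b3)}. X b - X a) \<le> flow k" using 1 3 by (intro flow_ge) auto
    then have "(X b1 - X a1) + (X b3 - X a3) \<le> flow k" using 3(2)[THEN not_sym] by simp
    then show ?thesis unfolding goal using 1(2) 2(2) True gap_le[OF 3(1)] by (simp add: g_def)
  qed
qed

text \<open>Only odd cuts are recorded. Behind the vertices 0, 1, 2 the rest is read in pairs
  \<open>2 * i + 3\<close>, \<open>2 * i + 4\<close>, and \<open>bridge i\<close> tells whether the
  cut inside a pair is a bridge.\<close>

definition state :: "nat \<Rightarrow> real \<times> real" where
  "state i = (upper (2 * i + 3), flow (2 * i + 3))"

definition bridge :: "nat \<Rightarrow> bool" where
  "bridge i \<longleftrightarrow> card (level_cut (2 * i + 4)) = 1"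

lemma state_pos:
  assumes "2 * i + 3 < n"
  shows "0 < fst (state i) \<and> 0 < snd (state i)"
  using flow_pos[of "2 * i + 3"] assms pos[of "2 * i + 2"] pos[of "2 * i + 1"]
  by (auto simp: state_def upper_def numeral_eq_Suc intro!: add_pos_pos)

lemma state_move:
  assumes i: "2 * i + 5 < n"
  shows "if bridge i then bridge_move \<epsilon> (state i) (state (Suc i)) else pair_move \<epsilon> (state i) (state (Suc i))"
proof -
  define k where "k = 2 * i + 3"
  have k: "odd k" "3 \<le> k" "Suc k < n" "Suc (Suc k) < n" using i by (auto simp: k_def)
  have ev: "bridge i \<longleftrightarrow> card (level_cut (Suc k)) = 1" by (simp add: bridge_def k_def numeral_eq_Suc)
  have st: "state i = (upper k, flow k)" by (simp add: state_def k_def)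
  have st': "state (Suc i) = (upper (Suc (Suc k)), flow (Suc (Suc k)))"
    by (simp add: state_def k_def numeral_eq_Suc)
  have f1: "flow (Suc k) = flow k - \<epsilon> * X k" and f2: "flow (Suc (Suc k)) = flow (Suc k) - \<epsilon> * X (Suc k)"
    using flow_step[of k] flow_step[of "Suc k"] k by auto
  have gap: "lower k \<le> upper k + flow k / 2" using flow_ge_gap[OF k(1-3)] by simp
  show ?thesis
  proof (cases "bridge i")
    case True
    then have c: "card (level_cut (Suc k)) = 1" by (simp add: ev)
    have u: "upper (Suc (Suc k)) = X (Suc k)" and l: "lower k = X k" using c by (simp_all add: upper_def lower_def)
    obtain a b where ab: "(a, b) \<in> level_cut (Suc k)" using cut_nonempty[of "Suc k"] k by fastforce
    have "(\<Sum>(a, b)\<in>{(a, b)}. X b - X a) \<le> flow (Suc k)" using ab by (intro flow_ge) auto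
    moreover have "X a \<le> X k" "X (Suc k) \<le> X b"
      using level_cut_bounds[OF ab] by auto
    ultimately have "X (Suc k) - X k \<le> flow (Suc k)" by simp
    then have "bridge_move \<epsilon> (state i) (state (Suc i))"
      unfolding bridge_move_def st st' u using f1 f2 gap l pos[of k] k by (intro exI[of _ "X k"]) auto
    then show ?thesis using True by simp
  next
    case False
    then have c: "card (level_cut (Suc k)) \<noteq> 1" by (simp add: ev)
    have u: "upper (Suc (Suc k)) = (X k + X (Suc k)) / 2" and l: "lower k = (X k + X (Suc k)) / 2"
      using c by (simp_all add: upper_def lower_def)
    have "pair_move \<epsilon> (state i) (state (Suc i))"
      unfolding pair_move_def st st' u using f1 f2 gap l by (simp add: field_simps)
    then show ?thesis using False by simp
  qed
qed

text \<open>The edge from 1 to 2 is itself a bridge, so the next even cut cannot be one.\<close>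

lemma bridge_0: "\<not> bridge 0"
  using no_adjacent_bridges[of 3] n by (auto simp: bridge_def cut_2)

lemma bridge_Suc:
  assumes "2 * i + 6 < n" "bridge i"
  shows "\<not> bridge (Suc i)"
proof
  assume "bridge (Suc i)"
  moreover have e: "2 * i + 5 - 1 = 2 * i + 4" "Suc (2 * i + 5) = 2 * Suc i + 4" by simp_all
  ultimately show False
    using assms(2) no_adjacent_bridges[of "2 * i + 5", unfolded e] assms(1) unfolding bridge_def by fastforce
qed

lemma state_0:
  assumes "X 0 = 1"
  shows "state 0 = chain_start \<epsilon>"
proof -
  have "X 1 = 3 - \<epsilon>" using eigen[of 0] n assms unfolding R0 by simp
  moreover have "X 0 + X 2 = (3 - \<epsilon>) * X 1" using eigen[of 1] n unfolding R1 by simp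
  ultimately have X: "X 1 = 3 - \<epsilon>" "X 2 = (3 - \<epsilon>)^2 - 1" using assms by (auto simp: power2_eq_square)
  have "flow 2 = X 2 - X 1" by (simp add: flow_def cut_2)
  moreover have "flow 3 = flow 2 - \<epsilon> * X 2" using flow_step[of 2] n by (simp add: numeral_eq_Suc)
  ultimately have "flow 3 = (1 - \<epsilon>) * ((3 - \<epsilon>)^2 - 1) - (3 - \<epsilon>)" unfolding X by (simp add: algebra_simps)
  moreover have "upper 3 = X 2" by (simp add: upper_def cut_2)
  ultimately show ?thesis by (simp add: state_def chain_start_def X)
qed

text \<open>The last two vertices share at most one edge, so each has at least two edges down across
  the cut \<open>p\<close>, with distinct lower ends whose values sum to at most
  \<open>X (p - 2) + X (p - 1)\<close>. This bounds the flow from below, while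
  \<open>flow_eq\<close> gives it exactly.\<close>

lemma state_end:
  assumes M: "n = 2 * M + 5"
  shows "snd (state M) * (1 - \<epsilon>/2) \<le> 2 * \<epsilon> * fst (state M)"
proof -
  define p where "p = n - 2"
  define q where "q = n - 1"
  have pq: "p < n" "q < n" "q = Suc p" "5 \<le> p" "n = Suc (Suc p)" using n by (auto simp: p_def q_def)
  have "2 * M + 3 = p" using M by (simp add: p_def)
  then have st: "state M = (upper p, flow p)" unfolding state_def by (simp only:)
  have fl: "flow p = \<epsilon> * (X p + X q)"
  proof -
    have "{p..<n} = {p, q}" using pq by auto
    then show ?thesis using flow_eq[of p] pq by simp
  qed
  have two: "\<exists>a b. a \<noteq> b \<and> (a, t) \<in> level_cut p \<and> (b, t) \<in> level_cut p" if "t = p \<or> t = q" for t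
  proof -
    have "card (R `` {t}) = 3" using deg3[of t] that pq by (auto simp: vdegree_def)
    define t' where "t' = (if t = p then q else p)"
    have "2 \<le> card (R `` {t} - {t'})"
      using \<open>card (R `` {t}) = 3\<close> card_Diff1_le[of "R `` {t}" t'] finite_nbrs[of t]
      by (cases "t' \<in> R `` {t}") (auto simp: card_Diff_singleton)
    then obtain S where "S \<subseteq> R `` {t} - {t'}" "card S = 2" by (meson obtain_subset_with_card_n)
    then obtain a b where ab: "a \<noteq> b" "{a, b} \<subseteq> R `` {t} - {t'}" by (auto simp: card_2_iff)
    have "(c, t) \<in> level_cut p" if "c \<in> {a, b}" for c
    proof -
      have c: "(t, c) \<in> R" "c \<noteq> t'" using ab that by auto
      then have "c \<noteq> t" "c < n" using lt_n[OF c(1)] by auto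
      then have "c < p" using c \<open>t = p \<or> t = q\<close> pq by (auto simp: t'_def split: if_splits)
      then show ?thesis using R_sym[OF c(1)] \<open>t = p \<or> t = q\<close> pq by (auto simp: level_cut_def)
    qed
    then show ?thesis using ab by blast
  qed
  obtain a b where ab: "a \<noteq> b" "(a, p) \<in> level_cut p" "(b, p) \<in> level_cut p" using two by blast
  obtain c d where cd: "c \<noteq> d" "(c, q) \<in> level_cut p" "(d, q) \<in> level_cut p" using two by blast
  have sum2: "X a + X b \<le> X (p - 2) + X (p - 1)" if "a \<noteq> b" "a < p" "b < p" for a b
  proof -
    have "a \<le> p - 2 \<and> b \<le> p - 1 \<or> b \<le> p - 2 \<and> a \<le> p - 1" using that by arith
    moreover have "p - 1 < n" "p - 2 < n" using pq by auto
    ultimately show ?thesis using mono[of a "p - 2"] mono[of b "p - 1"] mono[of b "p - 2"] mono[of a "p - 1"] by auto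
  qed
  have "(\<Sum>(a, b)\<in>{(a, p), (b, p), (c, q), (d, q)}. X b - X a) \<le> flow p"
    using ab cd by (intro flow_ge) auto
  then have "2 * X p + 2 * X q - (X a + X b) - (X c + X d) \<le> flow p"
    using ab cd pq by (simp add: algebra_simps)
  moreover have "X a + X b \<le> X (p - 2) + X (p - 1)" "X c + X d \<le> X (p - 2) + X (p - 1)"
    using ab cd sum2[of a b] sum2[of c d] unfolding level_cut_def by blast+
  moreover have "(X (p - 2) + X (p - 1)) / 2 \<le> upper p"
    using mono[of "p - 2" "p - 1"] pq by (auto simp: upper_def)
  ultimately have "2 * (X p + X q) - 4 * upper p \<le> flow p" by (simp add: field_simps)
  then have "\<epsilon> * (2 * (X p + X q) - 4 * upper p) \<le> \<epsilon> * flow p" using eps by simp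
  then have "2 * flow p - 4 * \<epsilon> * upper p \<le> \<epsilon> * flow p" unfolding fl by (simp add: algebra_simps)
  then show ?thesis by (simp add: st algebra_simps)
qed

lemma diamond_gain:
  assumes "X 0 = 1" and "n = 4 * K + r + 1" and "r = 4 \<and> \<epsilon> \<le> 2/25 \<or> r = 6 \<and> \<epsilon> \<le> 3/47"
  shows "\<exists>J\<le>K. let (a, F) = (step_diamond \<epsilon> ^^ J) (1, 1 - \<epsilon>); \<rho> = real r + 4 * real (K - J)
           in 0 < \<rho> * \<epsilon> * (a + F/2)^2 - F^2/2 - a * F"
proof (rule deficient_chain_gain[where s = state and br = bridge and M = "(n - 5) div 2"])
  have M: "n = 2 * ((n - 5) div 2) + 5" using n assms by auto
  show "state 0 = chain_start \<epsilon>" using assms state_0 by simp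
  show "snd (state ((n - 5) div 2)) * (1 - \<epsilon>/2) \<le> 2 * \<epsilon> * fst (state ((n - 5) div 2))"
    using M by (rule state_end)
  show "0 < fst (state i) \<and> 0 < snd (state i)" if "i \<le> (n - 5) div 2" for i
    using that M by (intro state_pos) simp
  show "if bridge i then bridge_move \<epsilon> (state i) (state (Suc i)) else pair_move \<epsilon> (state i) (state (Suc i))"
    if "i < (n - 5) div 2" for i using that M by (intro state_move) linarith
  show "\<not> bridge (Suc i)" if "Suc i < (n - 5) div 2" "bridge i" for i
    using that M by (intro bridge_Suc) linarith+
  show "(n - 5) div 2 = 2 * K \<and> real r = 4 \<and> \<epsilon> \<le> 2/25 \<or> (n - 5) div 2 = Suc (2 * K) \<and> real r = 6 \<and> \<epsilon> \<le> 3/47"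
    using assms by auto
qed (use eps bridge_0 in auto)

end

section \<open>Excluding degrees 2 and 1, and the degree sequence\<close>

context extremal_cubic
begin

text \<open>Fixes the first three vertices of the sorted order. Another minimizer of
  \<open>x\<close> outside \<open>u\<close> and \<open>v\<close> would have three neighbours of at
  least its own value, against \<open>\<mu> < 3\<close>.\<close>

lemma deficient_pair_2_1_start:
  assumes uv: "u \<in> V" "v \<in> V" "u \<noteq> v" "vdegree E u = 2" "E `` {v} = {u}"
    and other: "\<And>z. z \<in> V \<Longrightarrow> z \<noteq> u \<Longrightarrow> z \<noteq> v \<Longrightarrow> vdegree E z = 3"
    and n: "8 \<le> card V"
  obtains w where "w \<in> V" "w \<noteq> u" "w \<noteq> v" "E `` {u} = {v, w}" "x v \<le> x u" "x u \<le> x w"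
    "\<And>z. z \<in> V \<Longrightarrow> z \<noteq> u \<Longrightarrow> z \<noteq> v \<Longrightarrow> x w \<le> x z"
proof -
  have vu: "(u, v) \<in> E" using uv(5) by (blast intro: symD[OF sym_E])
  obtain w where Nu: "E `` {u} = {v, w}" "v \<noteq> w" using nbrs_2[OF uv(4) vu] by blast
  have w: "w \<in> V" "w \<noteq> u" using Nu by (auto dest: edge_in_V)
  define m where "m = real (card V)"
  have m: "8 \<le> m" using n by (simp add: m_def)
  have mu2: "2 < \<mu>"
  proof -
    have "(\<Sum>z\<in>V. vdegree E z) = (\<Sum>z\<in>V - {u, v}. vdegree E z) + 3"
      using uv finite_V by (simp add: sum.remove[of V u] sum.remove[of "V - {u}" v] Diff_insert2[symmetric] vdegree_def)
    also have "(\<Sum>z\<in>V - {u, v}. vdegree E z) = 3 * (card V - 2)"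
      using uv finite_V by (simp add: other card_Diff_subset)
    finally have "real (card E) = 3 * m - 3" using sum_vdegree n by (simp add: m_def)
    then have "3 * m - 3 \<le> \<mu> * m" using average_degree by (simp add: m_def)
    moreover have "\<mu> * m \<le> 2 * m" if "\<mu> \<le> 2" using that m by (intro mult_right_mono) auto
    ultimately show ?thesis using m by linarith
  qed
  have xu: "x u = \<mu> * x v" using eigen[OF uv(2)] uv(5) by simp
  have xw: "x v + x w = \<mu> * x u" using eigen[OF uv(1)] Nu by simp
  have le1: "x v \<le> x u" unfolding xu using mu2 x_pos[OF uv(2)] by simp
  have "2 * x u \<le> \<mu> * x u" using mu2 x_pos[OF uv(1)] by simp
  then have le2: "x u \<le> x w" using xw le1 by simp
  let ?W = "V - {u, v}"
  have W: "finite ?W" "?W \<noteq> {}" using finite_V w Nu by auto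
  obtain z where z: "z \<in> ?W" "\<And>y. y \<in> ?W \<Longrightarrow> x z \<le> x y"
    using ex_min_if_finite[of "x ` ?W"] W by (auto simp: not_less)
  have "z = w"
  proof (rule ccontr)
    assume zw: "z \<noteq> w"
    have "E `` {z} \<subseteq> ?W"
    proof
      fix y assume "y \<in> E `` {z}"
      then have y: "(z, y) \<in> E" "(y, z) \<in> E" by (auto intro: symD[OF sym_E])
      have "y \<noteq> u"
      proof
        assume "y = u"
        then have "z \<in> {v, w}" using y Nu by blast
        then show False using z zw by auto
      qed
      moreover have "y \<noteq> v"
      proof
        assume "y = v"
        then have "z \<in> {u}" using y uv(5) by blast
        then show False using z by auto
      qed
      ultimately show "y \<in> ?W" using y by (auto dest: edge_in_V)
    qed
    then have "(\<Sum>y\<in>E `` {z}. x z) \<le> (\<Sum>y\<in>E `` {z}. x y)" using z by (intro sum_mono) auto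
    moreover have "vdegree E z = 3" using other z by auto
    ultimately have "3 * x z \<le> \<mu> * x z" using eigen[of z] z by (simp add: vdegree_def)
    then show False using mu_less_3 x_pos[of z] z by simp
  qed
  then have "\<And>y. y \<in> V \<Longrightarrow> y \<noteq> u \<Longrightarrow> y \<noteq> v \<Longrightarrow> x w \<le> x y" using z by auto
  then show thesis using that[of w] w Nu le1 le2 by auto
qed

lemma no_deficient_pair_2_1:
  assumes uv: "u \<in> V" "v \<in> V" "u \<noteq> v" "vdegree E u = 2" "E `` {v} = {u}"
    and other: "\<And>z. z \<in> V \<Longrightarrow> z \<noteq> u \<Longrightarrow> z \<noteq> v \<Longrightarrow> vdegree E z = 3"
    and n8: "8 \<le> card V"
  shows False
proof -
  obtain w where w: "w \<in> V" "w \<noteq> u" "w \<noteq> v" "E `` {u} = {v, w}" "x v \<le> x u" "x u \<le> x w"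
    and wmin: "\<And>z. z \<in> V \<Longrightarrow> z \<noteq> u \<Longrightarrow> z \<noteq> v \<Longrightarrow> x w \<le> x z"
  proof (rule deficient_pair_2_1_start[OF uv _ n8])
    show "\<And>z. z \<in> V \<Longrightarrow> z \<noteq> u \<Longrightarrow> z \<noteq> v \<Longrightarrow> vdegree E z = 3" by (rule other)
  qed (rule that)
  define n where "n = card V"
  define \<epsilon> where "\<epsilon> = 3 - \<mu>"
  have eps: "0 < \<epsilon>" and mu: "\<mu> = 3 - \<epsilon>" using mu_less_3 by (simp_all add: \<epsilon>_def)
  \<comment> \<open>Degrees 2 and 1 force odd \<open>n\<close> by the handshake lemma, and 9 instead
    of 8 vertices are needed for the bound on \<epsilon>.\<close>
  have n: "odd n" "9 \<le> n"
  proof -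
    have "(\<Sum>z\<in>V. vdegree E z) = (\<Sum>z\<in>V - {u, v}. vdegree E z) + 3"
      using uv finite_V by (simp add: sum.remove[of V u] sum.remove[of "V - {u}" v] Diff_insert2[symmetric] vdegree_def)
    also have "(\<Sum>z\<in>V - {u, v}. vdegree E z) = 3 * (n - 2)"
      using uv finite_V by (simp add: other card_Diff_subset n_def)
    finally have "even (3 * (n - 2) + 3)" using even_card_E sum_vdegree by simp
    then show "odd n" using n8 by (auto simp: n_def)
    then show "9 \<le> n" using n8 by (cases "n = 8") (auto simp: n_def)
  qed
  obtain rest where rest: "set rest = V - {v, u, w}" "distinct rest"
    using finite_distinct_list[of "V - {v, u, w}"] finite_V by auto
  define ws where "ws = v # u # w # sort_key x rest"
  have ws: "set ws = V" "distinct ws" using rest uv w by (auto simp: ws_def)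
  have len: "length ws = n" using distinct_card[OF ws(2)] ws(1) by (simp add: n_def)
  have sorted: "sorted (map x ws)"
  proof -
    have "x w \<le> x z \<and> x u \<le> x z \<and> x v \<le> x z" if "z \<in> set rest" for z
      using wmin[of z] that rest w(5,6) by auto
    then show ?thesis using w(5,6) by (simp add: ws_def)
  qed
  define p where "p = (\<lambda>i. ws ! i)"
  have p: "bij_betw p {..<n} V"
    unfolding p_def using bij_betw_nth[OF ws(2)] ws(1) len by auto
  have p0: "p 0 = v" "p 1 = u" "p 2 = w" by (simp_all add: p_def ws_def)
  have inj: "p i = p j \<longleftrightarrow> i = j" if "i < n" "j < n" for i j
    using p that by (auto simp: bij_betw_def inj_on_def)
  have pV: "p i \<in> V" if "i < n" for i using p that by (auto simp: bij_betw_def)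
  have surj: "\<exists>i<n. p i = z" if "z \<in> V" for z using p that by (auto simp: bij_betw_def image_iff)
  define R where "R = {(i, j). i < n \<and> j < n \<and> (p i, p j) \<in> E}"
  have bijR: "bij_betw p (R `` {i}) (E `` {p i})" if "i < n" for i
    unfolding bij_betw_def
  proof
    show "inj_on p (R `` {i})" using inj by (auto simp: R_def inj_on_def)
    show "p ` (R `` {i}) = E `` {p i}"
    proof (intro equalityI subsetI)
      fix z assume z: "z \<in> E `` {p i}"
      then have "z \<in> V" by (auto dest: edge_in_V)
      then obtain j where "j < n" "p j = z" using surj by blast
      then show "z \<in> p ` (R `` {i})" using z that by (auto simp: R_def)
    qed (auto simp: R_def)
  qed
  have degR: "vdegree R i = vdegree E (p i)" if "i < n" for i
    unfolding vdegree_def by (rule bij_betw_same_card[OF bijR[OF that]])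
  have imR: "R `` {i} = {j. j < n \<and> p j \<in> E `` {p i}}" if "i < n" for i using that by (auto simp: R_def)
  \<comment> \<open>Scaled to value 1 at the pendant vertex, as in
    \<open>chain_start\<close>.\<close>
  define X where "X = (\<lambda>i. x (p i) / x v)"
  have xv: "0 < x v" using x_pos uv by simp
  interpret R: sorted_cubic n R X \<epsilon>
  proof
    show "finite {..<n}" by simp
    show "R \<subseteq> {..<n} \<times> {..<n}" by (auto simp: R_def)
    show "sym R" by (auto simp: R_def sym_def intro: symD[OF sym_E])
    show "irrefl R" by (auto simp: R_def irrefl_def)
    show "connected_graph {..<n} R"
      unfolding connected_graph_def
    proof (intro conjI allI impI)
      show "{..<n} \<noteq> {}" using n by (auto simp: lessThan_empty_iff)
      fix S assume S: "S \<subseteq> {..<n}" "S \<noteq> {} \<and> R `` S \<subseteq> S"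
      have "p ` S = V"
      proof (rule connected_graphD[OF conn])
        show "p ` S \<subseteq> V" using S pV by auto
        show "p ` S \<noteq> {}" using S by simp
        fix a b assume ab: "(a, b) \<in> E" "a \<in> p ` S"
        then obtain i where i: "i \<in> S" "a = p i" by auto
        have "b \<in> V" using ab by (auto dest: edge_in_V)
        then obtain j where j: "j < n" "p j = b" using surj by blast
        have "(i, j) \<in> R" using i j ab S by (auto simp: R_def)
        then have "j \<in> S" using S i by blast
        then show "b \<in> p ` S" using j by blast
      qed
      then have "card (p ` S) = n" by (simp add: n_def)
      then have "n \<le> card S" using card_image_le[of S p] finite_subset[OF S(1)] by simp
      then show "S = {..<n}" using S(1) by (intro card_seteq) auto
    qed
    show "7 \<le> n" "odd n" using n by auto
    show "X i \<le> X j" if "i \<le> j" "j < n" for i j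
      using sorted_nth_mono[OF sorted that(1)] that len xv by (simp add: X_def p_def divide_right_mono)
    show "0 < X i" if "i < n" for i using x_pos[OF pV[OF that]] xv by (simp add: X_def)
    show "(\<Sum>j\<in>R `` {i}. X j) = (3 - \<epsilon>) * X i" if "i < n" for i
    proof -
      have "(\<Sum>j\<in>R `` {i}. X j) = (\<Sum>z\<in>E `` {p i}. x z / x v)"
        unfolding X_def by (rule sum.reindex_bij_betw[OF bijR[OF that]])
      also have "\<dots> = (\<Sum>z\<in>E `` {p i}. x z) / x v" by (simp add: sum_divide_distrib)
      finally show ?thesis using eigen[OF pV[OF that]] by (simp add: X_def mu)
    qed
    show "0 < \<epsilon>" by (rule eps)
    have ie: "p j = v \<longleftrightarrow> j = 0" "p j = u \<longleftrightarrow> j = 1" "p j = w \<longleftrightarrow> j = 2" if "j < n" for j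
      using inj[OF that, of 0] inj[OF that, of 1] inj[OF that, of 2] n p0 by auto
    show "R `` {0} = {1}" using n ie by (subst imR) (auto simp: p0 uv(5))
    show "R `` {1} = {0, 2}" 
    proof -
      have "R `` {1} = {j. j < n \<and> p j \<in> {v, w}}" using imR[of 1] n unfolding p0 w(4) by simp
      also have "\<dots> = {0, 2}" using n p0 ie by auto
      finally show ?thesis .
    qed
    show "vdegree R i = 3" if "2 \<le> i" "i < n" for i
      using degR[OF that(2)] other[OF pV[OF that(2)]] ie[OF that(2)] that by auto
  qed
  have X0: "X 0 = 1" using xv by (simp add: X_def p0)
  obtain K r where Kr: "n = 4 * K + r + 1" "r = 4 \<or> r = 6" "r = 6 \<longrightarrow> 11 \<le> n"
  proof -
    have "n mod 4 = 1 \<or> n mod 4 = 3" using n by presburger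
    then show thesis
    proof
      assume m: "n mod 4 = 1"
      have "n = 4 * ((n - 5) div 4) + 4 + 1" using m n by presburger
      then show thesis using that[of "(n - 5) div 4" 4] by simp
    next
      assume m: "n mod 4 = 3"
      have "n = 4 * ((n - 7) div 4) + 6 + 1" "11 \<le> n" using m n by presburger+
      then show thesis using that[of "(n - 7) div 4" 6] by simp
    qed
  qed
  obtain tail where tail: "rooted r tail" using Kr rooted_tail4 rooted_tail6 by blast
  obtain H where H: "rooted (r + 4 * K) H" and chain: "\<forall>\<epsilon> a F m. \<forall>j\<le>K. \<exists>y. y (r + 4 * K) = a \<and>
    (let (b, G) = (step_diamond \<epsilon> ^^ j) (a, F)
     in rayleigh_gap \<epsilon> (r + 4 * K) H y + a * ((1 - \<epsilon>) * a - F)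
       = (real r + 4 * real (K - j)) * \<epsilon> * (m b G)^2 - 2 * (m b G - b)^2 - b * G)"
    using diamond_chain_graph[OF tail, of K] by (elim exE conjE)
  have cV: "card V = (r + 4 * K) + 1" using Kr by (simp add: n_def)
  have gap: "rayleigh_gap \<epsilon> (r + 4 * K) H y \<le> 0" for y
    using rooted_gap_nonpos[OF H cV] Kr by (auto simp: \<epsilon>_def)
  \<comment> \<open>Test vector 1 with \<open>a\<close> at the root;
    \<open>F = (1 - \<epsilon>) * a\<close> makes the boundary term vanish. Up to a term in
    \<epsilon> the loss is \<open>2 * (1 - a)^2 + a^2\<close>, which is smallest at
    \<open>a = 2/3\<close>.\<close>
  have e: "\<epsilon> * (real (r + 4 * K) + 4/9) \<le> 2/3"
    using rooted_plateau[OF H, of \<epsilon> 1 "2/3" "(1 - \<epsilon>) * (2/3)"] gap[of "(\<lambda>_. 1)(r + 4 * K := 2/3)"]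
    by (simp add: field_simps power2_eq_square)
  \<comment> \<open>There are at least 8 or at least 10 vertices besides the root, and the bound
    becomes 3/38, which is less than 2/25, or exactly 3/47.\<close>
  have "r = 4 \<and> \<epsilon> \<le> 2/25 \<or> r = 6 \<and> \<epsilon> \<le> 3/47"
  proof (cases "r = 4")
    case True
    have "\<epsilon> * (8 + 4/9) \<le> \<epsilon> * (real (r + 4 * K) + 4/9)" using eps n Kr by (intro mult_left_mono) auto
    then show ?thesis using e True by simp
  next
    case False
    then have "10 \<le> r + 4 * K" using Kr by auto
    then have "10 \<le> real (r + 4 * K)" by linarith
    then have "\<epsilon> * (10 + 4/9) \<le> \<epsilon> * (real (r + 4 * K) + 4/9)" using eps by (intro mult_left_mono) auto
    then show ?thesis using e False Kr by simp
  qed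
  then obtain J where J: "J \<le> K" "let (a, F) = (step_diamond \<epsilon> ^^ J) (1, 1 - \<epsilon>); \<rho> = real r + 4 * real (K - J)
           in 0 < \<rho> * \<epsilon> * (a + F/2)^2 - F^2/2 - a * F"
    using R.diamond_gain[OF X0 Kr(1)] by blast
  obtain b G where bG: "(step_diamond \<epsilon> ^^ J) (1, 1 - \<epsilon>) = (b, G)" by (cases "(step_diamond \<epsilon> ^^ J) (1, 1 - \<epsilon>)")
  \<comment> \<open>The start state \<open>(1, 1 - \<epsilon>)\<close> is a root without a further
    neighbour, so its boundary term is 0. The plateau value is the one of
    \<open>plateau_gain\<close>.\<close>
  obtain y where "rayleigh_gap \<epsilon> (r + 4 * K) H y + 1 * ((1 - \<epsilon>) * 1 - (1 - \<epsilon>))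
       = (real r + 4 * real (K - J)) * \<epsilon> * (b + G/2)^2 - 2 * (b + G/2 - b)^2 - b * G"
    using chain[rule_format, OF J(1), of 1 \<epsilon> "1 - \<epsilon>" "\<lambda>b G. b + G/2"] unfolding bG Let_def prod.case by (elim exE conjE)
  then have "rayleigh_gap \<epsilon> (r + 4 * K) H y = (real r + 4 * real (K - J)) * \<epsilon> * (b + G/2)^2 - G^2/2 - b * G"
    by (simp add: power2_eq_square)
  also have "\<dots> > 0" using J(2) unfolding bG Let_def prod.case .
  finally show False using gap[of y] by simp
qed

lemma unique_deficient:
  assumes n: "8 \<le> card V" and v: "v \<in> V" "vdegree E v < 3" and u: "u \<in> V" "u \<noteq> v"
  shows "vdegree E u = 3"
proof (rule ccontr)
  assume "vdegree E u \<noteq> 3"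
  then have du: "vdegree E u < 3" using deg_le[OF u(1)] by simp
  have no22: False if "a \<in> V" "b \<in> V" "a \<noteq> b" "vdegree E a = 2" "vdegree E b = 2"
    "\<And>z. z \<in> V \<Longrightarrow> z \<noteq> a \<Longrightarrow> z \<noteq> b \<Longrightarrow> vdegree E z = 3" for a b
  proof (cases "x b \<le> x a")
    case True
    show False by (rule no_deficient_pair_2_2[OF that(1-5) _ True]) (use that(6) n in simp_all)
  next
    case False
    then have le: "x a \<le> x b" by simp
    show False
      by (rule no_deficient_pair_2_2[OF that(2,1) that(3)[symmetric] that(5,4) _ le]) (use that(6) n in simp_all)
  qed
  have adj: "(a, b) \<in> E" if "a \<in> V" "b \<in> V" "a \<noteq> b" "vdegree E a < 3" "vdegree E b < 3" for a b
  proof (rule ccontr)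
    assume nab: "(a, b) \<notin> E"
    note nd = nonadjacent_deficient[OF that(1-3) nab that(4,5)]
    show False by (rule no22[OF that(1-3) nd(1,2)]) (rule nd(3))
  qed
  have closed: False if "S \<subseteq> V" "S \<noteq> {}" "card S < 8" "\<And>a. a \<in> S \<Longrightarrow> E `` {a} \<subseteq> S" for S
  proof -
    have "S = V" by (rule connected_graphD[OF conn that(1,2)]) (use that(4) in blast)
    then show False using that(3) n by simp
  qed
  have uv: "(u, v) \<in> E" "(v, u) \<in> E" using adj u v du by auto
  have other: "vdegree E z = 3" if z: "z \<in> V" "z \<noteq> u" "z \<noteq> v" for z
  proof (rule ccontr)
    assume "vdegree E z \<noteq> 3"
    then have dz: "vdegree E z < 3" using deg_le[OF z(1)] by simp
    \<comment> \<open>Deficient vertices are pairwise adjacent, so three of them would have no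
      neighbours but each other and form a component.\<close>
    have nb: "E `` {a} \<subseteq> {b, c}" if "a \<in> V" "b \<in> V" "c \<in> V" "a \<noteq> b" "a \<noteq> c" "b \<noteq> c"
      "vdegree E a < 3" "vdegree E b < 3" "vdegree E c < 3" for a b c
    proof -
      have "{b, c} \<subseteq> E `` {a}" using adj that by auto
      moreover have "card (E `` {a}) \<le> card {b, c}" using that by (simp add: vdegree_def)
      ultimately have "{b, c} = E `` {a}" using finite_nbrs by (intro card_seteq)
      then show ?thesis by simp
    qed
    show False
    proof (rule closed[of "{u, v, z}"])
      show "card {u, v, z} < 8" by (simp add: card_insert_if)
      fix a assume "a \<in> {u, v, z}"
      then show "E `` {a} \<subseteq> {u, v, z}"
        using nb[of u v z] nb[of v u z] nb[of z u v] u v z du dz by auto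
    qed (use u v z in auto)
  qed
  have ge1: "1 \<le> vdegree E u" "1 \<le> vdegree E v"
    using uv finite_nbrs by (auto simp: vdegree_def Suc_le_eq card_gt_0_iff)
  have single: "E `` {a} = {b}" if "vdegree E a = 1" "(a, b) \<in> E" for a b
  proof -
    obtain c where "E `` {a} = {c}" using \<open>vdegree E a = 1\<close> by (auto simp: vdegree_def card_1_singleton_iff)
    moreover have "b \<in> E `` {a}" using \<open>(a, b) \<in> E\<close> by blast
    ultimately show ?thesis by simp
  qed
  consider "vdegree E u = 1" "vdegree E v = 1" | "vdegree E u = 2" "vdegree E v = 1"
    | "vdegree E u = 1" "vdegree E v = 2" | "vdegree E u = 2" "vdegree E v = 2"
    using ge1 du v by linarith
  then show False
  proof cases
    case 1
    show False
    proof (rule closed[of "{u, v}"])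
      fix a assume "a \<in> {u, v}"
      then show "E `` {a} \<subseteq> {u, v}" using single[OF 1(1) uv(1)] single[OF 1(2) uv(2)] by auto
    qed (use u v in \<open>auto simp: card_insert_if\<close>)
  next
    case 2
    show False
      by (rule no_deficient_pair_2_1[OF u(1) v(1) u(2) 2(1) single[OF 2(2) uv(2)] _ n]) (rule other)
  next
    case 3
    show False
      by (rule no_deficient_pair_2_1[OF v(1) u(1) u(2)[symmetric] 3(2) single[OF 3(1) uv(1)] _ n]) (rule other)
  next
    case 4
    show False by (rule no22[OF u(1) v(1) u(2) 4]) (rule other)
  qed
qed

lemma degree_sequence:
  assumes n: "8 \<le> card V"
  shows "\<exists>v\<in>V. vdegree E v = (if odd (card V) then 2 else 1) \<and> (\<forall>u\<in>V - {v}. vdegree E u = 3)"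
proof -
  obtain v where v: "v \<in> V" "vdegree E v < 3" using comp by (auto simp: competitor_def)
  have other: "\<forall>u\<in>V - {v}. vdegree E u = 3" using unique_deficient[OF n v] by auto
  have "vdegree E v \<noteq> 0"
  proof
    assume "vdegree E v = 0"
    then have e: "E `` {v} = {}" using finite_nbrs by (simp add: vdegree_def)
    have "{v} = V" by (rule connected_graphD[OF conn]) (use v e in auto)
    then have "card V = 1" by (metis card_1_singleton_iff One_nat_def)
    then show False using n by simp
  qed
  \<comment> \<open>Degree 0 is excluded by connectivity, so the parity of the degree sum decides
    between 1 and 2.\<close>
  moreover have "even (3 * (card V - 1) + vdegree E v)"
  proof -
    have "(\<Sum>z\<in>V. vdegree E z) = vdegree E v + (\<Sum>z\<in>V - {v}. vdegree E z)"
      using v finite_V by (simp add: sum.remove)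
    also have "(\<Sum>z\<in>V - {v}. vdegree E z) = 3 * (card V - 1)" using other v finite_V by simp
    finally show ?thesis using even_card_E sum_vdegree by (simp add: add.commute)
  qed
  ultimately have "vdegree E v = (if odd (card V) then 2 else 1)"
    using v n by (cases "vdegree E v = 1"; cases "vdegree E v = 2") auto
  then show ?thesis using v other by blast
qed

end

theorem theorem4p4:
  fixes G :: "'a pair_pre_digraph" and n \<delta> :: nat
  assumes "n \<ge> 8"
    and "attains_max_spectral_radius n 3 G"
    and "\<delta> = (if odd n then 2 else 1)"
  shows "\<exists>v\<in>pverts G. out_degree (with_proj G) v = \<delta> \<and>
    (\<forall>u\<in>pverts G - {v}. out_degree (with_proj G) u = 3)"
proof -
  obtain x \<mu> where ext: "extremal_cubic (pverts G) (parcs G) x \<mu>" and n: "card (pverts G) = n"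
    using assms(2) by (rule attains_max_extremal_cubic)
  interpret extremal_cubic "pverts G" "parcs G" x \<mu> by (rule ext)
  show ?thesis
    using degree_sequence assms(1,3) unfolding n out_degree_with_proj by simp
qed

end
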